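(* Let $\lambda_1,\dots,\lambda_N$ be the eigenvalues of the pencil $\mathcal A(\lambda)$ in $Q(\beta_1,\beta_2)$, let $\varphi^k_{j,m}$, $\psi^k_{j,m}$ be the corresponding biorthogonally normalized Jordan chains, and for a function $u$ of $t\in\mathbb R$ with values in $Y$ put $u^k_{j,m}(t)=(u(t),\psi^k_{j,m}(t))$ and $$\mathcal P u(t)=\sum_{k=1}^N\sum_{j=1}^{J_k}\sum_{m=0}^{m_{k,j}-1}u^k_{j,m}(t)\,\varphi^k_{j,m_{k,j}-1-m}(t),\qquad t\in\mathbb R ,$$ where $\mathcal P(t)$ denotes the evaluation of this operator at $t$. Then: (i) $\mathcal P(t)$ is a projector for every $t\in\mathbb R$; (ii) $\mathcal L\mathcal P u=\mathcal P\mathcal L u$ for all $u\in\mathcal X_{\rm loc}$; (iii) for all $u\in\mathcal X_{\rm loc}$, $$\mathcal L\mathcal P u=\sum_{k=1}^N\sum_{j=1}^{J_k}\sum_{m=0}^{m_{k,j}-1}\Big((D_t-\lambda_k)u^k_{j,m}(t)-u^k_{j,m-1}(t)\Big)\varphi^k_{j,m_{k,j}-1-m}(t),$$ where $u^k_{j,-1}:=0$.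
   Context: Spaces. $X,Y$ are complex Hilbert spaces, $X$ compactly and densely embedded in $Y$; $(\cdot,\cdot)$ is the inner product of $Y$ (linear in the first argument), $Y^*$ is identified with $Y$, and $X^*\supset Y$ is the completion of $Y$ in the norm $\|h\|_{X^*}=\sup\{|(g,h)|:g\in X,\|g\|_X=1\}$; $(\cdot,\cdot)$ extends to $X\times X^*$. $D_t=\partial/\partial t$. For $a<b$, $\mathcal X(a,b)$ is the space of $u:(a,b)\to X$ with weak derivative $D_tu$ valued in $Y$ and finite norm $\big(\int_a^b(\|u(t)\|_X^2+\|D_tu(t)\|_Y^2)dt\big)^{1/2}$, and $\mathcal Y(a,b)=L^2((a,b);Y)$. $\mathcal X_{\rm loc}$, $\mathcal Y_{\rm loc}$ are the functions on $\mathbb R$ whose restrictions to all bounded $(a,b)$ lie in $\mathcal X(a,b)$, resp. $\mathcal Y(a,b)$. $\widehat{\mathcal X}\subset\mathcal X_{\rm loc}$, $\widehat{\mathcal Y}\subset\mathcal Y_{\rm loc}$ are the subspaces of 1-periodic functions with the norms of $\mathcal X(0,1)$, $\mathcal Y(0,1)$; $(u,v)_{\widehat{\mathcal Y}}=\int_0^1(u(t),v(t))\,dt$. Operator. $A(t):X\to Y$ is bounded, 1-periodic and norm-continuous in $t\in\mathbb R$; $A(t)^*:Y\to X^*$ is its adjoint with respect to $(\cdot,\cdot)$. $\mathcal L=\mathcal L(t,D_t)=D_t+A(t)$, and $\mathcal A(\lambda)=\mathcal L(t,D_t)+\lambda:\widehat{\mathcal X}\to\widehat{\mathcal Y}$,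 $\lambda\in\mathbb C$. Standing assumptions: (a) there is $C$ with $\|u;\mathcal X(0,1)\|\le C(\|\mathcal Lu;\mathcal Y(-1,2)\|+\|u;\mathcal Y(-1,2)\|)$ for all $u\in\mathcal X(-1,2)$; (b) $\mathcal A(\lambda_0):\widehat{\mathcal X}\to\widehat{\mathcal Y}$ is an isomorphism for some $\lambda_0\in\mathbb C$. Then the spectrum of $\mathcal A$ consists of isolated eigenvalues ($\lambda$ with $\ker\mathcal A(\lambda)\ne\{0\}$) of finite algebraic multiplicity, and is invariant under $\lambda\mapsto\lambda+2\pi i$. Eigenvalues and chains. Real numbers $\beta_1<\beta_2$ are fixed such that there are no eigenvalues on $\delta_{\beta_1},\delta_{\beta_2}$, where $\delta_\beta=\{\lambda:\Re\lambda=\beta,\ \Im\lambda\in[0,2\pi)\}$. $\lambda_1,\dots,\lambda_N$ are the (distinct) eigenvalues in $Q(\beta_1,\beta_2)=\{\beta+i\xi:\beta_1<\beta<\beta_2,\ \xi\in[0,2\pi)\}$; $J_k$ is the geometric multiplicity of $\lambda_k$ and $m_{k,1},\dots,m_{k,J_k}$ its partial multiplicities. $\varphi^k_{j,m}\in\widehat{\mathcal X}$ ($j=1,\dots,J_k$, $m=0,\dots,m_{k,j}-1$) is a canonical system of Jordan chains for $\lambda_k$: $\mathcal A(\lambda_k)\varphi^k_{j,0}=0$, $\mathcal A(\lambda_k)\varphi^k_{j,m}=-\varphi^k_{j,m-1}$ for $m\ge1$, the $\varphi^k_{j,0}$ form a basis of $\ker\mathcal A(\lambda_k)$, and the chain lengths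 are the partial multiplicities (their sum is the algebraic multiplicity). $\psi^k_{j,m}\in\widehat{\mathcal Y}$ (same index range) are the uniquely determined Jordan chains of the adjoint pencil satisfying $(-D_t+A(t)^*+\overline{\lambda_k})\psi^k_{j,m}=-\psi^k_{j,m-1}$ in $\widehat{\mathcal X}^*$ (with $\psi^k_{j,-1}=0$), i.e. $(\mathcal A(\lambda_k)\varphi,\psi^k_{j,m})_{\widehat{\mathcal Y}}=-(\varphi,\psi^k_{j,m-1})_{\widehat{\mathcal Y}}$ for all $\varphi\in\widehat{\mathcal X}$, and normalized by $(\varphi^k_{j,m_{k,j}-1},\psi^k_{J,m})_{\widehat{\mathcal Y}}=\delta_j^J\delta_0^m$ for $m=0,\dots,m_{k,J}-1$, $j,J=1,\dots,J_k$. The operator $\mathcal P$ is taken to be well defined on $\mathcal Y_{\rm loc}$ and $\mathcal X_{\rm loc}$ (in the paper, by $|u^k_{j,m}(t)|\le C\|u(t)\|_Y$). A projector is an idempotent operator. *)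

theory Defs
  imports "HOL-Analysis.Analysis"
begin

section \<open>Complex Hilbert spaces\<close>

text \<open>The inner product \<open>cinner\<close> is linear in the first argument; the norm, metric and topology are
  those of the underlying real inner product, which is \<open>Re (cinner x y)\<close>.\<close>

class complex_hilbert = real_inner + banach +
  fixes scaleC :: "complex \<Rightarrow> 'a \<Rightarrow> 'a"  (infixr "*\<^sub>C" 75)
    and cinner :: "'a \<Rightarrow> 'a \<Rightarrow> complex"
  assumes scaleC_add_right: "c *\<^sub>C (x + y) = c *\<^sub>C x + c *\<^sub>C y"
    and scaleC_add_left: "(c + d) *\<^sub>C x = c *\<^sub>C x + d *\<^sub>C x"
    and scaleC_scaleC: "c *\<^sub>C (d *\<^sub>C x) = (c * d) *\<^sub>C x"
    and scaleR_eq_scaleC: "r *\<^sub>R x = complex_of_real r *\<^sub>C x"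
    and cinner_commute: "cinner x y = cnj (cinner y x)"
    and cinner_add_left: "cinner (x + y) z = cinner x z + cinner y z"
    and cinner_scaleC_left: "cinner (c *\<^sub>C x) y = c * cinner x y"
    and inner_eq_Re_cinner: "inner x y = Re (cinner x y)"

definition bounded_clinear :: "('a::complex_hilbert \<Rightarrow> 'b::complex_hilbert) \<Rightarrow> bool" where
  "bounded_clinear f \<longleftrightarrow> bounded_linear f \<and> (\<forall>c x. f (c *\<^sub>C x) = c *\<^sub>C f x)"

definition projector :: "('a::complex_hilbert \<Rightarrow> 'a) \<Rightarrow> bool" where
  "projector T \<longleftrightarrow> bounded_clinear T \<and> (\<forall>y. T (T y) = T y)"

definition compact_dense_embedding :: "('x::complex_hilbert \<Rightarrow> 'y::complex_hilbert) \<Rightarrow> bool" where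
  "compact_dense_embedding \<iota> \<longleftrightarrow>
     bounded_clinear \<iota> \<and> inj \<iota> \<and> compact (closure (\<iota> ` cball 0 1)) \<and> closure (range \<iota>) = UNIV"


section \<open>Functions of t modulo null sets\<close>

text \<open>The Bochner integral needs second countable spaces. For \<open>X\<close> and \<open>Y\<close> this sort constraint is no
  restriction: a compact dense embedding \<open>\<iota>\<close> has separable range, so \<open>Y\<close> is separable, and its
  adjoint is compact with dense range in \<open>X\<close> because \<open>\<iota>\<close> is injective.

  Elements of Lebesgue and Sobolev spaces are represented by functions on the real line, and
  all equalities between them are equalities almost everywhere.\<close>

definition ae_eq :: "(real \<Rightarrow> 'a) \<Rightarrow> (real \<Rightarrow> 'a) \<Rightarrow> bool" where
  "ae_eq f g \<longleftrightarrow> (AE t in lebesgue. f t = g t)"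

definition L2_on :: "real \<Rightarrow> real \<Rightarrow> (real \<Rightarrow> 'a::real_normed_vector) \<Rightarrow> bool" where
  "L2_on a b f \<longleftrightarrow> set_borel_measurable lebesgue {a<..<b} f \<and>
     set_integrable lebesgue {a<..<b} (\<lambda>t. (norm (f t))\<^sup>2)"

definition L2_norm_on :: "real \<Rightarrow> real \<Rightarrow> (real \<Rightarrow> 'a::real_normed_vector) \<Rightarrow> real" where
  "L2_norm_on a b f = sqrt (LINT t:{a<..<b}|lebesgue. (norm (f t))\<^sup>2)"

text \<open>Weak derivatives on an open set \<open>S\<close> of reals.\<close>

definition test_function :: "real set \<Rightarrow> (real \<Rightarrow> real) \<Rightarrow> bool" where
  "test_function S \<eta> \<longleftrightarrow> (\<forall>n t. (deriv ^^ n) \<eta> differentiable at t) \<and>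
     (\<exists>K. compact K \<and> K \<subseteq> S \<and> (\<forall>t. t \<notin> K \<longrightarrow> \<eta> t = 0))"

definition locally_integrable_on ::
    "(real \<Rightarrow> 'a::{banach,second_countable_topology}) \<Rightarrow> real set \<Rightarrow> bool" where
  "locally_integrable_on f S \<longleftrightarrow> (\<forall>K. compact K \<longrightarrow> K \<subseteq> S \<longrightarrow> set_integrable lebesgue K f)"

definition has_weak_deriv ::
    "real set \<Rightarrow> (real \<Rightarrow> 'a::{banach,second_countable_topology}) \<Rightarrow> (real \<Rightarrow> 'a) \<Rightarrow> bool" where
  "has_weak_deriv S u v \<longleftrightarrow> locally_integrable_on u S \<and> locally_integrable_on v S \<and>
     (\<forall>\<eta>. test_function S \<eta> \<longrightarrow>
        (LINT t:S|lebesgue. deriv \<eta> t *\<^sub>R u t) = - (LINT t:S|lebesgue. \<eta> t *\<^sub>R v t))"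

definition weakly_differentiable_on ::
    "(real \<Rightarrow> 'a::{banach,second_countable_topology}) \<Rightarrow> real set \<Rightarrow> bool" where
  "weakly_differentiable_on u S \<longleftrightarrow> (\<exists>v. has_weak_deriv S u v)"

text \<open>The weak derivative, determined up to a null subset of \<open>S\<close>.\<close>

definition Dt :: "real set \<Rightarrow> (real \<Rightarrow> 'a::{banach,second_countable_topology}) \<Rightarrow> real \<Rightarrow> 'a" where
  "Dt S u = (SOME v. has_weak_deriv S u v)"

text \<open>Pointwise values: a bounded Jordan chain of the adjoint pencil is in general only weakly
  continuous in \<open>Y\<close>, and the elements of \<open>\<X>\<^sub>l\<^sub>o\<^sub>c\<close> have representatives that are even continuous
  in \<open>Y\<close>. In both cases the value at every \<open>t\<close> is that of the unique weakly continuous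
  representative.\<close>

definition weakly_continuous :: "(real \<Rightarrow> 'a::complex_hilbert) \<Rightarrow> bool" where
  "weakly_continuous g \<longleftrightarrow> (\<forall>y. continuous_on UNIV (\<lambda>t. cinner (g t) y))"

definition wc_rep :: "(real \<Rightarrow> 'a::complex_hilbert) \<Rightarrow> real \<Rightarrow> 'a" where
  "wc_rep f = (THE g. weakly_continuous g \<and> ae_eq g f)"

lemma wc_rep_unique:
  assumes g: "weakly_continuous g" "ae_eq g f" and h: "weakly_continuous h" "ae_eq h f"
  shows "g = h"
proof
  fix t
  define d where "d s = cinner (g s) (g t - h t) - cinner (h s) (g t - h t)" for s
  have cont: "continuous_on UNIV d"
    using g(1) h(1) unfolding d_def weakly_continuous_def by (intro continuous_intros) auto
  have "AE s in lebesgue. d s = 0"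
    using g(2) h(2) unfolding ae_eq_def d_def by eventually_elim simp
  then have "negligible {s. d s \<noteq> 0}"
    by (simp add: negligible_iff_null_sets AE_iff_null_sets completion.AE_iff_null_sets
        eventually_ae_filter null_sets_completion_subset)
       (use null_sets_completion_subset in blast)
  moreover have "open {s. d s \<noteq> 0}"
    using cont by (intro open_Collect_neq) auto
  ultimately have "d t = 0"
    using open_not_negligible by blast
  then have "cinner (g t) (g t - h t) = cinner (h t) (g t - h t)"
    by (simp add: d_def)
  then have "inner (g t) (g t - h t) = inner (h t) (g t - h t)"
    by (simp only: inner_eq_Re_cinner)
  then have "inner (g t - h t) (g t - h t) = 0"
    by (simp only: inner_diff_left diff_self)
  then show "g t = h t" by simp
qed

lemma wc_rep_eq:
  assumes "weakly_continuous g" "ae_eq g f"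
  shows "wc_rep f = g"
  unfolding wc_rep_def using assms wc_rep_unique by (intro the_equality) blast+


section \<open>The function spaces\<close>

text \<open>With the embedding \<open>\<iota>\<close> of \<open>X\<close> into \<open>Y\<close> explicit, functions with values in \<open>X\<close> are
  represented by functions with values in \<open>Y\<close> that lie in \<open>range \<iota>\<close> almost everywhere; this way
  the continuous representative in \<open>Y\<close>, which may leave \<open>X\<close> on a null set, is also available.
  \<open>inv \<iota> (u t)\<close> is \<open>u t\<close> regarded as an element of \<open>X\<close>.\<close>

definition X_sp :: "('x::{complex_hilbert,second_countable_topology} \<Rightarrow>
    'y::{complex_hilbert,second_countable_topology}) \<Rightarrow> real \<Rightarrow> real \<Rightarrow> (real \<Rightarrow> 'y) set" where
  "X_sp \<iota> a b = {u. (AE t in lebesgue. t \<in> {a<..<b} \<longrightarrow> u t \<in> range \<iota>) \<and>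
     L2_on a b (\<lambda>t. inv \<iota> (u t)) \<and>
     (\<exists>v. has_weak_deriv {a<..<b} u v \<and> L2_on a b v)}"

definition X_norm :: "('x::{complex_hilbert,second_countable_topology} \<Rightarrow>
    'y::{complex_hilbert,second_countable_topology}) \<Rightarrow> real \<Rightarrow> real \<Rightarrow> (real \<Rightarrow> 'y) \<Rightarrow> real" where
  "X_norm \<iota> a b u = sqrt (LINT t:{a<..<b}|lebesgue.
     (norm (inv \<iota> (u t)))\<^sup>2 + (norm (Dt {a<..<b} u t))\<^sup>2)"

definition X_loc :: "('x::{complex_hilbert,second_countable_topology} \<Rightarrow>
    'y::{complex_hilbert,second_countable_topology}) \<Rightarrow> (real \<Rightarrow> 'y) set" where
  "X_loc \<iota> = {u. \<forall>a b. a < b \<longrightarrow> u \<in> X_sp \<iota> a b}"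

definition Y_loc :: "(real \<Rightarrow> 'y::{complex_hilbert,second_countable_topology}) set" where
  "Y_loc = {u. \<forall>a b. a < b \<longrightarrow> L2_on a b u}"

definition X_hat :: "('x::{complex_hilbert,second_countable_topology} \<Rightarrow>
    'y::{complex_hilbert,second_countable_topology}) \<Rightarrow> (real \<Rightarrow> 'y) set" where
  "X_hat \<iota> = {u \<in> X_loc \<iota>. ae_eq (\<lambda>t. u (t + 1)) u}"

definition Y_hat :: "(real \<Rightarrow> 'y::{complex_hilbert,second_countable_topology}) set" where
  "Y_hat = {u \<in> Y_loc. ae_eq (\<lambda>t. u (t + 1)) u}"

definition Y_hat_inner ::
    "(real \<Rightarrow> 'y::{complex_hilbert,second_countable_topology}) \<Rightarrow> (real \<Rightarrow> 'y) \<Rightarrow> complex" where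
  "Y_hat_inner u v = (LINT t:{0<..<1}|lebesgue. cinner (u t) (v t))"


section \<open>The operator and its pencil\<close>

definition L_op :: "('x::{complex_hilbert,second_countable_topology} \<Rightarrow>
    'y::{complex_hilbert,second_countable_topology}) \<Rightarrow> (real \<Rightarrow> 'x \<Rightarrow>\<^sub>L 'y) \<Rightarrow> real set \<Rightarrow>
    (real \<Rightarrow> 'y) \<Rightarrow> real \<Rightarrow> 'y" where
  "L_op \<iota> A S u t = Dt S u t + blinfun_apply (A t) (inv \<iota> (u t))"

definition pencil :: "('x::{complex_hilbert,second_countable_topology} \<Rightarrow>
    'y::{complex_hilbert,second_countable_topology}) \<Rightarrow> (real \<Rightarrow> 'x \<Rightarrow>\<^sub>L 'y) \<Rightarrow> complex \<Rightarrow>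
    (real \<Rightarrow> 'y) \<Rightarrow> real \<Rightarrow> 'y" where
  "pencil \<iota> A l u t = L_op \<iota> A UNIV u t + l *\<^sub>C u t"

definition local_estimate :: "('x::{complex_hilbert,second_countable_topology} \<Rightarrow>
    'y::{complex_hilbert,second_countable_topology}) \<Rightarrow> (real \<Rightarrow> 'x \<Rightarrow>\<^sub>L 'y) \<Rightarrow> bool" where
  "local_estimate \<iota> A \<longleftrightarrow> (\<exists>C. \<forall>u \<in> X_sp \<iota> (-1) 2.
     X_norm \<iota> 0 1 u \<le> C * (L2_norm_on (-1) 2 (L_op \<iota> A {-1<..<2} u) + L2_norm_on (-1) 2 u))"

definition pencil_isomorphism :: "('x::{complex_hilbert,second_countable_topology} \<Rightarrow>
    'y::{complex_hilbert,second_countable_topology}) \<Rightarrow> (real \<Rightarrow> 'x \<Rightarrow>\<^sub>L 'y) \<Rightarrow> complex \<Rightarrow> bool" where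
  "pencil_isomorphism \<iota> A l \<longleftrightarrow>
     (\<forall>u \<in> X_hat \<iota>. pencil \<iota> A l u \<in> Y_hat) \<and>
     (\<forall>f \<in> Y_hat. \<exists>u \<in> X_hat \<iota>. ae_eq (pencil \<iota> A l u) f \<and>
        (\<forall>u' \<in> X_hat \<iota>. ae_eq (pencil \<iota> A l u') f \<longrightarrow> ae_eq u' u)) \<and>
     (\<exists>C. \<forall>u \<in> X_hat \<iota>. L2_norm_on 0 1 (pencil \<iota> A l u) \<le> C * X_norm \<iota> 0 1 u) \<and>
     (\<exists>C. \<forall>u \<in> X_hat \<iota>. X_norm \<iota> 0 1 u \<le> C * L2_norm_on 0 1 (pencil \<iota> A l u))"

definition pencil_kernel :: "('x::{complex_hilbert,second_countable_topology} \<Rightarrow>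
    'y::{complex_hilbert,second_countable_topology}) \<Rightarrow> (real \<Rightarrow> 'x \<Rightarrow>\<^sub>L 'y) \<Rightarrow> complex \<Rightarrow>
    (real \<Rightarrow> 'y) set" where
  "pencil_kernel \<iota> A l = {u \<in> X_hat \<iota>. ae_eq (pencil \<iota> A l u) (\<lambda>_. 0)}"

definition pencil_eigenvalue :: "('x::{complex_hilbert,second_countable_topology} \<Rightarrow>
    'y::{complex_hilbert,second_countable_topology}) \<Rightarrow> (real \<Rightarrow> 'x \<Rightarrow>\<^sub>L 'y) \<Rightarrow> complex \<Rightarrow> bool" where
  "pencil_eigenvalue \<iota> A l \<longleftrightarrow> (\<exists>u \<in> pencil_kernel \<iota> A l. \<not> ae_eq u (\<lambda>_. 0))"

definition delta_line :: "real \<Rightarrow> complex set" where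
  "delta_line b = {z. Re z = b \<and> 0 \<le> Im z \<and> Im z < 2 * pi}"

definition Q_strip :: "real \<Rightarrow> real \<Rightarrow> complex set" where
  "Q_strip b1 b2 = {z. b1 < Re z \<and> Re z < b2 \<and> 0 \<le> Im z \<and> Im z < 2 * pi}"


section \<open>Jordan chains\<close>

definition in_cspan :: "'i set \<Rightarrow> ('i \<Rightarrow> real \<Rightarrow> 'y::complex_hilbert) \<Rightarrow> (real \<Rightarrow> 'y) \<Rightarrow> bool" where
  "in_cspan I F u \<longleftrightarrow> (\<exists>c. ae_eq u (\<lambda>t. \<Sum>i\<in>I. c i *\<^sub>C F i t))"

definition cindependent_family :: "'i set \<Rightarrow> ('i \<Rightarrow> real \<Rightarrow> 'y::complex_hilbert) \<Rightarrow> bool" where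
  "cindependent_family I F \<longleftrightarrow>
     (\<forall>c. ae_eq (\<lambda>t. \<Sum>i\<in>I. c i *\<^sub>C F i t) (\<lambda>_. 0) \<longrightarrow> (\<forall>i\<in>I. c i = 0))"

text \<open>A chain of length \<open>n\<close> consists of \<open>w 0, \<dots>, w (n - 1)\<close>.\<close>

definition jordan_chain :: "('x::{complex_hilbert,second_countable_topology} \<Rightarrow>
    'y::{complex_hilbert,second_countable_topology}) \<Rightarrow> (real \<Rightarrow> 'x \<Rightarrow>\<^sub>L 'y) \<Rightarrow> complex \<Rightarrow> nat \<Rightarrow>
    (nat \<Rightarrow> real \<Rightarrow> 'y) \<Rightarrow> bool" where
  "jordan_chain \<iota> A l n w \<longleftrightarrow> (\<forall>m<n. w m \<in> X_hat \<iota> \<and>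
     ae_eq (pencil \<iota> A l (w m)) (\<lambda>t. if m = 0 then 0 else - w (m - 1) t))"

definition starts_chain :: "('x::{complex_hilbert,second_countable_topology} \<Rightarrow>
    'y::{complex_hilbert,second_countable_topology}) \<Rightarrow> (real \<Rightarrow> 'x \<Rightarrow>\<^sub>L 'y) \<Rightarrow> complex \<Rightarrow>
    (real \<Rightarrow> 'y) \<Rightarrow> nat \<Rightarrow> bool" where
  "starts_chain \<iota> A l v n \<longleftrightarrow> (\<exists>w. jordan_chain \<iota> A l n w \<and> ae_eq (w 0) v)"

text \<open>Canonical system, after Gohberg and Sigal: up to a renumbering \<open>\<sigma>\<close> of the chains, each chain
  has the maximal length among the chains starting at an eigenvector outside the span of the
  preceding eigenvectors (equivalently, in a direct complement of that span in the kernel). The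
  numbers \<open>\<mu> j\<close> are then the partial multiplicities, and \<open>J\<close> is the geometric multiplicity.\<close>

definition canonical_system :: "('x::{complex_hilbert,second_countable_topology} \<Rightarrow>
    'y::{complex_hilbert,second_countable_topology}) \<Rightarrow> (real \<Rightarrow> 'x \<Rightarrow>\<^sub>L 'y) \<Rightarrow> complex \<Rightarrow>
    nat \<Rightarrow> (nat \<Rightarrow> nat) \<Rightarrow> (nat \<Rightarrow> nat \<Rightarrow> real \<Rightarrow> 'y) \<Rightarrow> bool" where
  "canonical_system \<iota> A l J \<mu> \<phi> \<longleftrightarrow>
     (\<forall>j\<in>{1..J}. \<mu> j \<ge> 1 \<and> jordan_chain \<iota> A l (\<mu> j) (\<phi> j)) \<and>
     cindependent_family {1..J} (\<lambda>j. \<phi> j 0) \<and>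
     (\<forall>v \<in> pencil_kernel \<iota> A l. in_cspan {1..J} (\<lambda>j. \<phi> j 0) v) \<and>
     (\<exists>\<sigma>. bij_betw \<sigma> {1..J} {1..J} \<and>
        (\<forall>i\<in>{1..J}. \<forall>v \<in> pencil_kernel \<iota> A l. \<forall>n.
           \<not> in_cspan {1..<i} (\<lambda>i'. \<phi> (\<sigma> i') 0) v \<longrightarrow> starts_chain \<iota> A l v n \<longrightarrow> n \<le> \<mu> (\<sigma> i)))"

text \<open>Jordan chains of the adjoint pencil: the equation in the dual of \<open>X_hat \<iota>\<close> is tested against
  all elements of \<open>X_hat \<iota>\<close>.\<close>

definition adjoint_chains :: "('x::{complex_hilbert,second_countable_topology} \<Rightarrow>
    'y::{complex_hilbert,second_countable_topology}) \<Rightarrow> (real \<Rightarrow> 'x \<Rightarrow>\<^sub>L 'y) \<Rightarrow> complex \<Rightarrow>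
    nat \<Rightarrow> (nat \<Rightarrow> nat) \<Rightarrow> (nat \<Rightarrow> nat \<Rightarrow> real \<Rightarrow> 'y) \<Rightarrow> bool" where
  "adjoint_chains \<iota> A l J \<mu> \<psi> \<longleftrightarrow> (\<forall>j\<in>{1..J}. \<forall>m<\<mu> j. \<psi> j m \<in> Y_hat \<and>
     (\<forall>u \<in> X_hat \<iota>. Y_hat_inner (pencil \<iota> A l u) (\<psi> j m) =
        (if m = 0 then 0 else - Y_hat_inner u (\<psi> j (m - 1)))))"

definition biorthonormal :: "nat \<Rightarrow> (nat \<Rightarrow> nat) \<Rightarrow>
    (nat \<Rightarrow> nat \<Rightarrow> real \<Rightarrow> 'y::{complex_hilbert,second_countable_topology}) \<Rightarrow>
    (nat \<Rightarrow> nat \<Rightarrow> real \<Rightarrow> 'y) \<Rightarrow> bool" where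
  "biorthonormal J \<mu> \<phi> \<psi> \<longleftrightarrow> (\<forall>j\<in>{1..J}. \<forall>j'\<in>{1..J}. \<forall>m<\<mu> j'.
     Y_hat_inner (\<phi> j (\<mu> j - 1)) (\<psi> j' m) = (if j = j' \<and> m = 0 then 1 else 0))"


section \<open>The spectral projector\<close>

text \<open>The coefficient \<open>(u(t), \<psi>(t))\<close>.\<close>

definition coef ::
    "(real \<Rightarrow> 'y::complex_hilbert) \<Rightarrow> (real \<Rightarrow> 'y) \<Rightarrow> real \<Rightarrow> complex" where
  "coef \<psi> u t = cinner (u t) (wc_rep \<psi> t)"

definition P_op :: "nat \<Rightarrow> (nat \<Rightarrow> nat) \<Rightarrow> (nat \<Rightarrow> nat \<Rightarrow> nat) \<Rightarrow>
    (nat \<Rightarrow> nat \<Rightarrow> nat \<Rightarrow> real \<Rightarrow> 'y::complex_hilbert) \<Rightarrow> (nat \<Rightarrow> nat \<Rightarrow> nat \<Rightarrow> real \<Rightarrow> 'y) \<Rightarrow>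
    (real \<Rightarrow> 'y) \<Rightarrow> real \<Rightarrow> 'y" where
  "P_op N J \<mu> \<phi> \<psi> u t = (\<Sum>k=1..N. \<Sum>j=1..J k. \<Sum>m<\<mu> k j.
     coef (\<psi> k j m) u t *\<^sub>C wc_rep (\<phi> k j (\<mu> k j - 1 - m)) t)"

text \<open>\<open>P_op\<close> acts pointwise in \<open>t\<close>; its evaluation at \<open>t\<close> is the following operator in \<open>Y\<close>.\<close>

definition P_at :: "nat \<Rightarrow> (nat \<Rightarrow> nat) \<Rightarrow> (nat \<Rightarrow> nat \<Rightarrow> nat) \<Rightarrow>
    (nat \<Rightarrow> nat \<Rightarrow> nat \<Rightarrow> real \<Rightarrow> 'y::complex_hilbert) \<Rightarrow> (nat \<Rightarrow> nat \<Rightarrow> nat \<Rightarrow> real \<Rightarrow> 'y) \<Rightarrow>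
    real \<Rightarrow> 'y \<Rightarrow> 'y" where
  "P_at N J \<mu> \<phi> \<psi> t y = P_op N J \<mu> \<phi> \<psi> (\<lambda>_. y) t"

end

theory Submission
  imports Defs
begin

text \<open>
  Each coefficient function of the operator satisfies a scalar differential equation, and everything
  follows from these equations. Write \<open>L = D\<^sub>t + A(t)\<close>, and let \<open>\<psi>\<^sub>0, \<psi>\<^sub>1, \<dots>\<close> be a Jordan
  chain of the adjoint pencil at \<open>\<lambda>\<close>, with \<open>\<psi>\<^sub>-\<^sub>1 = 0\<close>. For every \<open>u\<close> in \<open>\<X>\<^sub>l\<^sub>o\<^sub>c\<close>, in the weak sense,
  \<open>D\<^sub>t (u, \<psi>\<^sub>m) = (L u, \<psi>\<^sub>m) + \<lambda> (u, \<psi>\<^sub>m) + (u, \<psi>\<^sub>m\<^sub>-\<^sub>1)\<close>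
  (\<open>has_weak_deriv_cinner\<close>, \<open>coef_has_weak_deriv\<close>). The chain equation is given only against
  periodic functions. To localize it, a test function \<open>\<eta>\<close> is fixed and \<open>\<eta> u\<close> is replaced by its
  periodization, the sum of all integer translates: it is an admissible periodic function, the
  pencil commutes with periodization because \<open>A\<close> is periodic, and an integral over one period
  of a periodization against the periodic \<open>\<psi>\<^sub>m\<close> unfolds to an integral over the line.

  The equation yields first the pointwise values of \<open>\<psi>\<^sub>m\<close>. For constant \<open>u\<close> in \<open>X\<close> the function
  \<open>(u, \<psi>\<^sub>m)\<close> is weakly differentiable, hence continuous after modification on a null set. Since
  \<open>\<psi>\<^sub>m\<close> is essentially bounded and \<open>X\<close> is dense in \<open>Y\<close>, the same holds for all \<open>u\<close> in \<open>Y\<close>, and the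
  Riesz theorem at each \<open>t\<close> produces a bounded weakly continuous representative
  (\<open>weakly_continuous_representative\<close>).

  Projector: let \<open>w\<^sub>0, w\<^sub>1, \<dots>\<close> be a Jordan chain at \<open>\<lambda>'\<close>. Since \<open>L w\<^sub>a = - \<lambda>' w\<^sub>a - w\<^sub>a\<^sub>-\<^sub>1\<close>, the pairings
  \<open>f\<^sub>a\<^sub>m = (w\<^sub>a, \<psi>\<^sub>m)\<close> are continuous 1-periodic functions with
  \<open>f\<^sub>a\<^sub>m' = (\<lambda> - \<lambda>') f\<^sub>a\<^sub>m - f\<^sub>a\<^sub>-\<^sub>1\<^sub>,\<^sub>m + f\<^sub>a\<^sub>,\<^sub>m\<^sub>-\<^sub>1\<close>. If \<open>\<lambda> \<noteq> \<lambda>'\<close> lie in the strip, then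
  \<open>exp (\<lambda> - \<lambda>') \<noteq> 1\<close> and induction on \<open>a + m\<close> shows that all of them vanish. If \<open>\<lambda> = \<lambda>'\<close>, the same induction
  shows that each \<open>f\<^sub>a\<^sub>m\<close> has constant derivative, which is zero by periodicity; so \<open>f\<^sub>a\<^sub>m\<close> is
  constant and depends only on \<open>a + m\<close>. The normalization, which is a condition on integrals
  over a period for maximal \<open>a\<close>, therefore becomes biorthogonality at every single \<open>t\<close>.

  Commutation: by the product rule,
  \<open>L (f w) = f' w + f L w\<close> for scalar \<open>f\<close>. Inserting the equation for \<open>D\<^sub>t (u, \<psi>\<^sub>m)\<close> and the chain
  equation for \<open>L w\<close>, the terms with \<open>\<lambda>\<close> cancel, and the shifted terms \<open>(u, \<psi>\<^sub>m) w\<^sub>r\<^sub>-\<^sub>1\<close> and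
  \<open>(u, \<psi>\<^sub>m\<^sub>-\<^sub>1) w\<^sub>r\<close> cancel after summation by an index shift (\<open>chain_shift_sum\<close>). What remains
  is the sum of \<open>(L u, \<psi>\<^sub>m) w\<^sub>r\<close>, and solving the equation for \<open>(L u, \<psi>\<^sub>m)\<close> gives the last formula.

  Weak derivatives are handled through indefinite Lebesgue integrals: a function has a weak
  derivative on the line precisely when it is almost everywhere equal to such an integral
  (\<open>has_weak_deriv_imp_primitive\<close>). The product rule is then proved for indefinite integrals,
  and uniqueness of the weak derivative comes from a supply of smooth compactly supported functions.
\<close>

section \<open>Indefinite integrals of locally integrable functions\<close>

lemma locally_integrable_UNIV_iff:
  "locally_integrable_on v UNIV \<longleftrightarrow> (\<forall>a b. set_integrable lebesgue {a..b} v)"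
proof
  assume "\<forall>a b. set_integrable lebesgue {a..b} v"
  moreover have "\<exists>a b. K \<subseteq> {a..b}" if "compact K" for K :: "real set"
    using compact_imp_bounded[OF that] bounded_subset_cbox_symmetric by (metis cbox_interval)
  ultimately show "locally_integrable_on v UNIV"
    unfolding locally_integrable_on_def
    by (metis set_integrable_subset compact_imp_closed borel_closed sets_completionI_sets sets_lborel)
qed (auto simp: locally_integrable_on_def)

text \<open>This is local absolute continuity of \<open>u\<close> with derivative \<open>v\<close>, in integrated form; unlike a weak
  derivative it fixes the values of \<open>u\<close> at every point.\<close>

definition primitive :: "(real \<Rightarrow> 'a::{banach,second_countable_topology}) \<Rightarrow> (real \<Rightarrow> 'a) \<Rightarrow> bool" where
  "primitive u v \<longleftrightarrow> locally_integrable_on v UNIV \<and>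
     (\<forall>a b. a \<le> b \<longrightarrow> u b - u a = (LINT t:{a..b}|lebesgue. v t))"

lemma locally_integrableD:
  "locally_integrable_on v UNIV \<Longrightarrow> set_integrable lebesgue {a..b} v"
  by (simp add: locally_integrable_UNIV_iff)

lemma primitiveD:
  assumes "primitive u v"
  shows "locally_integrable_on v UNIV" "set_integrable lebesgue {a..b} v"
    "a \<le> b \<Longrightarrow> u b - u a = (LINT t:{a..b}|lebesgue. v t)"
  using assms by (auto simp: primitive_def locally_integrable_UNIV_iff)

lemma interval_integral_combine:
  fixes v :: "real \<Rightarrow> 'a::{banach,second_countable_topology}"
  assumes "locally_integrable_on v UNIV" "a \<le> b" "b \<le> c"
  shows "(LINT t:{a..c}|lebesgue. v t) = (LINT t:{a..b}|lebesgue. v t) + (LINT t:{b..c}|lebesgue. v t)"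
proof -
  have eq: "{a..c} = {a..b} \<union> {b..c}" using assms by auto
  show ?thesis unfolding eq
  proof (rule set_integral_Un_AE)
    have "AE x in lebesgue. x \<noteq> b"
      by (rule AE_I'[of "{b}"]) auto
    then show "AE x in lebesgue. \<not> (x \<in> {a..b} \<and> x \<in> {b..c})" by eventually_elim auto
  qed (use assms in \<open>auto simp: locally_integrable_UNIV_iff\<close>)
qed

lemma locally_integrable_norm:
  "locally_integrable_on v UNIV \<Longrightarrow> locally_integrable_on (\<lambda>t. norm (v t)) UNIV"
  unfolding locally_integrable_UNIV_iff by (auto intro: set_integrable_norm)

lemma interval_integral_norm_le:
  fixes v :: "real \<Rightarrow> 'a::{banach,second_countable_topology}"
  assumes "locally_integrable_on v UNIV"
  shows "norm (LINT t:{a..b}|lebesgue. v t) \<le> (LINT t:{a..b}|lebesgue. norm (v t))"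
  using assms by (intro set_integral_norm_bound) (auto simp: locally_integrable_UNIV_iff)

lemma primitive_exists:
  fixes v :: "real \<Rightarrow> 'a::{banach,second_countable_topology}"
  assumes v: "locally_integrable_on v UNIV"
  obtains u where "primitive u v"
proof
  define u where "u t = (if 0 \<le> t then (LINT s:{0..t}|lebesgue. v s) else - (LINT s:{t..0}|lebesgue. v s))" for t
  have "u b - u a = (LINT t:{a..b}|lebesgue. v t)" if "a \<le> b" for a b
  proof -
    consider "0 \<le> a" | "a < 0" "0 \<le> b" | "b < 0" using that by linarith
    then show ?thesis
    proof cases
      case 1 then show ?thesis using interval_integral_combine[OF v, of 0 a b] that by (simp add: u_def)
    next
      case 2 then show ?thesis using interval_integral_combine[OF v, of a 0 b] by (simp add: u_def)
    next
      case 3 then show ?thesis using interval_integral_combine[OF v, of a b 0] that by (simp add: u_def)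
    qed
  qed
  then show "primitive u v" using v by (simp add: primitive_def)
qed

lemma primitive_continuous_real:
  fixes u :: "real \<Rightarrow> real"
  assumes "primitive u v"
  shows "continuous_on UNIV u"
proof -
  have "continuous_on {-R<..<R} u" for R
  proof -
    have ac: "v absolutely_integrable_on {-R..R}"
      using primitiveD(2)[OF assms] by simp
    have cont: "continuous_on {-R..R} (\<lambda>x. u (-R) + integral {-R..x} v)"
      by (rule continuous_on_add[OF continuous_on_const
            indefinite_integral_continuous_1[OF set_lebesgue_integral_eq_integral(1)[OF ac]]])
    have "u (-R) + integral {-R..x} v = u x" if "x \<in> {-R..R}" for x
      using primitiveD(3)[OF assms, of "-R" x] that
      by (simp add: set_lebesgue_integral_eq_integral(2)[OF primitiveD(2)[OF assms]])
    from continuous_on_eq[OF cont this] have "continuous_on {-R..R} u" .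
    then show ?thesis by (rule continuous_on_subset) auto
  qed
  moreover have "(\<Union>R. {-R<..<R}) = (UNIV :: real set)"
  proof -
    have "x \<in> {-(\<bar>x\<bar>+1)<..<\<bar>x\<bar>+1}" for x :: real by auto
    then show ?thesis by blast
  qed
  ultimately show ?thesis
    using continuous_on_open_UN[of UNIV "\<lambda>R. {-R<..<R}" u] by simp
qed

lemma primitive_norm_diff_le:
  assumes "primitive u v" "primitive n (\<lambda>t. norm (v t))" "a \<le> b"
  shows "norm (u b - u a) \<le> n b - n a"
  using interval_integral_norm_le[OF primitiveD(1)[OF assms(1)], of a b]
    primitiveD(3)[OF assms(1,3)] primitiveD(3)[OF assms(2,3)] by simp

text \<open>The increments of \<open>u\<close> are dominated by those of the indefinite integral of \<open>norm v\<close>, a real function,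
  for which continuity is a statement about Henstock-Kurzweil integrals.\<close>

lemma primitive_continuous:
  assumes "primitive u v"
  shows "continuous_on UNIV u"
proof -
  obtain n where n: "primitive n (\<lambda>t. norm (v t))"
    using primitive_exists[OF locally_integrable_norm[OF primitiveD(1)[OF assms]]] .
  have nc: "isCont n x" for x
    using primitive_continuous_real[OF n] by (simp add: continuous_on_eq_continuous_at)
  have le: "norm (u y - u x) \<le> norm (n y - n x)" for x y
    using primitive_norm_diff_le[OF assms n, of x y] primitive_norm_diff_le[OF assms n, of y x]
    by (cases "x \<le> y") (auto simp: norm_minus_commute)
  have "isCont u x" for x
  proof -
    have "((\<lambda>y. n y - n x) \<longlongrightarrow> 0) (at x)"
      using nc[of x] by (simp add: isCont_def LIM_zero_iff)
    then have "((\<lambda>y. u y - u x) \<longlongrightarrow> 0) (at x)"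
      by (rule Lim_null_comparison[rotated, OF tendsto_norm_zero]) (use le in auto)
    then show ?thesis by (simp add: isCont_def LIM_zero_iff)
  qed
  then show ?thesis by (simp add: continuous_on_eq_continuous_at)
qed

lemma locally_integrable_continuous:
  fixes f :: "real \<Rightarrow> 'a::{banach,second_countable_topology}"
  assumes "continuous_on UNIV f"
  shows "locally_integrable_on f UNIV"
proof -
  have "set_integrable lborel {a..b} f" for a b
    by (rule borel_integrable_atLeastAtMost') (use assms continuous_on_subset in blast)
  then have "set_integrable lebesgue {a..b} f" for a b
    unfolding set_integrable_def
    by (metis integrable_completion borel_measurable_integrable borel_measurable_if_D)
  then show ?thesis by (simp add: locally_integrable_UNIV_iff)
qed

lemma set_integral_bounded_linear:
  fixes f :: "real \<Rightarrow> 'a::{banach,second_countable_topology}"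
    and T :: "'a \<Rightarrow> 'b::{banach,second_countable_topology}"
  assumes "bounded_linear T" "set_integrable M S f"
  shows "set_integrable M S (\<lambda>t. T (f t))" "(LINT t:S|M. T (f t)) = T (LINT t:S|M. f t)"
proof -
  have eq: "indicator S t *\<^sub>R T (f t) = T (indicator S t *\<^sub>R f t)" for t
    using assms(1) by (simp add: linear_simps)
  show "set_integrable M S (\<lambda>t. T (f t))" "(LINT t:S|M. T (f t)) = T (LINT t:S|M. f t)"
    using assms(2) unfolding set_integrable_def set_lebesgue_integral_def eq
    by (auto intro: integrable_bounded_linear[OF assms(1)] integral_bounded_linear[OF assms(1)])
qed

lemma set_borel_measurable_bilinear:
  fixes f :: "real \<Rightarrow> 'a::{banach,second_countable_topology}"
    and g :: "real \<Rightarrow> 'b::{banach,second_countable_topology}"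
    and B :: "'a \<Rightarrow> 'b \<Rightarrow> 'c::{banach,second_countable_topology}"
  assumes B: "bounded_bilinear B"
    and f: "set_borel_measurable M S f" and g: "set_borel_measurable M S g"
  shows "set_borel_measurable M S (\<lambda>t. B (f t) (g t))"
proof -
  interpret bounded_bilinear B by fact
  have eq: "indicator S t *\<^sub>R B (f t) (g t) = B (indicator S t *\<^sub>R f t) (indicator S t *\<^sub>R g t)" for t
    by (cases "t \<in> S") (auto simp: zero_left)
  show ?thesis
    using f g unfolding set_borel_measurable_def eq
    by (rule borel_measurable_continuous_Pair) (intro continuous_on continuous_intros)
qed

lemma set_integrable_bilinear_bounded:
  fixes f :: "real \<Rightarrow> 'a::{banach,second_countable_topology}"
    and g :: "real \<Rightarrow> 'b::{banach,second_countable_topology}"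
    and B :: "'a \<Rightarrow> 'b \<Rightarrow> 'c::{banach,second_countable_topology}"
  assumes B: "bounded_bilinear B"
    and f: "set_integrable M S f" and g: "set_borel_measurable M S g"
    and bd: "AE t in M. t \<in> S \<longrightarrow> norm (g t) \<le> C"
  shows "set_integrable M S (\<lambda>t. B (f t) (g t))"
proof -
  obtain K where K: "\<And>a b. norm (B a b) \<le> norm a * norm b * K" "K > 0"
    using bounded_bilinear.pos_bounded[OF B] by blast
  have fm: "set_borel_measurable M S f"
    using f by (simp add: set_integrable_def set_borel_measurable_def)
  have "integrable M (\<lambda>t. (C * K) *\<^sub>R (indicator S t *\<^sub>R f t))"
    using f unfolding set_integrable_def by (rule integrable_scaleR_right)
  then show ?thesis unfolding set_integrable_def
  proof (rule Bochner_Integration.integrable_bound)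
    show "(\<lambda>t. indicator S t *\<^sub>R B (f t) (g t)) \<in> borel_measurable M"
      using set_borel_measurable_bilinear[OF B fm g] by (simp add: set_borel_measurable_def)
    show "AE t in M. norm (indicator S t *\<^sub>R B (f t) (g t)) \<le> norm ((C * K) *\<^sub>R indicator S t *\<^sub>R f t)"
      using bd
    proof eventually_elim
      case (elim t)
      have "norm (B (f t) (g t)) \<le> \<bar>C * K\<bar> * norm (f t)" if "t \<in> S"
      proof -
        have "norm (f t) * norm (g t) * K \<le> norm (f t) * C * K"
          using elim that K(2) by (intro mult_right_mono mult_left_mono) auto
        also have "\<dots> = C * K * norm (f t)" by (simp add: mult_ac)
        also have "\<dots> \<le> \<bar>C * K\<bar> * norm (f t)" by (intro mult_right_mono) auto
        finally show ?thesis using K(1)[of "f t" "g t"] by linarith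
      qed
      then show ?case by (cases "t \<in> S") auto
    qed
  qed
qed

lemma set_borel_measurable_continuous:
  fixes g :: "real \<Rightarrow> 'b::{banach,second_countable_topology}"
  assumes "continuous_on UNIV g" "S \<in> sets lebesgue"
  shows "set_borel_measurable lebesgue S g"
proof -
  have "g \<in> borel_measurable borel" using assms(1) by (rule borel_measurable_continuous_onI)
  then have "g \<in> borel_measurable lebesgue" by (simp add: measurable_completion)
  then show ?thesis unfolding set_borel_measurable_def
    using assms(2) by (intro borel_measurable_scaleR borel_measurable_indicator)
qed

lemma locally_integrable_bilinear_continuous:
  fixes f :: "real \<Rightarrow> 'a::{banach,second_countable_topology}"
    and g :: "real \<Rightarrow> 'b::{banach,second_countable_topology}"
    and B :: "'a \<Rightarrow> 'b \<Rightarrow> 'c::{banach,second_countable_topology}"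
  assumes B: "bounded_bilinear B"
    and f: "locally_integrable_on f UNIV" and g: "continuous_on UNIV g"
  shows "locally_integrable_on (\<lambda>t. B (f t) (g t)) UNIV"
  unfolding locally_integrable_UNIV_iff
proof (intro allI)
  fix a b :: real
  have "compact (g ` {a..b})"
    using g by (intro compact_continuous_image) (auto intro: continuous_on_subset)
  then have "bounded (g ` {a..b})" by (rule compact_imp_bounded)
  then obtain C where "\<And>t. t \<in> {a..b} \<Longrightarrow> norm (g t) \<le> C"
    unfolding bounded_iff by blast
  then show "set_integrable lebesgue {a..b} (\<lambda>t. B (f t) (g t))"
    by (intro set_integrable_bilinear_bounded[OF B locally_integrableD[OF f]]
          set_borel_measurable_continuous[OF g]) auto
qed

lemma locally_integrable_add:
  "locally_integrable_on f UNIV \<Longrightarrow> locally_integrable_on g UNIV \<Longrightarrow> locally_integrable_on (\<lambda>t. f t + g t) UNIV"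
  by (simp add: locally_integrable_UNIV_iff set_integral_add)

text \<open>The product rule. Freezing one factor at an endpoint of a short interval, the defect of the
  claimed formula on that interval is at most \<open>\<epsilon>\<close> times the integral of \<open>norm f' + norm g'\<close>, by
  continuity of \<open>f\<close> and \<open>g\<close>. Defects add up along adjacent intervals, so the same bound holds on
  every interval, and \<open>\<epsilon>\<close> is arbitrary.\<close>

lemma primitive_bilinear:
  fixes f f' :: "real \<Rightarrow> 'a::{banach,second_countable_topology}"
    and g g' :: "real \<Rightarrow> 'b::{banach,second_countable_topology}"
    and B :: "'a \<Rightarrow> 'b \<Rightarrow> 'c::{banach,second_countable_topology}"
  assumes B: "bounded_bilinear B" and f: "primitive f f'" and g: "primitive g g'"
  shows "primitive (\<lambda>t. B (f t) (g t)) (\<lambda>t. B (f' t) (g t) + B (f t) (g' t))"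
proof -
  interpret bounded_bilinear B by fact
  obtain K where K: "\<And>a b. norm (B a b) \<le> norm a * norm b * K" "K > 0"
    using pos_bounded by blast
  note fc = primitive_continuous[OF f] and gc = primitive_continuous[OF g]
  note fi = primitiveD(1)[OF f] and gi = primitiveD(1)[OF g]
  let ?h = "\<lambda>t. B (f' t) (g t) + B (f t) (g' t)"
  have i1: "locally_integrable_on (\<lambda>t. B (f' t) (g t)) UNIV"
    by (rule locally_integrable_bilinear_continuous[OF B fi gc])
  have i2: "locally_integrable_on (\<lambda>t. B (f t) (g' t)) UNIV"
    by (rule locally_integrable_bilinear_continuous[OF flip gi fc])
  have hi: "locally_integrable_on ?h UNIV"
    by (rule locally_integrable_add[OF i1 i2])
  obtain n where n: "primitive n (\<lambda>t. norm (f' t) + norm (g' t))"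
    using primitive_exists[OF locally_integrable_add[OF locally_integrable_norm[OF fi] locally_integrable_norm[OF gi]]] .
  \<comment> \<open>The defect of the product rule on \<open>{a..b}\<close>.\<close>
  define E where "E a b = B (f b) (g b) - B (f a) (g a) - (LINT t:{a..b}|lebesgue. ?h t)" for a b
  have E_le: "norm (E a b) \<le> e * (n b - n a)" if "a \<le> b" "e > 0" for a b e
    using that(1)
  proof (induction rule: Bolzano)
    case (trans a b c)
    have "E a c = E a b + E b c"
      using interval_integral_combine[OF hi trans(3,4)] by (simp add: E_def)
    then show ?case using trans(1,2) norm_triangle_ineq[of "E a b" "E b c"]
      by (simp add: right_diff_distrib)
  next
    case (local x)
    \<comment> \<open>Two values of \<open>f\<close> or \<open>g\<close> near \<open>x\<close> differ by at most \<open>2 d\<close>, and the form is bounded by \<open>K\<close>.\<close>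
    define d where "d = e / (2 * K)"
    have d: "d > 0" "2 * d * K = e" using that(2) K(2) by (auto simp: d_def)
    have "isCont f x" "isCont g x" using fc gc by (auto simp: continuous_on_eq_continuous_at)
    then obtain r1 r2 where "r1 > 0" "\<And>t. dist t x < r1 \<Longrightarrow> dist (f t) (f x) < d"
      "r2 > 0" "\<And>t. dist t x < r2 \<Longrightarrow> dist (g t) (g x) < d"
      using d(1) unfolding continuous_at_eps_delta by metis
    then obtain r where r: "r > 0" "\<And>t. dist t x < r \<Longrightarrow> dist (f t) (f x) < d \<and> dist (g t) (g x) < d"
      by (intro that[of "min r1 r2"]) auto
    have "norm (E a b) \<le> e * (n b - n a)" if ab: "a \<le> x" "x \<le> b" "b - a < r" for a b
    proof -
      have near: "norm (f a - f t) \<le> 2 * d" "norm (g b - g t) \<le> 2 * d" if "t \<in> {a..b}" for t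
      proof -
        have "dist t x < r" "dist a x < r" "dist b x < r" using that ab by (auto simp: dist_real_def)
        note r(2)[OF this(1)] r(2)[OF this(2)] r(2)[OF this(3)]
        then show "norm (f a - f t) \<le> 2 * d" "norm (g b - g t) \<le> 2 * d"
          using dist_triangle2[of "f a" "f t" "f x"] dist_triangle2[of "g b" "g t" "g x"]
          unfolding dist_norm[symmetric] by linarith+
      qed
      have s: "set_integrable lebesgue {a..b} (\<lambda>t. B (f' t) (g b))" "set_integrable lebesgue {a..b} (\<lambda>t. B (f a) (g' t))"
         "set_integrable lebesgue {a..b} ?h"
        using set_integral_bounded_linear(1)[OF bounded_linear_left primitiveD(2)[OF f], of a b "g b"]
          set_integral_bounded_linear(1)[OF bounded_linear_right primitiveD(2)[OF g], of a b "f a"] hi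
        by (auto simp: locally_integrable_UNIV_iff)
      have "B (f b) (g b) - B (f a) (g a) = B (f b - f a) (g b) + B (f a) (g b - g a)"
        by (simp add: diff_left diff_right)
      also have "\<dots> = (LINT t:{a..b}|lebesgue. B (f' t) (g b)) + (LINT t:{a..b}|lebesgue. B (f a) (g' t))"
        using primitiveD(3)[OF f, of a b] primitiveD(3)[OF g, of a b] ab
        by (simp add: set_integral_bounded_linear(2)[OF bounded_linear_left primitiveD(2)[OF f]]
            set_integral_bounded_linear(2)[OF bounded_linear_right primitiveD(2)[OF g]])
      also have "\<dots> - (LINT t:{a..b}|lebesgue. ?h t)
          = (LINT t:{a..b}|lebesgue. B (f' t) (g b) + B (f a) (g' t) - ?h t)"
        using s by (simp add: set_integral_add set_integral_diff)
      also have "\<dots> = (LINT t:{a..b}|lebesgue. B (f' t) (g b - g t) + B (f a - f t) (g' t))"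
        by (simp add: diff_left diff_right algebra_simps)
      finally have Eq: "E a b = (LINT t:{a..b}|lebesgue. B (f' t) (g b - g t) + B (f a - f t) (g' t))"
        by (simp add: E_def)
      have si: "set_integrable lebesgue {a..b} (\<lambda>t. B (f' t) (g b - g t) + B (f a - f t) (g' t))"
      proof -
        have "set_integrable lebesgue {a..b} (\<lambda>t. B (f' t) (g b) + B (f a) (g' t) - ?h t)"
          by (intro set_integral_diff(1) set_integral_add(1) s)
        then show ?thesis by (simp add: diff_left diff_right algebra_simps)
      qed
      have "norm (E a b) \<le> (LINT t:{a..b}|lebesgue. norm (B (f' t) (g b - g t) + B (f a - f t) (g' t)))"
        unfolding Eq by (rule set_integral_norm_bound[OF si])
      also have "\<dots> \<le> (LINT t:{a..b}|lebesgue. e * (norm (f' t) + norm (g' t)))"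
      proof (rule set_integral_mono[OF set_integrable_norm[OF si]])
        show "set_integrable lebesgue {a..b} (\<lambda>t. e * (norm (f' t) + norm (g' t)))"
          using primitiveD(2)[OF n] by auto
        fix t assume t: "t \<in> {a..b}"
        have "norm (B (f' t) (g b - g t)) \<le> norm (f' t) * (2 * d) * K"
          using K(2) near[OF t] by (intro order_trans[OF K(1)] mult_right_mono mult_left_mono) auto
        moreover have "norm (B (f a - f t) (g' t)) \<le> (2 * d) * norm (g' t) * K"
          using K(2) near[OF t] by (intro order_trans[OF K(1)] mult_right_mono mult_left_mono) auto
        ultimately have "norm (B (f' t) (g b - g t) + B (f a - f t) (g' t))
            \<le> (2 * d * K) * (norm (f' t) + norm (g' t))"
          by (intro order_trans[OF norm_triangle_ineq]) (simp add: algebra_simps)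
        then show "norm (B (f' t) (g b - g t) + B (f a - f t) (g' t)) \<le> e * (norm (f' t) + norm (g' t))"
          by (simp only: d(2))
      qed
      also have "\<dots> = e * (n b - n a)" using primitiveD(3)[OF n, of a b] ab by simp
      finally show ?thesis .
    qed
    then show ?case using r(1) by blast
  qed
  have "E a b = 0" if "a \<le> b" for a b
  proof (rule ccontr)
    assume "E a b \<noteq> 0"
    moreover define m where "m = norm (E a b)"
    ultimately have m: "m > 0" by simp
    have nn: "n b - n a \<ge> 0" using E_le[OF that, of 1] norm_ge_zero[of "E a b"] by (simp del: norm_ge_zero)
    define N where "N = n b - n a"
    have "m \<le> m / (2 * (N + 1)) * N"
      using E_le[OF that, of "m / (2 * (N + 1))"] m nn by (simp add: m_def N_def)
    also have "\<dots> = m * (N / (2 * (N + 1)))" by simp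
    also have "\<dots> < m * 1"
      using m nn by (intro mult_strict_left_mono) (auto simp: N_def)
    finally show False by simp
  qed
  then show ?thesis using hi by (simp add: primitive_def E_def)
qed

lemma primitive_has_vector_derivative:
  assumes u: "primitive u v" and v: "isCont v x"
  shows "(u has_vector_derivative v x) (at x)"
  unfolding has_vector_derivative_def has_derivative_at_alt
proof (intro conjI allI impI bounded_linear_scaleR_left)
  fix e :: real assume "e > 0"
  then obtain d where d: "d > 0" "\<And>t. dist t x < d \<Longrightarrow> dist (v t) (v x) < e"
    using v by (metis continuous_at_eps_delta dist_commute)
  have bd: "norm (u b - u a - (b - a) *\<^sub>R v x) \<le> e * (b - a)"
    if ab: "a \<le> b" "\<And>t. t \<in> {a..b} \<Longrightarrow> dist t x < d" for a b
  proof -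
    have c: "set_integrable lebesgue {a..b} (\<lambda>_. v x)"
      using locally_integrable_continuous[of "\<lambda>_. v x"] by (simp add: locally_integrable_UNIV_iff)
    have si: "set_integrable lebesgue {a..b} (\<lambda>t. v t - v x)"
      by (intro set_integral_diff c primitiveD(2)[OF u])
    have "u b - u a - (b - a) *\<^sub>R v x = (LINT t:{a..b}|lebesgue. v t - v x)"
      using ab(1) primitiveD(3)[OF u ab(1)] set_integral_diff(2)[OF primitiveD(2)[OF u] c]
      by (simp add: set_integral_const)
    also have "norm \<dots> \<le> (LINT t:{a..b}|lebesgue. norm (v t - v x))"
      by (rule set_integral_norm_bound[OF si])
    also have "\<dots> \<le> (LINT t:{a..b}|lebesgue. e)"
      using set_integrable_norm[OF si]
      by (intro set_integral_mono) (use d(2)[OF ab(2)] locally_integrable_continuous[of "\<lambda>_. e"] in \<open>auto simp: dist_norm less_imp_le locally_integrable_UNIV_iff\<close>)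
    also have "\<dots> = e * (b - a)" using ab(1) by (simp add: set_integral_const)
    finally show ?thesis .
  qed
  show "\<exists>d>0. \<forall>y. norm (y - x) < d \<longrightarrow> norm (u y - u x - (y - x) *\<^sub>R v x) \<le> e * norm (y - x)"
  proof (intro exI[of _ d] conjI allI impI d(1))
    fix y assume "norm (y - x) < d"
    then show "norm (u y - u x - (y - x) *\<^sub>R v x) \<le> e * norm (y - x)"
    proof (cases "x \<le> y")
      case True
      then show ?thesis using bd[of x y] \<open>norm (y - x) < d\<close> by (auto simp: dist_real_def)
    next
      case False
      then have "norm (u x - u y - (x - y) *\<^sub>R v x) \<le> e * (x - y)"
        using bd[of y x] \<open>norm (y - x) < d\<close> by (auto simp: dist_real_def)
      moreover have "u y - u x - (y - x) *\<^sub>R v x = - (u x - u y - (x - y) *\<^sub>R v x)"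
        by (simp add: algebra_simps)
      ultimately show ?thesis using False by (simp only: norm_minus_cancel) simp
    qed
  qed
qed

lemma primitive_of_C1:
  fixes u v :: "real \<Rightarrow> 'a::{banach,second_countable_topology}"
  assumes "\<And>t. (u has_vector_derivative v t) (at t)" and cont: "continuous_on UNIV v"
  shows "primitive u v"
proof -
  have vi: "locally_integrable_on v UNIV" by (rule locally_integrable_continuous[OF cont])
  obtain w where w: "primitive w v" using primitive_exists[OF vi] .
  have dw: "(w has_vector_derivative v t) (at t)" for t
    using cont by (intro primitive_has_vector_derivative[OF w]) (simp add: continuous_on_eq_continuous_at)
  have "((\<lambda>s. u s - w s) has_derivative (\<lambda>h. 0)) (at t)" for t
    using has_vector_derivative_diff[OF assms(1)[of t] dw[of t]] by (simp add: has_vector_derivative_def)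
  then obtain c where c: "\<And>t. u t - w t = c"
    using has_derivative_zero_constant[of UNIV "\<lambda>s. u s - w s"] by auto
  have "u b - u a = w b - w a" for a b using c[of a] c[of b] by (metis add_diff_cancel_left diff_add_cancel diff_diff_eq2)
  then show ?thesis using w by (simp add: primitive_def)
qed

section \<open>Smooth functions of one real variable\<close>

definition smooth :: "(real \<Rightarrow> real) \<Rightarrow> bool" where
  "smooth f \<longleftrightarrow> (\<forall>n t. (deriv ^^ n) f differentiable at t)"

lemma smooth_deriv: "smooth f \<Longrightarrow> smooth (deriv f)"
  unfolding smooth_def by (metis funpow_Suc_right comp_apply)

lemma smooth_has_derivative: "smooth f \<Longrightarrow> (f has_real_derivative deriv f t) (at t)"
  unfolding smooth_def by (metis funpow_0 DERIV_deriv_iff_real_differentiable)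

text \<open>Exhibiting a set of functions that is closed under differentiation replaces formulas for the higher
  derivatives of products and compositions.\<close>

lemma smooth_coinduct:
  assumes "f \<in> F" and "\<And>h. h \<in> F \<Longrightarrow> \<exists>h'\<in>F. \<forall>t. (h has_real_derivative h' t) (at t)"
  shows "smooth f"
proof -
  have "deriv h \<in> F \<and> (\<forall>t. h differentiable at t)" if "h \<in> F" for h
  proof -
    obtain h' where h': "h' \<in> F" "\<And>t. (h has_real_derivative h' t) (at t)" using assms(2) \<open>h \<in> F\<close> by blast
    then have "deriv h = h'" by (auto intro!: DERIV_imp_deriv)
    with h' show ?thesis using real_differentiable_def by blast
  qed
  moreover have "(deriv ^^ n) h \<in> F" if "h \<in> F" for n h
    using that calculation by (induction n) auto
  ultimately show ?thesis using assms(1) by (auto simp: smooth_def)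
qed

lemma smooth_if_derivative_smooth:
  assumes "\<And>t. (f has_real_derivative g t) (at t)" "smooth g"
  shows "smooth f"
  by (rule smooth_coinduct[of _ "insert f {h. smooth h}"])
     (use assms smooth_has_derivative smooth_deriv in blast)+

lemma smooth_lincomb:
  assumes "smooth f" "smooth g"
  shows "smooth (\<lambda>t. a * f t + b * g t)"
proof (rule smooth_coinduct[of _ "{\<lambda>t. a * f t + b * g t | f g. smooth f \<and> smooth g}"])
  fix h assume "h \<in> {\<lambda>t. a * f t + b * g t | f g. smooth f \<and> smooth g}"
  then obtain f g where h: "h = (\<lambda>t. a * f t + b * g t)" "smooth f" "smooth g" by blast
  show "\<exists>h'\<in>{\<lambda>t. a * f t + b * g t | f g. smooth f \<and> smooth g}. \<forall>t. (h has_real_derivative h' t) (at t)"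
  proof (intro bexI allI)
    show "(h has_real_derivative a * deriv f t + b * deriv g t) (at t)" for t
      using h by (auto intro!: derivative_eq_intros smooth_has_derivative)
  qed (use h smooth_deriv in blast)
qed (use assms in blast)

lemma smooth_affine:
  assumes "smooth f"
  shows "smooth (\<lambda>t. f (a * t + b))"
proof (rule smooth_coinduct[of _ "{\<lambda>t. c * f (a * t + b) | c f. smooth f}"])
  fix h assume "h \<in> {\<lambda>t. c * f (a * t + b) | c f. smooth f}"
  then obtain c f where h: "h = (\<lambda>t. c * f (a * t + b))" "smooth f" by blast
  show "\<exists>h'\<in>{\<lambda>t. c * f (a * t + b) | c f. smooth f}. \<forall>t. (h has_real_derivative h' t) (at t)"
  proof (intro bexI allI)
    have "((\<lambda>t. f (a * t + b)) has_real_derivative deriv f (a * t + b) * a) (at t)" for t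
      by (rule DERIV_chain2[of f, OF smooth_has_derivative[OF h(2)]]) (auto intro!: derivative_eq_intros)
    then show "(h has_real_derivative (c * a) * deriv f (a * t + b)) (at t)" for t
      unfolding h(1) by (auto intro!: derivative_eq_intros)
  qed (use h smooth_deriv in blast)
qed (use assms in \<open>auto intro!: exI[of _ 1]\<close>)

text \<open>Closed under differentiation by the Leibniz rule, hence a suitable set for coinduction.\<close>

inductive sum_of_products :: "(real \<Rightarrow> real) \<Rightarrow> bool" where
  prod: "smooth f \<Longrightarrow> smooth g \<Longrightarrow> sum_of_products (\<lambda>t. f t * g t)"
| sum: "sum_of_products f \<Longrightarrow> sum_of_products g \<Longrightarrow> sum_of_products (\<lambda>t. f t + g t)"

lemma smooth_mult:
  assumes "smooth f" "smooth g"
  shows "smooth (\<lambda>t. f t * g t)"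
proof (rule smooth_coinduct[of _ "Collect sum_of_products"])
  fix h assume "h \<in> Collect sum_of_products"
  then have "sum_of_products h" by simp
  then show "\<exists>h'\<in>Collect sum_of_products. \<forall>t. (h has_real_derivative h' t) (at t)"
  proof induction
    case (prod f g)
    show ?case
    proof (intro bexI allI)
      show "((\<lambda>t. f t * g t) has_real_derivative deriv f t * g t + f t * deriv g t) (at t)" for t
        using prod by (auto intro!: derivative_eq_intros smooth_has_derivative)
      show "(\<lambda>t. deriv f t * g t + f t * deriv g t) \<in> Collect sum_of_products"
        using prod by (intro CollectI sum_of_products.intros smooth_deriv)
    qed
  next
    case (sum f g)
    then obtain f' g' where "sum_of_products f'" "\<forall>t. (f has_real_derivative f' t) (at t)"
      "sum_of_products g'" "\<forall>t. (g has_real_derivative g' t) (at t)" by blast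
    then have "sum_of_products (\<lambda>t. f' t + g' t)" "\<forall>t. ((\<lambda>t. f t + g t) has_real_derivative f' t + g' t) (at t)"
      by (auto intro: sum_of_products.sum intro!: derivative_eq_intros)
    then show ?case by (intro bexI[where x="\<lambda>t. f' t + g' t"]) simp_all
  qed
qed (use assms in \<open>auto intro: sum_of_products.prod\<close>)

text \<open>\<open>flat 0\<close> is the standard smooth function \<open>exp (- 1/x)\<close> that vanishes with all derivatives at 0.
  The powers of \<open>1/x\<close> make the family closed under differentiation up to linear combinations.\<close>

definition flat :: "nat \<Rightarrow> real \<Rightarrow> real" where
  "flat k x = (if x > 0 then (1 / x) ^ k * exp (- (1 / x)) else 0)"

lemma flat_has_derivative:
  "(flat k has_real_derivative - real k * flat (Suc k) x + flat (Suc (Suc k)) x) (at x)"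
proof -
  consider "x > 0" | "x < 0" | "x = 0" by linarith
  then show ?thesis
  proof cases
    case 1
    have inv: "((\<lambda>x::real. 1 / x) has_real_derivative - ((1 / x)\<^sup>2)) (at x)"
      using 1 by (auto intro!: derivative_eq_intros simp: power2_eq_square field_simps)
    have "((\<lambda>x. (1 / x) ^ k * exp (- (1 / x))) has_real_derivative
        - real k * flat (Suc k) x + flat (Suc (Suc k)) x) (at x)"
    proof -
      have pow: "real k * (1 / x) ^ (k - 1) * (1 / x)\<^sup>2 = real k * (1 / x) ^ Suc k"
        by (cases k) (simp_all add: power2_eq_square)
      have "flat (Suc k) x = (1 / x) ^ Suc k * exp (- (1 / x))"
        "flat (Suc (Suc k)) x = (1 / x) ^ k * (1 / x)\<^sup>2 * exp (- (1 / x))"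
        using 1 by (simp_all add: flat_def power2_eq_square)
      then have val: "(real k * (1 / x) ^ (k - 1) * exp (- (1 / x)) - (1 / x) ^ k * exp (- (1 / x))) * - ((1 / x)\<^sup>2)
          = - real k * flat (Suc k) x + flat (Suc (Suc k)) x"
        using arg_cong[OF pow, of "\<lambda>z. z * exp (- (1 / x))"]
        by (simp only: algebra_simps)
      have "((\<lambda>y::real. y ^ k * exp (- y)) has_real_derivative
         real k * y ^ (k - 1) * exp (- y) - y ^ k * exp (- y)) (at y)" for y
        by (auto intro!: derivative_eq_intros)
      from DERIV_chain2[OF this inv] show ?thesis
        by (simp only: val)
    qed
    then show ?thesis
      by (rule DERIV_cong_ev[THEN iffD1, rotated -1, OF _ refl _ refl])
         (use eventually_nhds_in_open[of "{0<..}" x] 1 in \<open>auto elim!: eventually_mono simp: flat_def\<close>)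
  next
    case 2
    have "((\<lambda>x::real. 0::real) has_real_derivative 0) (at x)" by simp
    then have "(flat k has_real_derivative 0) (at x)"
      by (rule DERIV_cong_ev[THEN iffD1, rotated -1, OF _ refl _ refl])
         (use eventually_nhds_in_open[of "{..<0}" x] 2 in \<open>auto elim!: eventually_mono simp: flat_def\<close>)
    then show ?thesis using 2 by (simp add: flat_def)
  next
    case 3
    have "((\<lambda>h. flat k h / h) \<longlongrightarrow> 0) (at 0)"
    proof (rule filterlim_split_at)
      have "((\<lambda>y::real. y ^ Suc k / exp y) \<longlongrightarrow> 0) at_top" for k by (rule tendsto_power_div_exp_0)
      then have "((\<lambda>h::real. (inverse h) ^ Suc k / exp (inverse h)) \<longlongrightarrow> 0) (at_right 0)"
        by (rule filterlim_compose) (rule filterlim_inverse_at_top_right)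
      moreover have "\<forall>\<^sub>F h in at_right 0. (inverse h) ^ Suc k / exp (inverse h) = flat k h / h"
        by (rule eventually_at_right_less[THEN eventually_mono])
           (simp add: flat_def exp_minus field_simps)
      ultimately show "((\<lambda>h. flat k h / h) \<longlongrightarrow> 0) (at_right 0)"
        by (simp add: filterlim_cong)
      have "\<forall>\<^sub>F h in at_left 0. 0 = flat k h / h"
        by (rule eventually_at_left_real[of "-1::real" 0, THEN eventually_mono]) (auto simp: flat_def)
      then show "((\<lambda>h. flat k h / h) \<longlongrightarrow> 0) (at_left 0)"
        by (simp add: tendsto_eventually eventually_mono)
    qed
    then show ?thesis using 3 by (simp add: DERIV_def flat_def)
  qed
qed

inductive flat_combination :: "(real \<Rightarrow> real) \<Rightarrow> bool" where
  "flat_combination (\<lambda>t. c * flat k t)"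
| "flat_combination f \<Longrightarrow> flat_combination g \<Longrightarrow> flat_combination (\<lambda>t. f t + g t)"

lemma smooth_flat: "smooth (flat 0)"
proof (rule smooth_coinduct[of _ "Collect flat_combination"])
  fix h assume "h \<in> Collect flat_combination"
  then have "flat_combination h" by simp
  then show "\<exists>h'\<in>Collect flat_combination. \<forall>t. (h has_real_derivative h' t) (at t)"
  proof induction
    case (1 c k)
    show ?case
    proof (intro bexI allI)
      show "((\<lambda>t. c * flat k t) has_real_derivative (- c * real k) * flat (Suc k) t + c * flat (Suc (Suc k)) t) (at t)" for t
        using flat_has_derivative[of k t] by (auto intro!: derivative_eq_intros simp: algebra_simps)
      show "(\<lambda>t. (- c * real k) * flat (Suc k) t + c * flat (Suc (Suc k)) t) \<in> Collect flat_combination"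
        by (intro CollectI flat_combination.intros)
    qed
  next
    case (2 f g)
    then obtain f' g' where "flat_combination f'" "\<forall>t. (f has_real_derivative f' t) (at t)"
      "flat_combination g'" "\<forall>t. (g has_real_derivative g' t) (at t)" by blast
    then have "flat_combination (\<lambda>t. f' t + g' t)" "\<forall>t. ((\<lambda>t. f t + g t) has_real_derivative f' t + g' t) (at t)"
      by (auto intro: flat_combination.intros intro!: derivative_eq_intros)
    then show ?case by (intro bexI[where x="\<lambda>t. f' t + g' t"]) simp_all
  qed
next
  have "flat_combination (\<lambda>t. 1 * flat 0 t)" by (rule flat_combination.intros)
  then show "flat 0 \<in> Collect flat_combination" by simp
qed

lemma smooth_continuous: "smooth f \<Longrightarrow> continuous_on UNIV f"
  by (meson smooth_has_derivative DERIV_continuous_on has_field_derivative_at_within)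

lemma primitive_smooth:
  assumes "smooth f"
  shows "primitive f (deriv f)"
  using smooth_has_derivative[OF assms] smooth_continuous[OF smooth_deriv[OF assms]]
  by (intro primitive_of_C1) (auto simp: has_real_derivative_iff_has_vector_derivative)

lemma smooth_primitive_exists:
  assumes "smooth g"
  obtains f where "smooth f" "primitive f g" "deriv f = g" "f c = 0"
proof -
  obtain h where h: "primitive h g"
    using primitive_exists[OF locally_integrable_continuous[OF smooth_continuous[OF assms]]] .
  define f where "f t = h t - h c" for t
  have f: "primitive f g" using h by (simp add: primitive_def f_def)
  have d: "(f has_real_derivative g t) (at t)" for t
    unfolding has_real_derivative_iff_has_vector_derivative
    using smooth_continuous[OF assms] by (intro primitive_has_vector_derivative[OF f]) (simp add: continuous_on_eq_continuous_at)
  show thesis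
    by (rule that[of f]) (use d f smooth_if_derivative_smooth[OF d assms] in \<open>auto simp: f_def intro!: DERIV_imp_deriv\<close>)
qed

text \<open>The normalized integral of the bump \<open>flat 0 t * flat 0 (1 - t)\<close>, which is supported in the unit
  interval.\<close>

lemma smooth_step_exists:
  "\<exists>\<sigma>. smooth \<sigma> \<and> (\<forall>t\<le>0. \<sigma> t = 0) \<and> (\<forall>t\<ge>1. \<sigma> t = 1) \<and> (\<forall>t. 0 \<le> \<sigma> t \<and> \<sigma> t \<le> 1)"
proof -
  define b where "b t = flat 0 t * flat 0 ((-1) * t + 1)" for t
  have b: "smooth b" unfolding b_def by (intro smooth_mult smooth_flat smooth_affine)
  have b0: "b t = 0" if "t \<le> 0 \<or> 1 \<le> t" for t using that by (auto simp: b_def flat_def)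
  have bpos: "b t > 0" if "0 < t" "t < 1" for t using that by (auto simp: b_def flat_def)
  have bnn: "b t \<ge> 0" for t using b0[of t] bpos[of t] by fastforce
  obtain f where f: "smooth f" "deriv f = b" "f 0 = 0" using smooth_primitive_exists[OF b] by metis
  have df: "(f has_real_derivative b t) (at t)" for t using smooth_has_derivative[OF f(1)] f(2) by simp
  have mono: "f s \<le> f t" if "s \<le> t" for s t
    by (rule DERIV_nonneg_imp_nondecreasing[OF that]) (use df bnn in blast)
  have f1: "f 1 > 0"
  proof -
    have "f 0 < f 1"
      by (rule DERIV_pos_imp_increasing_open[of 0 1 f])
         (use df bpos continuous_on_subset[OF smooth_continuous[OF f(1)]] in \<open>auto 4 4\<close>)
    then show ?thesis using f(3) by simp
  qed
  have const: "f s = f t" if "s \<le> t" "t \<le> 0 \<or> 1 \<le> s" for s t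
  proof (rule antisym[OF mono[OF that(1)]])
    show "f t \<le> f s"
      by (rule DERIV_nonpos_imp_nonincreasing[OF that(1)]) (use df b0 that in \<open>metis order.trans order_refl\<close>)
  qed
  have lo: "f t = 0" if "t \<le> 0" for t using const[of t 0] that f(3) by simp
  have hi: "f t = f 1" if "1 \<le> t" for t using const[of 1 t] that by simp
  have b: "0 \<le> f t" "f t \<le> f 1" for t
    using mono[of "0" t] lo[of t] mono[of t 1] hi[of t] f(3) f1 by (cases "0 \<le> t"; cases "t \<le> 1"; force)+
  show ?thesis
  \<comment> \<open>The quotient \<open>f t / f 1\<close>, written as a linear combination of smooth functions.\<close>
  proof (intro exI[of _ "\<lambda>t. (1 / f 1) * f t + 0 * f t"] conjI allI impI)
    show "smooth (\<lambda>t. (1 / f 1) * f t + 0 * f t)" by (rule smooth_lincomb[OF f(1) f(1)])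
    fix t
    show "0 \<le> (1 / f 1) * f t + 0 * f t" "(1 / f 1) * f t + 0 * f t \<le> 1"
      using b f1 by (simp_all add: divide_le_eq)
    show "(1 / f 1) * f t + 0 * f t = 0" if "t \<le> 0" using lo[OF that] by simp
    show "(1 / f 1) * f t + 0 * f t = 1" if "1 \<le> t" unfolding hi[OF that] using f1 by simp
  qed
qed

section \<open>Almost everywhere equality and test functions\<close>

lemma ae_eq_refl [simp]: "ae_eq f f" by (simp add: ae_eq_def)
lemma ae_eq_sym: "ae_eq f g \<Longrightarrow> ae_eq g f" unfolding ae_eq_def by (erule eventually_mono) simp
lemma ae_eq_trans:
  assumes "ae_eq f g" "ae_eq g h"
  shows "ae_eq f h"
  using assms unfolding ae_eq_def by eventually_elim simp

text \<open>The Lebesgue measure is complete, and preimages of open sets under \<open>f\<close> and \<open>g\<close> differ by null sets.\<close>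

lemma borel_measurable_lebesgue_AE:
  fixes f g :: "real \<Rightarrow> 'a::topological_space"
  assumes f: "f \<in> borel_measurable lebesgue" and ae: "AE x in lebesgue. f x = g x"
  shows "g \<in> borel_measurable lebesgue"
proof (rule borel_measurableI)
  fix U :: "'a set" assume "open U"
  then have "f -` U \<inter> space lebesgue \<in> sets lebesgue"
    using f by (metis measurable_sets borel_open)
  moreover have "AE x in lebesgue. x \<in> f -` U \<longleftrightarrow> x \<in> g -` U"
    using ae by eventually_elim simp
  ultimately show "g -` U \<inter> space lebesgue \<in> sets lebesgue"
    using completion.in_sets_AE[of "f -` U" "g -` U" lborel] by (auto simp: space_completion)
qed

lemma set_borel_measurable_cong_AE:
  fixes f g :: "real \<Rightarrow> 'a::real_normed_vector"
  assumes "set_borel_measurable lebesgue S f" "AE x in lebesgue. x \<in> S \<longrightarrow> f x = g x"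
  shows "set_borel_measurable lebesgue S g"
  using assms(1) unfolding set_borel_measurable_def
  by (rule borel_measurable_lebesgue_AE) (use assms(2) in \<open>eventually_elim, auto\<close>)

lemma set_integrable_measurable: "set_integrable M S f \<Longrightarrow> set_borel_measurable M S f"
  by (simp add: set_integrable_def set_borel_measurable_def)

lemma set_integrable_AE_eq:
  fixes f g :: "real \<Rightarrow> 'a::{banach,second_countable_topology}"
  assumes "set_integrable lebesgue S f" "AE x in lebesgue. x \<in> S \<longrightarrow> f x = g x"
  shows "set_integrable lebesgue S g"
proof -
  have "set_borel_measurable lebesgue S g"
    by (rule set_borel_measurable_cong_AE[OF set_integrable_measurable[OF assms(1)] assms(2)])
  then show ?thesis
    using assms unfolding set_integrable_def set_borel_measurable_def
    by (subst integrable_cong_AE[of _ _ "\<lambda>x. indicator S x *\<^sub>R f x"]) (auto elim!: eventually_mono)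
qed

text \<open>If one side is not integrable, then neither is the other, and both integrals have the value 0;
  so integrability need not be checked.\<close>

lemma set_integral_AE_eq:
  fixes f g :: "real \<Rightarrow> 'a::{banach,second_countable_topology}"
  assumes "AE x in lebesgue. x \<in> S \<longrightarrow> f x = g x"
  shows "(LINT x:S|lebesgue. f x) = (LINT x:S|lebesgue. g x)"
proof (cases "set_integrable lebesgue S f")
  case True
  then have "set_integrable lebesgue S g" using assms by (rule set_integrable_AE_eq)
  with True assms show ?thesis
    unfolding set_lebesgue_integral_def set_integrable_def
    by (intro integral_cong_AE) (auto elim!: eventually_mono)
next
  case False
  moreover have "AE x in lebesgue. x \<in> S \<longrightarrow> g x = f x" using assms by eventually_elim simp
  ultimately have "\<not> set_integrable lebesgue S g"
    using set_integrable_AE_eq by blast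
  with False show ?thesis
    unfolding set_lebesgue_integral_def set_integrable_def by (simp add: not_integrable_integral_eq)
qed

lemma set_integral_support:
  fixes h :: "real \<Rightarrow> 'a::{banach,second_countable_topology}"
  assumes "T \<subseteq> S" "\<And>t. t \<in> S \<Longrightarrow> t \<notin> T \<Longrightarrow> h t = 0"
  shows "(LINT t:S|M. h t) = (LINT t:T|M. h t)" "set_integrable M S h \<longleftrightarrow> set_integrable M T h"
proof -
  have "(\<lambda>t. indicator S t *\<^sub>R h t) = (\<lambda>t. indicator T t *\<^sub>R h t)"
    using assms by (intro ext) (auto simp: indicator_def)
  then show "(LINT t:S|M. h t) = (LINT t:T|M. h t)" "set_integrable M S h \<longleftrightarrow> set_integrable M T h"
    unfolding set_lebesgue_integral_def set_integrable_def by (simp_all only:)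
qed

lemma sigma_finite_lebesgue: "sigma_finite_measure (lebesgue :: real measure)"
proof (unfold_locales, intro exI[of _ "range (\<lambda>n::nat. {- real n..real n})"] conjI ballI)
  have "x \<in> (\<Union>n::nat. {- real n..real n})" for x
  proof -
    obtain n where "\<bar>x\<bar> \<le> real n" using real_arch_simple by blast
    then have "x \<in> {- real n..real n}" by auto
    then show ?thesis by blast
  qed
  then show "\<Union> (range (\<lambda>n::nat. {- real n..real n})) = space lebesgue" by auto
qed auto

text \<open>The sets over which the integral vanishes form a Dynkin system that contains the half-lines,
  hence all Borel sets, and then all Lebesgue sets; densities of vector measures are unique.\<close>

lemma AE_zero_of_interval_integrals:
  fixes g :: "real \<Rightarrow> 'a::{banach,second_countable_topology}"
  assumes g: "set_integrable lebesgue {c..d} g"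
    and zero: "\<And>s t. c \<le> s \<Longrightarrow> s \<le> t \<Longrightarrow> t \<le> d \<Longrightarrow> (LINT x:{s..t}|lebesgue. g x) = 0"
  shows "AE x in lebesgue. x \<in> {c..d} \<longrightarrow> g x = 0"
proof (cases "c \<le> d")
  case True
  define G where "G x = indicator {c..d} x *\<^sub>R g x" for x
  have G: "integrable lebesgue G" using g by (simp add: G_def[abs_def] set_integrable_def)
  have Gs: "set_integrable lebesgue A G" if "A \<in> sets lebesgue" for A
    using that G by (simp add: set_integrable_def integrable_mult_indicator)
  have all: "(LINT x:UNIV|lebesgue. G x) = 0"
    using zero[of c d] True by (simp add: G_def set_lebesgue_integral_def)
  have borel: "(LINT x:A|lebesgue. G x) = 0" if "A \<in> sigma_sets UNIV (range (\<lambda>a::real. {..a}))" for A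
  proof (rule sigma_sets_induct_disjoint[OF _ _ that])
    have leb: "B \<in> sets lebesgue" if "B \<in> sigma_sets UNIV (range (\<lambda>a::real. {..a}))" for B
    proof -
      have "B \<in> sets borel" using that by (simp add: borel_eq_atMost)
      then show ?thesis by (metis sets_completionI_sets sets_lborel)
    qed
    show "Int_stable (range (\<lambda>a::real. {..a}))" by (auto simp: Int_stable_def)
    show "range (\<lambda>a::real. {..a}) \<subseteq> Pow UNIV" by simp
    show "(LINT x:{}|lebesgue. G x) = 0" by (simp add: set_lebesgue_integral_def)
    show "(LINT x:B|lebesgue. G x) = 0" if B: "B \<in> range (\<lambda>a::real. {..a})" for B
    proof -
      from B obtain a where a: "B = {..a}" by auto
      show ?thesis
      proof (cases "c \<le> a")
        case True
        have "(LINT x:B|lebesgue. G x) = (LINT x:{c..min a d}|lebesgue. g x)"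
          unfolding set_lebesgue_integral_def G_def a
          by (rule Bochner_Integration.integral_cong) (auto simp: indicator_def)
        then show ?thesis using zero[of c "min a d"] True \<open>c \<le> d\<close> by simp
      next
        case False
        then show ?thesis
          unfolding set_lebesgue_integral_def G_def a
          by (intro integral_eq_zero_AE AE_I2) (auto simp: indicator_def)
      qed
    qed
    show "(LINT x:UNIV - B|lebesgue. G x) = 0"
      if "B \<in> sigma_sets UNIV (range (\<lambda>a::real. {..a}))" "(LINT x:B|lebesgue. G x) = 0" for B
    proof -
      have "(LINT x:B \<union> (UNIV - B)|lebesgue. G x) = (LINT x:B|lebesgue. G x) + (LINT x:UNIV - B|lebesgue. G x)"
        using leb[OF that(1)] by (intro set_integral_Un Gs) auto
      then show ?thesis using all that(2) by simp
    qed
    show "(LINT x:(\<Union>i::nat. B i)|lebesgue. G x) = 0"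
      if B: "disjoint_family B" "range B \<subseteq> sigma_sets UNIV (range (\<lambda>a::real. {..a}))" "\<And>i. (LINT x:B i|lebesgue. G x) = 0" for B
    proof -
      have m: "B i \<in> sets lebesgue" for i using B(2) leb by blast
      have "(LINT x:(\<Union>i. B i)|lebesgue. G x) = (\<Sum>i. LINT x:B i|lebesgue. G x)"
        using B(1) m by (intro lebesgue_integral_countable_add Gs) (auto simp: disjoint_family_on_def)
      then show ?thesis using B(3) by simp
    qed
  qed
  have "AE x in lebesgue. G x = 0"
  proof (rule sigma_finite_measure.density_zero[OF _ G])
    fix A :: "real set" assume A: "A \<in> sets lebesgue"
    define B where "B = main_part lborel A"
    have B: "B \<in> sets borel" using main_part_sets[OF A] by (simp add: B_def)
    have N: "A = B \<union> null_part lborel A" using main_part_null_part_Un[OF A] by (simp add: B_def)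
    have "null_part lborel A \<in> null_sets lebesgue"
      using A by (simp add: null_sets_completion_subset null_part_null_sets)
    then have "AE x in lebesgue. x \<notin> null_part lborel A" by (rule AE_not_in)
    then have ae: "AE x in lebesgue. x \<in> B \<longleftrightarrow> x \<in> A"
      by eventually_elim (use N in blast)
    have "B \<in> sets lebesgue" using B by (metis sets_completionI_sets sets_lborel)
    then have "(LINT x:A|lebesgue. G x) = (LINT x:B|lebesgue. G x)"
      using A ae by (intro set_integral_cong_set) (auto intro!: set_integrable_measurable Gs)
    also have "\<dots> = 0" using B by (intro borel) (simp add: borel_eq_atMost)
    finally show "(LINT x:A|lebesgue. G x) = 0" .
  qed (rule sigma_finite_lebesgue)
  then show ?thesis by eventually_elim (auto simp: G_def)
next
  case False
  then show ?thesis by simp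
qed

lemma test_function_iff:
  "test_function S \<eta> \<longleftrightarrow> smooth \<eta> \<and> (\<exists>K. compact K \<and> K \<subseteq> S \<and> (\<forall>t. t \<notin> K \<longrightarrow> \<eta> t = 0))"
  by (simp add: test_function_def smooth_def)

lemma deriv_zero_outside:
  fixes \<eta> :: "real \<Rightarrow> real"
  assumes "compact K" "\<And>t. t \<notin> K \<Longrightarrow> \<eta> t = 0" "t \<notin> K"
  shows "deriv \<eta> t = 0"
proof -
  have "\<forall>\<^sub>F s in nhds t. \<eta> s = 0"
    using eventually_nhds_in_open[OF open_Compl[OF compact_imp_closed[OF assms(1)]], of t] assms(2,3)
    by (auto elim!: eventually_mono)
  then show ?thesis using deriv_cong_ev[of \<eta> "\<lambda>_. 0" t t] by simp
qed

lemma test_function_support: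
  assumes "test_function S \<eta>"
  obtains R where "R > 0" "\<And>t. t \<notin> {-R<..<R} \<Longrightarrow> \<eta> t = 0" "\<And>t. t \<notin> {-R<..<R} \<Longrightarrow> deriv \<eta> t = 0"
proof -
  obtain K where K: "compact K" "\<And>t. t \<notin> K \<Longrightarrow> \<eta> t = 0" using assms by (auto simp: test_function_def)
  obtain r where r: "r > 0" "\<And>t. t \<in> K \<Longrightarrow> \<bar>t\<bar> \<le> r"
    using compact_imp_bounded[OF K(1)] by (auto simp: bounded_pos)
  have "t \<notin> K" if "t \<notin> {-(r+1)<..<r+1}" for t using r(2)[of t] that by auto
  then show thesis
    using that[of "r + 1"] r(1) K(2) deriv_zero_outside[OF K] by auto
qed

lemma test_function_deriv: "test_function S \<eta> \<Longrightarrow> test_function S (deriv \<eta>)"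
  unfolding test_function_iff using smooth_deriv deriv_zero_outside by metis

lemma test_function_integrable:
  fixes v :: "real \<Rightarrow> 'a::{banach,second_countable_topology}"
  assumes v: "locally_integrable_on v S" and \<eta>: "test_function S \<eta>"
  shows "set_integrable lebesgue S (\<lambda>t. \<eta> t *\<^sub>R v t)"
proof -
  obtain K where K: "compact K" "K \<subseteq> S" "\<And>t. t \<notin> K \<Longrightarrow> \<eta> t = 0" "smooth \<eta>"
    using \<eta> by (auto simp: test_function_iff)
  have "compact (\<eta> ` K)"
    by (rule compact_continuous_image[OF continuous_on_subset[OF smooth_continuous[OF K(4)]] K(1)]) simp
  then have "bounded (\<eta> ` K)" by (rule compact_imp_bounded)
  then obtain C where C: "\<And>t. t \<in> K \<Longrightarrow> norm (\<eta> t) \<le> C" unfolding bounded_iff by blast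
  have "K \<in> sets lebesgue" using K(1) by (metis compact_imp_closed borel_closed sets_completionI_sets sets_lborel)
  then have "set_integrable lebesgue K (\<lambda>t. \<eta> t *\<^sub>R v t)"
    using v K(1,2) C
    by (intro set_integrable_bilinear_bounded[OF bounded_bilinear.flip[OF bounded_bilinear_scaleR], of _ _ v \<eta> C])
       (auto simp: locally_integrable_on_def intro!: set_borel_measurable_continuous smooth_continuous K(4))
  then show ?thesis
    by (subst set_integral_support(2)[OF K(2)]) (use K(3) in auto)
qed

text \<open>The fundamental lemma of the calculus of variations: products of two rescaled smooth steps are test
  functions that converge boundedly to the indicator of an interval.\<close>

lemma AE_zero_of_test_integrals:
  fixes g :: "real \<Rightarrow> 'a::{banach,second_countable_topology}"
  assumes g: "locally_integrable_on g S" and cd: "{c..d} \<subseteq> S"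
    and zero: "\<And>\<eta>. test_function S \<eta> \<Longrightarrow> (LINT t:S|lebesgue. \<eta> t *\<^sub>R g t) = 0"
  shows "AE x in lebesgue. x \<in> {c..d} \<longrightarrow> g x = 0"
proof (rule AE_zero_of_interval_integrals)
  show "set_integrable lebesgue {c..d} g" using g cd by (auto simp: locally_integrable_on_def)
  fix s t :: real assume st: "c \<le> s" "s \<le> t" "t \<le> d"
  obtain \<sigma> :: "real \<Rightarrow> real" where \<sigma>: "smooth \<sigma>" "\<And>t. t \<le> 0 \<Longrightarrow> \<sigma> t = 0" "\<And>t. 1 \<le> t \<Longrightarrow> \<sigma> t = 1"
    "\<And>t. 0 \<le> \<sigma> t" "\<And>t. \<sigma> t \<le> 1"
    using smooth_step_exists by auto
  \<comment> \<open>\<open>\<sigma> (n (x - s)) \<sigma> (n (t - x))\<close> in affine form.\<close>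
  define \<eta> where "\<eta> n x = \<sigma> (real n * x + (- real n * s)) * \<sigma> (- real n * x + real n * t)" for n :: nat and x
  have sm: "smooth (\<eta> n)" for n
    unfolding \<eta>_def by (intro smooth_mult smooth_affine \<sigma>(1))
  have out: "\<eta> n x = 0" if "x \<notin> {s<..<t}" for n x
  proof -
    have "real n * x + (- real n * s) = real n * (x - s)" "- real n * x + real n * t = real n * (t - x)"
      by (simp_all add: algebra_simps)
    then show ?thesis using that \<sigma>(2) unfolding \<eta>_def
      by (auto simp: not_less mult_nonneg_nonpos mult_le_0_iff)
  qed
  have bd: "\<bar>\<eta> n x\<bar> \<le> 1" for n x
    unfolding \<eta>_def using \<sigma>(4,5) by (auto simp: abs_mult intro!: mult_le_one)
  have inside: "\<forall>\<^sub>F n in sequentially. \<eta> n x = 1" if "x \<in> {s<..<t}" for x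
  proof -
    obtain N1 N2 where N: "1 / (x - s) \<le> real N1" "1 / (t - x) \<le> real N2" using real_arch_simple by metis
    have "\<eta> n x = 1" if "n \<ge> max N1 N2" for n
    proof -
      have "1 / (x - s) \<le> real n" "1 / (t - x) \<le> real n" using N that by auto
      then have "1 \<le> real n * (x - s)" "1 \<le> real n * (t - x)"
        using \<open>x \<in> {s<..<t}\<close> by (auto simp: divide_le_eq)
      moreover have "real n * x + (- real n * s) = real n * (x - s)" "- real n * x + real n * t = real n * (t - x)"
        by (simp_all add: algebra_simps)
      ultimately show ?thesis using \<sigma>(3) by (simp add: \<eta>_def)
    qed
    then show ?thesis unfolding eventually_sequentially by blast
  qed
  have gi: "set_integrable lebesgue {s..t} g"
  proof -
    have "compact {s..t}" "{s..t} \<subseteq> S" using cd st by auto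
    then show ?thesis using g unfolding locally_integrable_on_def by blast
  qed
  let ?g = "\<lambda>x. indicator {s..t} x *\<^sub>R g x"
  have zn: "(LINT x|lebesgue. \<eta> n x *\<^sub>R ?g x) = 0" for n
  proof -
    have "test_function S (\<eta> n)"
      unfolding test_function_iff using sm cd st out
      by (intro conjI exI[of _ "{s..t}"]) (auto simp: less_le_not_le)
    from zero[OF this] have "(LINT x:{s..t}|lebesgue. \<eta> n x *\<^sub>R g x) = 0"
      by (subst (asm) set_integral_support(1)[of "{s..t}" S]) (use out cd st in \<open>auto simp: less_le_not_le\<close>)
    then show ?thesis by (simp add: set_lebesgue_integral_def mult.commute)
  qed
  have "(\<lambda>n. LINT x|lebesgue. \<eta> n x *\<^sub>R ?g x) \<longlonglongrightarrow> (LINT x|lebesgue. ?g x)"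
  proof (rule integral_dominated_convergence[where w="\<lambda>x. norm (?g x)"])
    show gm: "?g \<in> borel_measurable lebesgue" and "integrable lebesgue (\<lambda>x. norm (?g x))"
      using gi unfolding set_integrable_def by (rule borel_measurable_integrable, rule integrable_norm)
    have "\<eta> n \<in> borel_measurable lebesgue" for n
      using borel_measurable_continuous_onI[OF smooth_continuous[OF sm]] by (intro measurable_completion) simp
    then show "(\<lambda>x. \<eta> n x *\<^sub>R ?g x) \<in> borel_measurable lebesgue" for n
      by (intro borel_measurable_scaleR gm)
    have "AE x in lebesgue. x \<noteq> s" "AE x in lebesgue. x \<noteq> t" by (auto intro: AE_I'[of "{s}"] AE_I'[of "{t}"])
    then show "AE x in lebesgue. (\<lambda>n. \<eta> n x *\<^sub>R ?g x) \<longlonglongrightarrow> ?g x"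
    proof eventually_elim
      case (elim x)
      show ?case
      proof (cases "x \<in> {s<..<t}")
        case True
        then show ?thesis using inside[OF True] by (intro tendsto_eventually) (auto elim!: eventually_mono)
      next
        case False
        then have "?g x = 0" using elim by (auto simp: indicator_def)
        then show ?thesis by (simp only: scaleR_zero_right tendsto_const)
      qed
    qed
    show "AE x in lebesgue. norm (\<eta> n x *\<^sub>R ?g x) \<le> norm (?g x)" for n
    proof (rule AE_I2)
      fix x
      show "norm (\<eta> n x *\<^sub>R ?g x) \<le> norm (?g x)"
        unfolding norm_scaleR[of "\<eta> n x"] using bd[of n x] by (rule mult_left_le_one_le[rotated 2]) simp_all
    qed
  qed
  then have "(LINT x|lebesgue. ?g x) = 0" unfolding zn by (simp add: LIMSEQ_const_iff)
  then show "(LINT x:{s..t}|lebesgue. g x) = 0" by (simp add: set_lebesgue_integral_def)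
qed

lemma locally_integrable_diff:
  "locally_integrable_on f S \<Longrightarrow> locally_integrable_on g S \<Longrightarrow> locally_integrable_on (\<lambda>t. f t - g t) S"
  by (auto simp: locally_integrable_on_def intro: set_integral_diff(1))

lemma has_weak_deriv_unique:
  assumes v: "has_weak_deriv S u v" and w: "has_weak_deriv S u w" and cd: "{c..d} \<subseteq> S"
  shows "AE x in lebesgue. x \<in> {c..d} \<longrightarrow> v x = w x"
proof -
  have "AE x in lebesgue. x \<in> {c..d} \<longrightarrow> v x - w x = 0"
  proof (rule AE_zero_of_test_integrals[OF _ cd])
    show "locally_integrable_on (\<lambda>t. v t - w t) S"
      using v w by (intro locally_integrable_diff) (auto simp: has_weak_deriv_def)
    fix \<eta> assume "test_function S \<eta>"
    then show "(LINT t:S|lebesgue. \<eta> t *\<^sub>R (v t - w t)) = 0"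
      using v w by (simp add: scaleR_diff_right has_weak_deriv_def test_function_integrable set_integral_diff)
  qed
  then show ?thesis by eventually_elim simp
qed

lemma AE_intervals:
  assumes "\<And>n::nat. AE x in lebesgue. x \<in> {- real n..real n} \<longrightarrow> P x"
  shows "AE x in lebesgue. P x"
proof -
  have "AE x in lebesgue. \<forall>n::nat. x \<in> {- real n..real n} \<longrightarrow> P x"
    unfolding AE_all_countable using assms by blast
  then show ?thesis
  proof eventually_elim
    case (elim x)
    obtain n where "\<bar>x\<bar> \<le> real n" using real_arch_simple by blast
    then have "x \<in> {- real n..real n}" by auto
    with elim show ?case by blast
  qed
qed

lemma Dt_ae_eq: "has_weak_deriv UNIV u v \<Longrightarrow> ae_eq (Dt UNIV u) v"
  unfolding ae_eq_def Dt_def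
  by (rule AE_intervals) (rule has_weak_deriv_unique[OF someI[of "has_weak_deriv UNIV u"]], auto)

lemma has_weak_deriv_cong:
  fixes u v :: "real \<Rightarrow> 'a::{banach,second_countable_topology}"
  assumes "has_weak_deriv UNIV u v" "ae_eq u u'" "ae_eq v v'"
  shows "has_weak_deriv UNIV u' v'"
proof -
  have "(LINT t:UNIV|lebesgue. c t *\<^sub>R f' t) = (LINT t:UNIV|lebesgue. c t *\<^sub>R f t)"
    if "ae_eq f f'" for c and f f' :: "real \<Rightarrow> 'a"
    by (rule set_integral_AE_eq) (use that in \<open>auto simp: ae_eq_def elim!: eventually_mono\<close>)
  from this[OF assms(2)] this[OF assms(3)]
  have "(LINT t:UNIV|lebesgue. c t *\<^sub>R u' t) = (LINT t:UNIV|lebesgue. c t *\<^sub>R u t)"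
     "(LINT t:UNIV|lebesgue. c t *\<^sub>R v' t) = (LINT t:UNIV|lebesgue. c t *\<^sub>R v t)" for c
    by blast+
  moreover have "locally_integrable_on f' UNIV"
    if "ae_eq f f'" "locally_integrable_on f UNIV" for f f' :: "real \<Rightarrow> 'a"
  proof -
    have "AE x in lebesgue. x \<in> {a..b} \<longrightarrow> f x = f' x" for a b
      using that(1) unfolding ae_eq_def by eventually_elim simp
    then show ?thesis using that(2) set_integrable_AE_eq unfolding locally_integrable_UNIV_iff by blast
  qed
  from this[OF assms(2)] this[OF assms(3)]
  have "locally_integrable_on u' UNIV" "locally_integrable_on v' UNIV"
    using assms(1) by (auto simp: has_weak_deriv_def)
  ultimately show ?thesis using assms(1) by (simp add: has_weak_deriv_def)
qed

lemma primitive_has_weak_deriv: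
  assumes "primitive u v"
  shows "has_weak_deriv UNIV u v"
  unfolding has_weak_deriv_def
proof (intro conjI allI impI)
  show ui: "locally_integrable_on u UNIV" by (rule locally_integrable_continuous[OF primitive_continuous[OF assms]])
  show vi: "locally_integrable_on v UNIV" by (rule primitiveD(1)[OF assms])
  fix \<eta> assume \<eta>: "test_function UNIV \<eta>"
  obtain R where R: "R > 0" "\<And>t. t \<notin> {-R<..<R} \<Longrightarrow> \<eta> t = 0" "\<And>t. t \<notin> {-R<..<R} \<Longrightarrow> deriv \<eta> t = 0"
    using test_function_support[OF \<eta>] by blast
  have "primitive (\<lambda>t. \<eta> t *\<^sub>R u t) (\<lambda>t. deriv \<eta> t *\<^sub>R u t + \<eta> t *\<^sub>R v t)"
    using \<eta> by (intro primitive_bilinear[OF bounded_bilinear_scaleR] assms primitive_smooth) (simp add: test_function_iff)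
  from primitiveD(3)[OF this, of "-R" R]
  have "(LINT t:{-R..R}|lebesgue. deriv \<eta> t *\<^sub>R u t + \<eta> t *\<^sub>R v t) = 0"
    using R by simp
  then have "(LINT t:UNIV|lebesgue. deriv \<eta> t *\<^sub>R u t + \<eta> t *\<^sub>R v t) = 0"
    by (subst set_integral_support(1)[of "{-R..R}"]) (use R in \<open>auto simp: less_le_not_le\<close>)
  then show "(LINT t:UNIV|lebesgue. deriv \<eta> t *\<^sub>R u t) = - (LINT t:UNIV|lebesgue. \<eta> t *\<^sub>R v t)"
    using set_integral_add(2)[OF test_function_integrable[OF ui test_function_deriv[OF \<eta>]] test_function_integrable[OF vi \<eta>]]
    by (simp add: eq_neg_iff_add_eq_0)
qed

text \<open>Du Bois-Reymond: after subtracting an indefinite integral of \<open>v\<close>, the weak derivative is zero. A test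
  function is a multiple of one fixed bump plus the derivative of a test function, so a function
  with zero weak derivative has the same test integrals as a constant.\<close>

lemma has_weak_deriv_imp_primitive:
  fixes u v :: "real \<Rightarrow> 'a::{banach,second_countable_topology}"
  assumes uv: "has_weak_deriv UNIV u v"
  obtains w where "primitive w v" "ae_eq w u"
proof -
  have ui: "locally_integrable_on u UNIV" and vi: "locally_integrable_on v UNIV"
    using uv by (auto simp: has_weak_deriv_def)
  obtain V where V: "primitive V v" using primitive_exists[OF vi] .
  have Vi: "locally_integrable_on V UNIV" by (rule locally_integrable_continuous[OF primitive_continuous[OF V]])
  define d where "d t = u t - V t" for t
  have di: "locally_integrable_on d UNIV" unfolding d_def by (rule locally_integrable_diff[OF ui Vi])
  have d: "(LINT t:UNIV|lebesgue. deriv \<eta> t *\<^sub>R d t) = 0" if "test_function UNIV \<eta>" for \<eta>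
  proof -
    have "(LINT t:UNIV|lebesgue. deriv \<eta> t *\<^sub>R u t) = (LINT t:UNIV|lebesgue. deriv \<eta> t *\<^sub>R V t)"
      using uv primitive_has_weak_deriv[OF V] that unfolding has_weak_deriv_def by presburger
    then show ?thesis
      unfolding d_def scaleR_diff_right
      by (subst set_integral_diff(2)[OF test_function_integrable[OF ui] test_function_integrable[OF Vi]])
         (use test_function_deriv[OF that] in simp_all)
  qed
  obtain \<sigma> :: "real \<Rightarrow> real" where \<sigma>: "smooth \<sigma>" "\<And>t. t \<le> 0 \<Longrightarrow> \<sigma> t = 0" "\<And>t. 1 \<le> t \<Longrightarrow> \<sigma> t = 1"
    using smooth_step_exists by auto
  define \<rho> where "\<rho> = deriv \<sigma>"
  have \<rho>0: "\<rho> t = 0" if "t \<notin> {0..1}" for t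
  proof -
    have "\<forall>\<^sub>F s in nhds t. \<sigma> s = \<sigma> t"
    proof (cases "t < 0")
      case True
      then have "\<forall>\<^sub>F s in nhds t. s \<in> {..<0}" by (intro eventually_nhds_in_open) auto
      then show ?thesis by (rule eventually_mono) (use True \<sigma>(2) in simp)
    next
      case False
      then have "\<forall>\<^sub>F s in nhds t. s \<in> {1<..}" using that by (intro eventually_nhds_in_open) auto
      then show ?thesis by (rule eventually_mono) (use False that \<sigma>(3)[of t] in \<open>simp add: \<sigma>(3)\<close>)
    qed
    then show ?thesis unfolding \<rho>_def using deriv_cong_ev[of \<sigma> "\<lambda>_. \<sigma> t" t t] by simp
  qed
  have \<rho>s: "smooth \<rho>" unfolding \<rho>_def by (rule smooth_deriv[OF \<sigma>(1)])
  have \<rho>t: "test_function UNIV \<rho>" unfolding test_function_iff using \<rho>s \<rho>0 by (intro conjI exI[of _ "{0..1}"]) auto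
  define c where "c = (LINT t:UNIV|lebesgue. \<rho> t *\<^sub>R d t)"
  have "AE x in lebesgue. x \<in> {- real n..real n} \<longrightarrow> d x - c = 0" for n
  proof (rule AE_zero_of_test_integrals[of _ UNIV])
    have ci: "locally_integrable_on (\<lambda>_. c) UNIV" by (rule locally_integrable_continuous) simp
    show "locally_integrable_on (\<lambda>t. d t - c) UNIV"
      by (intro locally_integrable_diff di ci)
    fix \<zeta> assume \<zeta>: "test_function UNIV \<zeta>"
    obtain R where R: "R > 0" "\<And>t. t \<notin> {-R<..<R} \<Longrightarrow> \<zeta> t = 0" using test_function_support[OF \<zeta>] by metis
    define Q where "Q = max R 1"
    have Q: "Q \<ge> 1" "\<And>t. t \<notin> {-Q<..<Q} \<Longrightarrow> \<zeta> t = 0" using R(2) by (auto simp: Q_def max_def not_less split: if_splits)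
    define I where "I = (LINT t:{-Q..Q}|lebesgue. \<zeta> t)"
    \<comment> \<open>\<open>\<zeta>\<close> minus the multiple of the bump with the same integral; its primitive has compact support.\<close>
    define \<kappa> where "\<kappa> t = 1 * \<zeta> t + (- I) * \<rho> t" for t
    have \<kappa>s: "smooth \<kappa>" unfolding \<kappa>_def using \<zeta> \<rho>s by (intro smooth_lincomb) (auto simp: test_function_iff)
    have \<kappa>0: "\<kappa> t = 0" if "t \<notin> {-Q..Q}" for t using Q \<rho>0[of t] Q(2)[of t] that by (auto simp: \<kappa>_def)
    obtain \<eta> where \<eta>: "smooth \<eta>" "primitive \<eta> \<kappa>" "deriv \<eta> = \<kappa>" "\<eta> (-Q) = 0"
      using smooth_primitive_exists[OF \<kappa>s] by metis
    have \<zeta>i: "locally_integrable_on \<zeta> UNIV" and \<rho>i: "locally_integrable_on \<rho> UNIV"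
      using \<zeta> \<rho>s by (auto intro!: locally_integrable_continuous smooth_continuous simp: test_function_iff)
    have r1: "(LINT t:{-Q..Q}|lebesgue. \<rho> t) = 1"
      using primitiveD(3)[OF primitive_smooth[OF \<sigma>(1)], of "-Q" Q] \<sigma>(2)[of "-Q"] \<sigma>(3)[of Q] Q(1) by (simp add: \<rho>_def)
    have "(LINT t:{-Q..Q}|lebesgue. \<kappa> t) = (LINT t:{-Q..Q}|lebesgue. \<zeta> t) + (LINT t:{-Q..Q}|lebesgue. (- I) * \<rho> t)"
      unfolding \<kappa>_def mult_1
      by (intro set_integral_add(2) set_integrable_mult_right impI locally_integrableD \<zeta>i \<rho>i)
    also have "(LINT t:{-Q..Q}|lebesgue. (- I) * \<rho> t) = (- I) * (LINT t:{-Q..Q}|lebesgue. \<rho> t)"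
      by (rule set_integral_mult_right)
    also have "(LINT t:{-Q..Q}|lebesgue. \<zeta> t) + (- I) * (LINT t:{-Q..Q}|lebesgue. \<rho> t) = 0"
      by (simp add: I_def[symmetric] r1)
    finally have k0: "(LINT t:{-Q..Q}|lebesgue. \<kappa> t) = 0" .
    have z: "(LINT t:{a..b}|lebesgue. \<kappa> t) = 0" if "b \<le> -Q \<or> Q \<le> a" for a b
    proof -
      have "AE x in lebesgue. x \<noteq> Q" "AE x in lebesgue. x \<noteq> -Q" by (auto intro: AE_I'[of "{Q}"] AE_I'[of "{-Q}"])
      then have "AE x in lebesgue. x \<in> {a..b} \<longrightarrow> \<kappa> x = 0"
        by eventually_elim (use that \<kappa>0 in force)
      then show ?thesis using set_integral_AE_eq[of "{a..b}" \<kappa> "\<lambda>_. 0"] by simp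
    qed
    have "\<eta> t = 0" if "t \<notin> {-Q..Q}" for t
    proof (cases "t \<le> -Q")
      case True
      then show ?thesis using primitiveD(3)[OF \<eta>(2) True] z[of "-Q" t] \<eta>(4) by simp
    next
      case False
      then have "Q \<le> t" using that by auto
      then show ?thesis
        using primitiveD(3)[OF \<eta>(2), of Q t] primitiveD(3)[OF \<eta>(2), of "-Q" Q] z[of t Q] \<eta>(4) k0 Q(1) by simp
    qed
    then have "test_function UNIV \<eta>" unfolding test_function_iff using \<eta>(1) by (intro conjI exI[of _ "{-Q..Q}"]) auto
    from d[OF this] have k: "(LINT t:UNIV|lebesgue. \<kappa> t *\<^sub>R d t) = 0" by (simp add: \<eta>(3))
    have Ic: "(LINT t:UNIV|lebesgue. \<zeta> t *\<^sub>R c) = I *\<^sub>R c"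
    proof -
      have "(LINT t:UNIV|lebesgue. \<zeta> t *\<^sub>R c) = (LINT t:{-Q..Q}|lebesgue. \<zeta> t *\<^sub>R c)"
        by (rule set_integral_support(1)) (use Q in \<open>auto simp: less_le_not_le\<close>)
      then show ?thesis using set_integral_bounded_linear(2)[OF bounded_linear_scaleR_left locally_integrableD[OF \<zeta>i]]
        by (simp add: I_def)
    qed
    have "(LINT t:UNIV|lebesgue. \<kappa> t *\<^sub>R d t)
        = (LINT t:UNIV|lebesgue. \<zeta> t *\<^sub>R d t) + (LINT t:UNIV|lebesgue. (- I) *\<^sub>R (\<rho> t *\<^sub>R d t))"
      unfolding \<kappa>_def mult_1 scaleR_add_left scaleR_scaleR[symmetric]
      by (intro set_integral_add(2) set_integrable_scaleR_right impI test_function_integrable[OF di \<zeta>]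
          test_function_integrable[OF di \<rho>t])
    then have "0 = (LINT t:UNIV|lebesgue. \<zeta> t *\<^sub>R d t) + (- I) *\<^sub>R c"
      unfolding k c_def set_integral_scaleR_right .
    then have "(LINT t:UNIV|lebesgue. \<zeta> t *\<^sub>R d t) = I *\<^sub>R c" by simp
    then show "(LINT t:UNIV|lebesgue. \<zeta> t *\<^sub>R (d t - c)) = 0"
      using set_integral_diff(2)[OF test_function_integrable[OF di \<zeta>] test_function_integrable[OF ci \<zeta>]] Ic
      by (simp add: scaleR_diff_right)
  qed simp
  then have "AE x in lebesgue. d x - c = 0" by (rule AE_intervals)
  then have "ae_eq (\<lambda>t. V t + c) u"
    unfolding ae_eq_def by eventually_elim (simp add: d_def algebra_simps)
  moreover have "primitive (\<lambda>t. V t + c) v" using V by (simp add: primitive_def)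
  ultimately show thesis using that by blast
qed

section \<open>Complex Hilbert spaces\<close>

text \<open>The functional \<open>J y = |y|\<^sup>2/2 - f y\<close> is bounded below, and by the parallelogram identity a minimizing
  sequence is Cauchy. The Euler equation at the minimizer \<open>z\<close> is \<open>f y = (y, z)\<close>.\<close>

lemma riesz_representation_real:
  fixes f :: "'a::{real_inner,banach} \<Rightarrow> real"
  assumes "bounded_linear f"
  shows "\<exists>z. \<forall>y. f y = inner y z"
proof -
  interpret bounded_linear f by fact
  obtain K where K: "\<And>x. norm (f x) \<le> norm x * K" using pos_bounded by blast
  define J where "J y = inner y y / 2 - f y" for y
  have "J y \<ge> - (K\<^sup>2 / 2)" for y
  proof -
    have "0 \<le> (norm y - K)\<^sup>2" by simp
    then have "norm y * K \<le> (norm y)\<^sup>2 / 2 + K\<^sup>2 / 2" by (simp add: power2_diff)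
    then show ?thesis using K[of y] by (simp add: J_def power2_norm_eq_inner)
  qed
  then have bdd: "bdd_below (range J)" by (intro bdd_belowI[of _ "- (K\<^sup>2 / 2)"]) auto
  define m where "m = Inf (range J)"
  have m: "m \<le> J y" for y unfolding m_def by (rule cInf_lower[OF rangeI bdd])
  have "\<exists>y. J y < m + inverse (Suc n)" for n :: nat
  proof -
    have "m < m + inverse (real (Suc n))" by simp
    then show ?thesis using cInf_less_iff[OF _ bdd, of "m + inverse (real (Suc n))"] by (auto simp: m_def)
  qed
  then obtain s where s: "\<And>n::nat. J (s n) < m + inverse (Suc n)" by metis
  have par: "(norm (x - y))\<^sup>2 \<le> 4 * (J x - m) + 4 * (J y - m)" for x y
  proof -
    have "(norm (x - y))\<^sup>2 = 4 * (J x + J y - 2 * J ((1/2) *\<^sub>R (x + y)))"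
      by (simp add: J_def power2_norm_eq_inner inner_diff inner_add scaleR add inner_commute[of y x] algebra_simps)
    then show ?thesis using m[of "(1/2) *\<^sub>R (x + y)"] by simp
  qed
  have "Cauchy s"
  proof (rule metric_CauchyI)
    fix e :: real assume e: "e > 0"
    then have "e\<^sup>2 / 8 > 0" by simp
    then obtain N where N: "N > 0" "inverse (real N) < e\<^sup>2 / 8"
      using ex_inverse_of_nat_less by blast
    have small: "J (s n) - m < e\<^sup>2 / 8" if "n \<ge> N" for n
    proof -
      have "inverse (real (Suc n)) \<le> inverse (real N)" using that N(1) by (intro le_imp_inverse_le) auto
      then show ?thesis using s[of n] N(2) by linarith
    qed
    show "\<exists>M. \<forall>i\<ge>M. \<forall>n\<ge>M. dist (s i) (s n) < e"
    proof (intro exI[of _ N] allI impI)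
      fix i n assume "N \<le> i" "N \<le> n"
      note small[OF this(1)] small[OF this(2)]
      then have "(norm (s i - s n))\<^sup>2 < e\<^sup>2" using par[of "s i" "s n"] by argo
      then show "dist (s i) (s n) < e" using e power2_less_imp_less[of "norm (s i - s n)" e] by (simp add: dist_norm)
    qed
  qed
  then obtain z where z: "s \<longlonglongrightarrow> z" using Cauchy_convergent_iff convergent_def by blast
  have "(\<lambda>n. J (s n)) \<longlonglongrightarrow> J z" unfolding J_def by (intro tendsto_intros z tendsto) simp
  moreover have "(\<lambda>n. m + inverse (real (Suc n))) \<longlonglongrightarrow> m + 0"
    by (intro tendsto_intros LIMSEQ_inverse_real_of_nat)
  ultimately have Jz: "J z \<le> m"
    using LIMSEQ_le[of "\<lambda>n. J (s n)" "J z" "\<lambda>n. m + inverse (real (Suc n))" m] s by (force intro: less_imp_le)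
  have "f y = inner y z" for y
  proof (cases "y = 0")
    case True then show ?thesis by (simp add: zero)
  next
    case False
    define q where "q = inner y z - f y"
    \<comment> \<open>The minimizer of the quadratic polynomial \<open>t \<mapsto> J (z + t y) - J z\<close>.\<close>
    define t where "t = - q / inner y y"
    have yy: "inner y y > 0" using False by simp
    have "J (z + t *\<^sub>R y) = J z + t * q + t\<^sup>2 * inner y y / 2"
      by (simp add: J_def q_def inner_add add scaleR inner_commute[of z y] power2_eq_square algebra_simps)
    then have "0 \<le> t * q + t\<^sup>2 * inner y y / 2" using m[of "z + t *\<^sub>R y"] Jz by linarith
    also have "\<dots> = - (q\<^sup>2 / (2 * inner y y))" using yy by (simp add: t_def power2_eq_square field_simps)
    finally have "q\<^sup>2 / (2 * inner y y) \<le> 0" by simp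
    then have "q\<^sup>2 \<le> 0" using yy by (simp add: divide_le_0_iff)
    then show ?thesis by (simp add: q_def)
  qed
  then show ?thesis by blast
qed

lemma cinner_scaleC_right: "cinner x (c *\<^sub>C y) = cnj c * cinner x y"
  by (metis cinner_commute cinner_scaleC_left complex_cnj_mult)

lemma cinner_add_right: "cinner x (y + z) = cinner x y + cinner x z"
  by (metis cinner_commute cinner_add_left complex_cnj_add)

lemma cinner_eq_Complex: "cinner x y = Complex (inner x y) (inner x (\<i> *\<^sub>C y))"
  by (simp add: inner_eq_Re_cinner cinner_scaleC_right complex_eq_iff)

lemma norm_scaleC: "norm (c *\<^sub>C x) = cmod c * norm (x :: 'a::complex_hilbert)"
proof -
  have im: "Im (cinner x x) = 0" using arg_cong[OF cinner_commute[of x x], of Im] by simp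
  have "inner (c *\<^sub>C x) (c *\<^sub>C x) = Re ((c * cnj c) * cinner x x)"
    by (simp add: inner_eq_Re_cinner cinner_scaleC_left cinner_scaleC_right mult_ac)
  also have "\<dots> = (cmod c)\<^sup>2 * inner x x"
    by (simp add: complex_norm_square[symmetric] inner_eq_Re_cinner im del: of_real_power)
  finally have "(norm (c *\<^sub>C x))\<^sup>2 = (cmod c * norm x)\<^sup>2"
    by (simp add: power2_norm_eq_inner power_mult_distrib)
  then show ?thesis by simp
qed

text \<open>The factor 2 comes from applying the real Cauchy-Schwarz inequality to the real and imaginary parts
  separately; the lemma serves to make the form bounded bilinear over the reals.\<close>

lemma norm_cinner_le: "cmod (cinner x y) \<le> norm x * norm y * 2"
proof -
  have "cmod (cinner x y) \<le> \<bar>inner x y\<bar> + \<bar>inner x (\<i> *\<^sub>C y)\<bar>"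
    unfolding cinner_eq_Complex using cmod_le[of "Complex (inner x y) (inner x (\<i> *\<^sub>C y))"] by simp
  then show ?thesis using Cauchy_Schwarz_ineq2[of x y] Cauchy_Schwarz_ineq2[of x "\<i> *\<^sub>C y"]
    by (simp add: norm_scaleC)
qed

lemma bounded_bilinear_cinner: "bounded_bilinear (cinner :: 'a::complex_hilbert \<Rightarrow> 'a \<Rightarrow> complex)"
proof
  show "cinner (r *\<^sub>R a) b = r *\<^sub>R cinner a b" for r and a b :: 'a
    by (simp add: scaleR_eq_scaleC cinner_scaleC_left scaleR_conv_of_real)
  show "cinner a (r *\<^sub>R b) = r *\<^sub>R cinner a b" for r and a b :: 'a
    by (simp add: scaleR_eq_scaleC cinner_scaleC_right scaleR_conv_of_real)
  show "\<exists>K. \<forall>a b :: 'a. norm (cinner a b) \<le> norm a * norm b * K"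
    using norm_cinner_le by blast
qed (simp_all add: cinner_add_left cinner_add_right)

lemma bounded_bilinear_scaleC: "bounded_bilinear (scaleC :: complex \<Rightarrow> 'a::complex_hilbert \<Rightarrow> 'a)"
proof
  show "(r *\<^sub>R a) *\<^sub>C b = r *\<^sub>R (a *\<^sub>C b)" for r a and b :: 'a
    by (simp add: scaleR_eq_scaleC scaleC_scaleC scaleR_conv_of_real)
  show "a *\<^sub>C (r *\<^sub>R b) = r *\<^sub>R (a *\<^sub>C b)" for r a and b :: 'a
    by (simp add: scaleR_eq_scaleC scaleC_scaleC mult.commute)
  show "\<exists>K. \<forall>a (b :: 'a). norm (a *\<^sub>C b) \<le> norm a * norm b * K"
    by (intro exI[of _ 1]) (simp add: norm_scaleC)
qed (simp_all add: scaleC_add_left scaleC_add_right)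

interpretation cinner: bounded_bilinear "cinner :: 'a::complex_hilbert \<Rightarrow> 'a \<Rightarrow> complex"
  by (rule bounded_bilinear_cinner)

interpretation scaleC: bounded_bilinear "scaleC :: complex \<Rightarrow> 'a::complex_hilbert \<Rightarrow> 'a"
  by (rule bounded_bilinear_scaleC)

lemma cinner_self_eq_0: "cinner x x = 0 \<Longrightarrow> x = 0"
  using inner_eq_Re_cinner[of x x] by simp

lemma riesz_representation:
  fixes f :: "'a::complex_hilbert \<Rightarrow> complex"
  assumes f: "bounded_linear f" and C: "\<And>c x. f (c *\<^sub>C x) = c * f x"
  shows "\<exists>z. \<forall>y. f y = cinner y z"
proof -
  obtain z where z: "\<And>y. Re (f y) = inner y z"
    using riesz_representation_real[of "\<lambda>y. Re (f y)"] bounded_linear_compose[OF bounded_linear_Re f] by auto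
  have "f y = cinner y z" for y
  proof (rule complex_eqI)
    show "Re (f y) = Re (cinner y z)" using z by (simp add: inner_eq_Re_cinner)
    have "Im (f y) = - Re (f (\<i> *\<^sub>C y))" by (simp add: C)
    also have "\<dots> = Im (cinner y z)" unfolding z by (simp add: inner_eq_Re_cinner cinner_scaleC_left)
    finally show "Im (f y) = Im (cinner y z)" .
  qed
  then show ?thesis by blast
qed

lemma eq_of_cinner_dense:
  fixes y z :: "'a::complex_hilbert"
  assumes D: "closure D = UNIV" and eq: "\<And>d. d \<in> D \<Longrightarrow> cinner d y = cinner d z"
  shows "y = z"
proof -
  have "closed {d. cinner d y = cinner d z}"
    by (intro closed_Collect_eq continuous_intros cinner.continuous_on)
  then have "closure D \<subseteq> {d. cinner d y = cinner d z}"
    using eq by (intro closure_minimal) auto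
  then have "cinner (y - z) y = cinner (y - z) z" using D by auto
  then have "cinner (y - z) (y - z) = 0" by (simp add: cinner.diff_right)
  then show ?thesis using cinner_self_eq_0 by fastforce
qed

section \<open>Locally square integrable functions\<close>

text \<open>The common form of local square integrability for values in \<open>X\<close>, in \<open>Y\<close> and in the complex
  numbers, the latter being no instance of the Hilbert space class.\<close>

definition locally_L2 :: "(real \<Rightarrow> 'a::real_normed_vector) \<Rightarrow> bool" where
  "locally_L2 f \<longleftrightarrow> (\<forall>a b. a < b \<longrightarrow> L2_on a b f)"

lemma set_borel_measurable_lebesgue:
  fixes f :: "real \<Rightarrow> 'a::{banach,second_countable_topology}"
  assumes "f \<in> borel_measurable lebesgue" "S \<in> sets lebesgue"
  shows "set_borel_measurable lebesgue S f"
  unfolding set_borel_measurable_def using assms by (intro borel_measurable_scaleR borel_measurable_indicator)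

lemma measurable_of_intervals:
  fixes f :: "real \<Rightarrow> 'a::{banach,second_countable_topology}"
  assumes "\<And>n::nat. set_borel_measurable lebesgue {- real n..real n} f"
  shows "f \<in> borel_measurable lebesgue"
proof (rule borel_measurable_LIMSEQ_metric)
  show "(\<lambda>t. indicator {- real n..real n} t *\<^sub>R f t) \<in> borel_measurable lebesgue" for n
    using assms by (simp add: set_borel_measurable_def)
  fix t :: real
  obtain N where N: "\<bar>t\<bar> \<le> real N" using real_arch_simple by blast
  have "indicator {- real n..real n} t *\<^sub>R f t = f t" if "n \<ge> N" for n
  proof -
    have "\<bar>t\<bar> \<le> real n" using N that by linarith
    then have "t \<in> {- real n..real n}" by auto
    then show ?thesis by simp
  qed
  then show "(\<lambda>n. indicator {- real n..real n} t *\<^sub>R f t) \<longlonglongrightarrow> f t"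
    by (intro tendsto_eventually) (auto simp: eventually_sequentially)
qed

lemma locally_integrable_measurable:
  "locally_integrable_on f UNIV \<Longrightarrow> f \<in> borel_measurable lebesgue"
  by (intro measurable_of_intervals set_integrable_measurable locally_integrableD)

lemma continuous_measurable:
  fixes f :: "real \<Rightarrow> 'a::{banach,second_countable_topology}"
  shows "continuous_on UNIV f \<Longrightarrow> f \<in> borel_measurable lebesgue"
  by (rule locally_integrable_measurable[OF locally_integrable_continuous])

lemma locally_integrable_bound:
  fixes f :: "real \<Rightarrow> 'a::{banach,second_countable_topology}" and g :: "real \<Rightarrow> real"
  assumes g: "locally_integrable_on g UNIV" and f: "f \<in> borel_measurable lebesgue"
    and le: "\<And>a b. \<exists>C. AE t in lebesgue. t \<in> {a..b} \<longrightarrow> norm (f t) \<le> C * \<bar>g t\<bar>"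
  shows "locally_integrable_on f UNIV"
  unfolding locally_integrable_UNIV_iff
proof (intro allI)
  fix a b :: real
  obtain C where C: "AE t in lebesgue. t \<in> {a..b} \<longrightarrow> norm (f t) \<le> C * \<bar>g t\<bar>" using le by blast
  have "set_integrable lebesgue {a..b} (\<lambda>t. C * \<bar>g t\<bar>)"
    by (intro set_integrable_mult_right impI set_integrable_abs locally_integrableD[OF g])
  then show "set_integrable lebesgue {a..b} f"
    unfolding set_integrable_def
  proof (rule Bochner_Integration.integrable_bound)
    show "(\<lambda>t. indicat_real {a..b} t *\<^sub>R f t) \<in> borel_measurable lebesgue"
      using set_borel_measurable_lebesgue[OF f, of "{a..b}"] by (simp add: set_borel_measurable_def)
    show "AE t in lebesgue. norm (indicat_real {a..b} t *\<^sub>R f t) \<le> norm (indicat_real {a..b} t *\<^sub>R (C * \<bar>g t\<bar>))"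
      using C by eventually_elim (auto simp: indicator_def)
  qed
qed

lemma locally_L2_iff:
  fixes f :: "real \<Rightarrow> 'a::{banach,second_countable_topology}"
  shows "locally_L2 f \<longleftrightarrow> f \<in> borel_measurable lebesgue \<and> locally_integrable_on (\<lambda>t. (norm (f t))\<^sup>2) UNIV"
proof
  assume L: "locally_L2 f"
  have 1: "set_borel_measurable lebesgue {a..b} f" "set_integrable lebesgue {a..b} (\<lambda>t. (norm (f t))\<^sup>2)" for a b
  proof (atomize (full), cases "a \<le> b")
    case True
    then have "L2_on (a - 1) (b + 1) f" using L by (simp add: locally_L2_def)
    moreover have "{a..b} \<subseteq> {a - 1<..<b + 1}" "{a..b} \<in> sets lebesgue" by auto
    ultimately show "set_borel_measurable lebesgue {a..b} f \<and> set_integrable lebesgue {a..b} (\<lambda>t. (norm (f t))\<^sup>2)"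
      unfolding L2_on_def by (meson set_borel_measurable_subset set_integrable_subset)
  qed (simp add: set_borel_measurable_def)
  show "f \<in> borel_measurable lebesgue \<and> locally_integrable_on (\<lambda>t. (norm (f t))\<^sup>2) UNIV"
    using measurable_of_intervals[OF 1(1)] 1(2) unfolding locally_integrable_UNIV_iff by blast
next
  assume R: "f \<in> borel_measurable lebesgue \<and> locally_integrable_on (\<lambda>t. (norm (f t))\<^sup>2) UNIV"
  have "L2_on a b f" for a b
    unfolding L2_on_def
  proof
    show "set_borel_measurable lebesgue {a<..<b} f" using R by (intro set_borel_measurable_lebesgue) auto
    have "set_integrable lebesgue {a..b} (\<lambda>t. (norm (f t))\<^sup>2)" using R by (simp add: locally_integrable_UNIV_iff)
    then show "set_integrable lebesgue {a<..<b} (\<lambda>t. (norm (f t))\<^sup>2)"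
      by (rule set_integrable_subset) auto
  qed
  then show "locally_L2 f" by (simp add: locally_L2_def)
qed

lemma locally_L2_measurable:
  fixes f :: "real \<Rightarrow> 'a::{banach,second_countable_topology}"
  shows "locally_L2 f \<Longrightarrow> f \<in> borel_measurable lebesgue"
  by (simp add: locally_L2_iff)

lemma L2_on_cong_AE:
  fixes f g :: "real \<Rightarrow> 'a::{banach,second_countable_topology}"
  assumes "L2_on a b f" and ae: "AE t in lebesgue. t \<in> {a<..<b} \<longrightarrow> f t = g t"
  shows "L2_on a b g"
  unfolding L2_on_def
proof
  show "set_borel_measurable lebesgue {a<..<b} g"
    by (rule set_borel_measurable_cong_AE[OF _ ae]) (use assms(1) in \<open>simp add: L2_on_def\<close>)
  have "AE t in lebesgue. t \<in> {a<..<b} \<longrightarrow> (norm (f t))\<^sup>2 = (norm (g t))\<^sup>2"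
    using ae by eventually_elim auto
  then show "set_integrable lebesgue {a<..<b} (\<lambda>t. (norm (g t))\<^sup>2)"
    by (rule set_integrable_AE_eq[rotated]) (use assms(1) in \<open>simp add: L2_on_def\<close>)
qed

lemma L2_on_subset:
  fixes f :: "real \<Rightarrow> 'a::{banach,second_countable_topology}"
  assumes "L2_on c d f" "{a<..<b} \<subseteq> {c<..<d}"
  shows "L2_on a b f"
  unfolding L2_on_def
proof
  show "set_borel_measurable lebesgue {a<..<b} f"
    by (rule set_borel_measurable_subset[OF _ _ assms(2)]) (use assms(1) in \<open>simp_all add: L2_on_def\<close>)
  show "set_integrable lebesgue {a<..<b} (\<lambda>t. (norm (f t))\<^sup>2)"
    by (rule set_integrable_subset[OF _ _ assms(2)]) (use assms(1) in \<open>simp_all add: L2_on_def\<close>)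
qed

lemma locally_L2_cong:
  fixes f g :: "real \<Rightarrow> 'a::{banach,second_countable_topology}"
  assumes "locally_L2 f" "ae_eq f g"
  shows "locally_L2 g"
  unfolding locally_L2_def
proof (intro allI impI)
  fix a b :: real assume "a < b"
  then have "L2_on a b f" using assms(1) by (simp add: locally_L2_def)
  then show "L2_on a b g"
    by (rule L2_on_cong_AE) (use assms(2) in \<open>auto simp: ae_eq_def elim!: eventually_mono\<close>)
qed

lemma locally_L2_bound:
  fixes f :: "real \<Rightarrow> 'a::{banach,second_countable_topology}"
    and g :: "real \<Rightarrow> 'b::{banach,second_countable_topology}"
  assumes g: "locally_L2 g" and f: "f \<in> borel_measurable lebesgue"
    and le: "\<And>a b. \<exists>C. AE t in lebesgue. t \<in> {a..b} \<longrightarrow> norm (f t) \<le> C * norm (g t)"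
  shows "locally_L2 f"
  unfolding locally_L2_iff
proof (rule conjI[OF f], rule locally_integrable_bound[where g="\<lambda>t. (norm (g t))\<^sup>2"])
  show "locally_integrable_on (\<lambda>t. (norm (g t))\<^sup>2) UNIV" using g by (simp add: locally_L2_iff)
  show "(\<lambda>t. (norm (f t))\<^sup>2) \<in> borel_measurable lebesgue" using f by simp
  fix a b :: real
  obtain C where C: "AE t in lebesgue. t \<in> {a..b} \<longrightarrow> norm (f t) \<le> C * norm (g t)" using le by blast
  have "AE t in lebesgue. t \<in> {a..b} \<longrightarrow> norm ((norm (f t))\<^sup>2) \<le> C\<^sup>2 * \<bar>(norm (g t))\<^sup>2\<bar>"
    using C
  proof eventually_elim
    case (elim t)
    show ?case
    proof
      assume "t \<in> {a..b}"
      with elim have "(norm (f t))\<^sup>2 \<le> (C * norm (g t))\<^sup>2" by (intro power_mono) auto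
      then show "norm ((norm (f t))\<^sup>2) \<le> C\<^sup>2 * \<bar>(norm (g t))\<^sup>2\<bar>" by (simp add: power_mult_distrib)
    qed
  qed
  then show "\<exists>C. AE t in lebesgue. t \<in> {a..b} \<longrightarrow> norm ((norm (f t))\<^sup>2) \<le> C * \<bar>(norm (g t))\<^sup>2\<bar>" by blast
qed

lemma locally_L2_add:
  fixes f g :: "real \<Rightarrow> 'a::{banach,second_countable_topology}"
  assumes "locally_L2 f" "locally_L2 g"
  shows "locally_L2 (\<lambda>t. f t + g t)"
  unfolding locally_L2_iff
proof (rule conjI, goal_cases)
  case 1
  show m: ?case
    using assms by (intro borel_measurable_add) (auto simp: locally_L2_iff)
  case 2
  show ?case
  proof (rule locally_integrable_bound[where g="\<lambda>t. (norm (f t))\<^sup>2 + (norm (g t))\<^sup>2"])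
  show "locally_integrable_on (\<lambda>t. (norm (f t))\<^sup>2 + (norm (g t))\<^sup>2) UNIV"
    using assms by (intro locally_integrable_add) (auto simp: locally_L2_iff)
  show "(\<lambda>t. (norm (f t + g t))\<^sup>2) \<in> borel_measurable lebesgue"
    by (intro borel_measurable_power measurable_compose[OF m] borel_measurable_norm)
  have "norm ((norm (f t + g t))\<^sup>2) \<le> 2 * \<bar>(norm (f t))\<^sup>2 + (norm (g t))\<^sup>2\<bar>" for t
  proof -
    have "(norm (f t + g t))\<^sup>2 \<le> (norm (f t) + norm (g t))\<^sup>2" by (intro power_mono norm_triangle_ineq) auto
    also have "\<dots> \<le> 2 * ((norm (f t))\<^sup>2 + (norm (g t))\<^sup>2)"
      using sum_squares_bound[of "norm (f t)" "norm (g t)"] by (simp add: power2_sum)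
    finally show ?thesis by simp
  qed
  then show "\<exists>C. AE t in lebesgue. t \<in> {a..b} \<longrightarrow> norm ((norm (f t + g t))\<^sup>2) \<le> C * \<bar>(norm (f t))\<^sup>2 + (norm (g t))\<^sup>2\<bar>" for a b
    by blast
  qed
qed

lemma locally_L2_zero: "locally_L2 (\<lambda>_. 0 :: 'a::{banach,second_countable_topology})"
  by (simp add: locally_L2_iff locally_integrable_continuous)

lemma locally_L2_sum:
  fixes f :: "'i \<Rightarrow> real \<Rightarrow> 'a::{banach,second_countable_topology}"
  assumes "\<And>i. i \<in> I \<Longrightarrow> locally_L2 (f i)"
  shows "locally_L2 (\<lambda>t. \<Sum>i\<in>I. f i t)"
  using assms by (induction I rule: infinite_finite_induct) (auto intro: locally_L2_zero locally_L2_add)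

lemma borel_measurable_bilinear:
  fixes f :: "real \<Rightarrow> 'a::{banach,second_countable_topology}"
    and g :: "real \<Rightarrow> 'b::{banach,second_countable_topology}"
    and B :: "'a \<Rightarrow> 'b \<Rightarrow> 'c::{banach,second_countable_topology}"
  assumes B: "bounded_bilinear B" and "f \<in> borel_measurable M" "g \<in> borel_measurable M"
  shows "(\<lambda>t. B (f t) (g t)) \<in> borel_measurable M"
  using set_borel_measurable_bilinear[OF B, of M UNIV f g] assms(2,3) by (simp add: set_borel_measurable_def)

lemma locally_L2_bilinear_bounded:
  fixes f :: "real \<Rightarrow> 'a::{banach,second_countable_topology}"
    and g :: "real \<Rightarrow> 'b::{banach,second_countable_topology}"
    and B :: "'a \<Rightarrow> 'b \<Rightarrow> 'c::{banach,second_countable_topology}"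
  assumes B: "bounded_bilinear B" and f: "locally_L2 f" and g: "g \<in> borel_measurable lebesgue"
    and bd: "\<And>a b. \<exists>C. AE t in lebesgue. t \<in> {a..b} \<longrightarrow> norm (g t) \<le> C"
  shows "locally_L2 (\<lambda>t. B (f t) (g t))"
proof (rule locally_L2_bound[OF f borel_measurable_bilinear[OF B locally_L2_measurable[OF f] g]])
  fix a b :: real
  obtain C where C: "AE t in lebesgue. t \<in> {a..b} \<longrightarrow> norm (g t) \<le> C" using bd by blast
  obtain K where K: "\<And>a b. norm (B a b) \<le> norm a * norm b * K" "K > 0"
    using bounded_bilinear.pos_bounded[OF B] by blast
  have "AE t in lebesgue. t \<in> {a..b} \<longrightarrow> norm (B (f t) (g t)) \<le> (C * K) * norm (f t)"
    using C
  proof eventually_elim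
    case (elim t)
    show ?case
    proof
      assume "t \<in> {a..b}"
      then have "norm (f t) * norm (g t) * K \<le> norm (f t) * C * K"
        using elim K(2) by (intro mult_right_mono mult_left_mono) auto
      then show "norm (B (f t) (g t)) \<le> (C * K) * norm (f t)" using K(1)[of "f t" "g t"] by (simp add: mult_ac)
    qed
  qed
  then show "\<exists>C. AE t in lebesgue. t \<in> {a..b} \<longrightarrow> norm (B (f t) (g t)) \<le> C * norm (f t)" by blast
qed

lemma continuous_locally_bounded:
  fixes g :: "real \<Rightarrow> 'a::real_normed_vector"
  assumes "continuous_on UNIV g"
  shows "\<exists>C. \<forall>t\<in>{a..b}. norm (g t) \<le> C"
proof -
  have "compact (g ` {a..b})"
    using assms by (intro compact_continuous_image) (auto intro: continuous_on_subset)
  then have "bounded (g ` {a..b})" by (rule compact_imp_bounded)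
  then show ?thesis unfolding bounded_iff by blast
qed

lemma locally_L2_bilinear_continuous:
  fixes f :: "real \<Rightarrow> 'a::{banach,second_countable_topology}"
    and g :: "real \<Rightarrow> 'b::{banach,second_countable_topology}"
    and B :: "'a \<Rightarrow> 'b \<Rightarrow> 'c::{banach,second_countable_topology}"
  assumes B: "bounded_bilinear B" and f: "locally_L2 f" and g: "continuous_on UNIV g"
  shows "locally_L2 (\<lambda>t. B (f t) (g t))"
proof (rule locally_L2_bilinear_bounded[OF B f continuous_measurable[OF g]])
  fix a b
  obtain C where "\<forall>t\<in>{a..b}. norm (g t) \<le> C" using continuous_locally_bounded[OF g] by blast
  then show "\<exists>C. AE t in lebesgue. t \<in> {a..b} \<longrightarrow> norm (g t) \<le> C" by (intro exI[of _ C] AE_I2) auto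
qed

lemma locally_L2_continuous:
  fixes f :: "real \<Rightarrow> 'a::{banach,second_countable_topology}"
  assumes "continuous_on UNIV f"
  shows "locally_L2 f"
  using assms by (auto simp: locally_L2_iff continuous_measurable intro!: locally_integrable_continuous continuous_intros)

lemma locally_L2_bilinear_integrable:
  fixes f :: "real \<Rightarrow> 'a::{banach,second_countable_topology}"
    and g :: "real \<Rightarrow> 'b::{banach,second_countable_topology}"
    and B :: "'a \<Rightarrow> 'b \<Rightarrow> 'c::{banach,second_countable_topology}"
  assumes B: "bounded_bilinear B" and f: "locally_L2 f" and g: "locally_L2 g"
  shows "locally_integrable_on (\<lambda>t. B (f t) (g t)) UNIV"
proof (rule locally_integrable_bound)
  show "locally_integrable_on (\<lambda>t. (norm (f t))\<^sup>2 + (norm (g t))\<^sup>2) UNIV"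
    using f g by (intro locally_integrable_add) (auto simp: locally_L2_iff)
  show "(\<lambda>t. B (f t) (g t)) \<in> borel_measurable lebesgue"
    by (rule borel_measurable_bilinear[OF B locally_L2_measurable[OF f] locally_L2_measurable[OF g]])
  obtain K where K: "\<And>a b. norm (B a b) \<le> norm a * norm b * K" "K > 0"
    using bounded_bilinear.pos_bounded[OF B] by blast
  have "norm (B (f t) (g t)) \<le> K * \<bar>(norm (f t))\<^sup>2 + (norm (g t))\<^sup>2\<bar>" for t
  proof -
    have "norm (f t) * norm (g t) \<le> (norm (f t))\<^sup>2 + (norm (g t))\<^sup>2"
      using sum_squares_bound[of "norm (f t)" "norm (g t)"] mult_nonneg_nonneg[OF norm_ge_zero[of "f t"] norm_ge_zero[of "g t"]]
      by linarith
    then have "norm (f t) * norm (g t) * K \<le> ((norm (f t))\<^sup>2 + (norm (g t))\<^sup>2) * K"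
      using K(2) by (intro mult_right_mono) auto
    then show ?thesis using K(1)[of "f t" "g t"] by (simp add: mult.commute)
  qed
  then show "\<exists>C. AE t in lebesgue. t \<in> {a..b} \<longrightarrow> norm (B (f t) (g t)) \<le> C * \<bar>(norm (f t))\<^sup>2 + (norm (g t))\<^sup>2\<bar>" for a b
    by blast
qed

lemma test_function_mono: "test_function S \<eta> \<Longrightarrow> S \<subseteq> T \<Longrightarrow> test_function T \<eta>"
  unfolding test_function_def by (meson subset_trans)

lemma has_weak_deriv_restrict:
  assumes uv: "has_weak_deriv T u v" and ST: "S \<subseteq> T"
  shows "has_weak_deriv S u v"
  unfolding has_weak_deriv_def
proof (intro conjI allI impI)
  show "locally_integrable_on u S" "locally_integrable_on v S"
    using uv ST by (auto simp: has_weak_deriv_def locally_integrable_on_def)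
  fix \<eta> assume \<eta>: "test_function S \<eta>"
  then obtain K where K: "compact K" "K \<subseteq> S" "\<And>t. t \<notin> K \<Longrightarrow> \<eta> t = 0" by (auto simp: test_function_def)
  have d0: "deriv \<eta> t = 0" if "t \<notin> K" for t by (rule deriv_zero_outside[OF K(1) K(3) that])
  have "(LINT t:T|lebesgue. deriv \<eta> t *\<^sub>R u t) = - (LINT t:T|lebesgue. \<eta> t *\<^sub>R v t)"
    using uv test_function_mono[OF \<eta> ST] by (simp only: has_weak_deriv_def)
  moreover have "(LINT t:T|lebesgue. deriv \<eta> t *\<^sub>R u t) = (LINT t:S|lebesgue. deriv \<eta> t *\<^sub>R u t)"
    using K(2) ST d0 by (intro set_integral_support(1)) auto
  moreover have "(LINT t:T|lebesgue. \<eta> t *\<^sub>R v t) = (LINT t:S|lebesgue. \<eta> t *\<^sub>R v t)"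
    using K ST by (intro set_integral_support(1)) auto
  ultimately show "(LINT t:S|lebesgue. deriv \<eta> t *\<^sub>R u t) = - (LINT t:S|lebesgue. \<eta> t *\<^sub>R v t)" by simp
qed

text \<open>Weak derivatives on an exhausting sequence of intervals agree almost everywhere by uniqueness, and
  a test function on the line has its support in one of these intervals.\<close>

lemma weak_deriv_gluing:
  fixes u :: "real \<Rightarrow> 'a::{banach,second_countable_topology}"
  assumes ex: "\<And>a b. a < b \<Longrightarrow> \<exists>v. has_weak_deriv {a<..<b} u v \<and> L2_on a b v"
  obtains v where "has_weak_deriv UNIV u v" "locally_L2 v"
proof -
  define S where "S n = {- real (Suc n)<..<real (Suc n)}" for n :: nat
  have "\<exists>v. has_weak_deriv (S n) u v \<and> L2_on (- real (Suc n)) (real (Suc n)) v" for n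
    using ex[of "- real (Suc n)" "real (Suc n)"] by (simp add: S_def)
  then obtain V where V: "\<And>n. has_weak_deriv (S n) u (V n)" "\<And>n. L2_on (- real (Suc n)) (real (Suc n)) (V n)" by metis
  \<comment> \<open>At \<open>t\<close>, the first of the derivatives \<open>V n\<close> with \<open>\<bar>t\<bar> \<le> n\<close> is used.\<close>
  define v where "v t = V (nat \<lceil>\<bar>t\<bar>\<rceil>) t" for t
  have sub: "has_weak_deriv (S m) u (V n)" if "m \<le> n" for m n
    by (rule has_weak_deriv_restrict[OF V(1)]) (use that in \<open>auto simp: S_def\<close>)
  have agree: "AE t in lebesgue. t \<in> {- real n..real n} \<longrightarrow> v t = V n t" for n
  proof -
    have "AE t in lebesgue. \<forall>m\<le>n. t \<in> {- real m..real m} \<longrightarrow> V m t = V n t"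
    proof (subst AE_all_countable, intro allI)
      fix m
      show "AE t in lebesgue. m \<le> n \<longrightarrow> t \<in> {- real m..real m} \<longrightarrow> V m t = V n t"
      proof (cases "m \<le> n")
        case True
        then have "AE t in lebesgue. t \<in> {- real m..real m} \<longrightarrow> V m t = V n t"
          by (intro has_weak_deriv_unique[OF V(1) sub]) (auto simp: S_def)
        then show ?thesis by eventually_elim simp
      qed simp
    qed
    then show ?thesis
    proof eventually_elim
      case (elim t)
      show ?case
      proof
        assume t: "t \<in> {- real n..real n}"
        define m where "m = nat \<lceil>\<bar>t\<bar>\<rceil>"
        have "\<bar>t\<bar> \<le> real m" "m \<le> n" using t by (auto simp: m_def nat_le_iff ceiling_le_iff)
        then show "v t = V n t" using elim by (auto simp: v_def m_def[symmetric])
      qed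
    qed
  qed
  have ui: "locally_integrable_on u UNIV" and vi: "locally_integrable_on v UNIV"
  proof -
    have "set_integrable lebesgue {a..b} u \<and> set_integrable lebesgue {a..b} v" for a b
    proof -
      obtain n where n: "max \<bar>a\<bar> \<bar>b\<bar> \<le> real n" using real_arch_simple by blast
      then have sub: "{a..b} \<subseteq> {- real n..real n}" "{- real n..real n} \<subseteq> S n" by (auto simp: S_def)
      then have "set_integrable lebesgue {a..b} u" "set_integrable lebesgue {a..b} (V n)"
        using V(1)[of n] unfolding has_weak_deriv_def locally_integrable_on_def by (meson compact_Icc order.trans)+
      moreover have "AE t in lebesgue. t \<in> {a..b} \<longrightarrow> V n t = v t"
        using agree[of n] by eventually_elim (use sub in auto)
      ultimately show ?thesis using set_integrable_AE_eq by blast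
    qed
    then show "locally_integrable_on u UNIV" "locally_integrable_on v UNIV" by (auto simp: locally_integrable_UNIV_iff)
  qed
  have "has_weak_deriv UNIV u v"
    unfolding has_weak_deriv_def
  proof (intro conjI allI impI ui vi)
    fix \<eta> assume \<eta>: "test_function UNIV \<eta>"
    obtain R where R: "\<And>t. t \<notin> {-R<..<R} \<Longrightarrow> \<eta> t = 0" "\<And>t. t \<notin> {-R<..<R} \<Longrightarrow> deriv \<eta> t = 0"
      using test_function_support[OF \<eta>] by metis
    obtain n where n: "R \<le> real n" using real_arch_simple by blast
    have out: "\<eta> t = 0" "deriv \<eta> t = 0" if "t \<notin> {- real n..real n}" for t
      using that n R(1)[of t] R(2)[of t] by auto
    have nS: "{- real n..real n} \<subseteq> S n" by (auto simp: S_def)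
    have out': "\<eta> t = 0" "deriv \<eta> t = 0" if "t \<notin> S n" for t
      using that nS out by blast+
    have "test_function (S n) \<eta>"
      using \<eta> out nS by (auto simp: test_function_def intro!: exI[of _ "{- real n..real n}"])
    then have "(LINT t:S n|lebesgue. deriv \<eta> t *\<^sub>R u t) = - (LINT t:S n|lebesgue. \<eta> t *\<^sub>R V n t)"
      using V(1)[of n] by (simp only: has_weak_deriv_def)
    moreover have "(LINT t:UNIV|lebesgue. deriv \<eta> t *\<^sub>R u t) = (LINT t:S n|lebesgue. deriv \<eta> t *\<^sub>R u t)"
      by (intro set_integral_support(1)) (simp_all add: out')
    moreover have "(LINT t:UNIV|lebesgue. \<eta> t *\<^sub>R V n t) = (LINT t:S n|lebesgue. \<eta> t *\<^sub>R V n t)"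
      by (intro set_integral_support(1)) (simp_all add: out')
    moreover have "(LINT t:UNIV|lebesgue. \<eta> t *\<^sub>R V n t) = (LINT t:UNIV|lebesgue. \<eta> t *\<^sub>R v t)"
    proof (rule set_integral_AE_eq)
      show "AE t in lebesgue. t \<in> UNIV \<longrightarrow> \<eta> t *\<^sub>R V n t = \<eta> t *\<^sub>R v t"
        using agree[of n]
      proof eventually_elim
        case (elim t)
        then show ?case using out(1)[of t] by (cases "t \<in> {- real n..real n}") auto
      qed
    qed
    ultimately show "(LINT t:UNIV|lebesgue. deriv \<eta> t *\<^sub>R u t) = - (LINT t:UNIV|lebesgue. \<eta> t *\<^sub>R v t)" by simp
  qed
  moreover have "locally_L2 v"
    unfolding locally_L2_def
  proof (intro allI impI)
    fix a b :: real
    obtain n where n: "max \<bar>a\<bar> \<bar>b\<bar> \<le> real n" using real_arch_simple by blast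
    then have sub: "{a<..<b} \<subseteq> {- real n..real n}" "{a<..<b} \<subseteq> {- real (Suc n)<..<real (Suc n)}" by auto
    have "L2_on a b (V n)" by (rule L2_on_subset[OF V(2) sub(2)])
    then show "L2_on a b v"
    proof (rule L2_on_cong_AE)
      show "AE t in lebesgue. t \<in> {a<..<b} \<longrightarrow> V n t = v t"
        using agree[of n] by eventually_elim (use sub(1) in auto)
    qed
  qed
  ultimately show thesis using that by blast
qed

text \<open>The weak derivatives on the bounded intervals are glued to a single one on the line.\<close>

lemma X_loc_iff:
  "u \<in> X_loc \<iota> \<longleftrightarrow> (AE t in lebesgue. u t \<in> range \<iota>) \<and> locally_L2 (\<lambda>t. inv \<iota> (u t)) \<and>
     (\<exists>v. has_weak_deriv UNIV u v \<and> locally_L2 v)"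
proof
  assume u: "u \<in> X_loc \<iota>"
  have "AE t in lebesgue. t \<in> {- real n..real n} \<longrightarrow> u t \<in> range \<iota>" for n
  proof -
    have "u \<in> X_sp \<iota> (- real (Suc n)) (real (Suc n))" using u by (simp add: X_loc_def)
    then have "AE t in lebesgue. t \<in> {- real (Suc n)<..<real (Suc n)} \<longrightarrow> u t \<in> range \<iota>" unfolding X_sp_def by blast
    then show ?thesis by eventually_elim auto
  qed
  then have "AE t in lebesgue. u t \<in> range \<iota>" by (rule AE_intervals)
  moreover have "locally_L2 (\<lambda>t. inv \<iota> (u t))" using u by (auto simp: X_loc_def X_sp_def locally_L2_def)
  moreover have "\<exists>v. has_weak_deriv UNIV u v \<and> locally_L2 v"
  proof -
    have ex: "\<exists>v. has_weak_deriv {a<..<b} u v \<and> L2_on a b v" if "a < b" for a b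
      using u that unfolding X_loc_def X_sp_def by blast
    obtain v where "has_weak_deriv UNIV u v" "locally_L2 v" by (rule weak_deriv_gluing[OF ex])
    then show ?thesis by blast
  qed
  ultimately show "(AE t in lebesgue. u t \<in> range \<iota>) \<and> locally_L2 (\<lambda>t. inv \<iota> (u t)) \<and>
     (\<exists>v. has_weak_deriv UNIV u v \<and> locally_L2 v)" by blast
next
  assume R: "(AE t in lebesgue. u t \<in> range \<iota>) \<and> locally_L2 (\<lambda>t. inv \<iota> (u t)) \<and>
     (\<exists>v. has_weak_deriv UNIV u v \<and> locally_L2 v)"
  then have "AE t in lebesgue. t \<in> {a<..<b} \<longrightarrow> u t \<in> range \<iota>" for a b by (auto elim: eventually_mono)
  with R show "u \<in> X_loc \<iota>"
    by (auto simp: X_loc_def X_sp_def locally_L2_def intro: has_weak_deriv_restrict[OF _ subset_UNIV])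
qed

lemma Y_loc_iff: "u \<in> Y_loc \<longleftrightarrow> locally_L2 u"
  by (auto simp: Y_loc_def locally_L2_def)

section \<open>Translation and periodization\<close>

lemma distr_lebesgue_shift: "distr lebesgue lebesgue ((+) c) = lebesgue" for c :: real
  using lebesgue_real_affine[of 1 c] by (simp add: density_1)

lemma shift_measurable: "(+) c \<in> lebesgue \<rightarrow>\<^sub>M lebesgue" for c :: real
  using lebesgue_affine_measurable[where c="\<lambda>_. 1" and t=c] by (simp add: euclidean_representation)

lemma AE_shift:
  assumes "AE t in lebesgue. P (t::real)"
  shows "AE t in lebesgue. P (c + t)"
proof -
  have "AE t in distr lebesgue lebesgue ((+) c). P t" unfolding distr_lebesgue_shift by (rule assms)
  then show ?thesis by (rule AE_distrD[OF shift_measurable])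
qed

lemma AE_int_shift:
  assumes "AE t in lebesgue. P (t::real)"
  shows "AE t in lebesgue. \<forall>k::int. P (t + of_int k)"
  unfolding AE_all_countable
proof
  fix k :: int
  show "AE t in lebesgue. P (t + of_int k)" using AE_shift[OF assms, of "of_int k"] by (simp only: add.commute)
qed

lemma set_integral_shift:
  fixes g :: "real \<Rightarrow> 'a::{banach,second_countable_topology}"
  assumes "set_integrable lebesgue {c + a..c + b} g"
  shows "set_integrable lebesgue {a..b} (\<lambda>t. g (c + t))"
    "(LINT t:{a..b}|lebesgue. g (c + t)) = (LINT t:{c + a..c + b}|lebesgue. g t)"
proof -
  have eq: "indicator {a..b} t *\<^sub>R g (c + t) = (\<lambda>s. indicator {c + a..c + b} s *\<^sub>R g s) (c + t)" for t :: real
    by (simp add: indicator_def)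
  have m: "(\<lambda>s. indicator {c + a..c + b} s *\<^sub>R g s) \<in> borel_measurable lebesgue"
    using assms by (simp add: set_integrable_def)
  show "set_integrable lebesgue {a..b} (\<lambda>t. g (c + t))"
    unfolding set_integrable_def eq
    using integrable_distr_eq[OF shift_measurable m, of c] assms by (simp add: distr_lebesgue_shift set_integrable_def)
  show "(LINT t:{a..b}|lebesgue. g (c + t)) = (LINT t:{c + a..c + b}|lebesgue. g t)"
    unfolding set_lebesgue_integral_def eq
    using integral_distr[OF shift_measurable m, of c] by (simp add: distr_lebesgue_shift)
qed

lemma locally_integrable_shift:
  "locally_integrable_on g UNIV \<Longrightarrow> locally_integrable_on (\<lambda>t. g (c + t)) UNIV"
  by (simp add: locally_integrable_UNIV_iff set_integral_shift(1))

lemma locally_L2_shift: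
  fixes f :: "real \<Rightarrow> 'a::{banach,second_countable_topology}"
  assumes "locally_L2 f"
  shows "locally_L2 (\<lambda>t. f (c + t))"
  using assms measurable_compose[OF shift_measurable, of f borel c]
    locally_integrable_shift[of "\<lambda>t. (norm (f t))\<^sup>2" c]
  by (simp add: locally_L2_iff)

lemma primitive_shift:
  assumes "primitive f g"
  shows "primitive (\<lambda>t. f (c + t)) (\<lambda>t. g (c + t))"
  unfolding primitive_def
proof (intro conjI allI impI)
  show "locally_integrable_on (\<lambda>t. g (c + t)) UNIV" by (rule locally_integrable_shift[OF primitiveD(1)[OF assms]])
  fix a b :: real assume "a \<le> b"
  then show "f (c + b) - f (c + a) = (LINT t:{a..b}|lebesgue. g (c + t))"
    using primitiveD(3)[OF assms, of "c + a" "c + b"] set_integral_shift(2)[OF primitiveD(2)[OF assms]] by simp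
qed

lemma primitive_add:
  assumes "primitive f f'" "primitive g g'"
  shows "primitive (\<lambda>t. f t + g t) (\<lambda>t. f' t + g' t)"
  unfolding primitive_def
proof (intro conjI allI impI)
  show "locally_integrable_on (\<lambda>t. f' t + g' t) UNIV"
    by (intro locally_integrable_add primitiveD(1)[OF assms(1)] primitiveD(1)[OF assms(2)])
  fix a b :: real assume "a \<le> b"
  then show "f b + g b - (f a + g a) = (LINT t:{a..b}|lebesgue. f' t + g' t)"
    using set_integral_add(2)[OF primitiveD(2)[OF assms(1)] primitiveD(2)[OF assms(2)], of a b]
      primitiveD(3)[OF assms(1), of a b] primitiveD(3)[OF assms(2), of a b] by (simp add: algebra_simps)
qed

lemma primitive_const: "primitive (\<lambda>_. c) (\<lambda>_. 0)"
  by (simp add: primitive_def locally_integrable_continuous)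

lemma primitive_sum:
  assumes "\<And>i. i \<in> I \<Longrightarrow> primitive (f i) (g i)"
  shows "primitive (\<lambda>t. \<Sum>i\<in>I. f i t) (\<lambda>t. \<Sum>i\<in>I. g i t)"
  using assms by (induction I rule: infinite_finite_induct) (auto intro: primitive_add primitive_const)

text \<open>The sum of all integer translates. The summation is over the indices with nonzero summand, so that it
  is a finite sum whenever \<open>f\<close> vanishes outside a bounded set.\<close>

definition periodize :: "(real \<Rightarrow> 'a::real_normed_vector) \<Rightarrow> real \<Rightarrow> 'a" where
  "periodize f t = (\<Sum>k\<in>{k::int. f (of_int k + t) \<noteq> 0}. f (of_int k + t))"

text \<open>On bounded sets of \<open>t\<close> one index range serves for all \<open>t\<close>, which reduces analytic properties of the
  periodization to finite sums of translates.\<close>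

lemma periodize_eq:
  assumes supp: "\<And>s. s \<notin> {-R<..<R} \<Longrightarrow> f s = 0" and n: "R + \<bar>t\<bar> \<le> real n"
  shows "periodize f t = (\<Sum>k\<in>{- int n..int n}. f (of_int k + t))"
  unfolding periodize_def
proof (rule sum.mono_neutral_left)
  show "{k::int. f (of_int k + t) \<noteq> 0} \<subseteq> {- int n..int n}"
  proof
    fix k :: int assume "k \<in> {k. f (of_int k + t) \<noteq> 0}"
    then have "of_int k + t \<in> {-R<..<R}" using supp[of "of_int k + t"] by auto
    then have "- real n \<le> of_int k" "of_int k \<le> real n" using n by auto
    then show "k \<in> {- int n..int n}" by simp
  qed
qed auto

lemma periodize_periodic: "periodize f (t + 1) = periodize f t"
  unfolding periodize_def
  by (rule sum.reindex_bij_witness[of _ "\<lambda>k. k - 1" "\<lambda>k. k + 1"]) (auto simp: algebra_simps)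

lemma periodize_primitive:
  fixes f g :: "real \<Rightarrow> 'a::{banach,second_countable_topology}"
  assumes fg: "primitive f g"
    and f: "\<And>s. s \<notin> {-R<..<R} \<Longrightarrow> f s = 0" and g: "\<And>s. s \<notin> {-R<..<R} \<Longrightarrow> g s = 0"
  shows "primitive (periodize f) (periodize g)"
proof -
  have "set_integrable lebesgue {a..b} (periodize g) \<and>
      (a \<le> b \<longrightarrow> periodize f b - periodize f a = (LINT t:{a..b}|lebesgue. periodize g t))" for a b
  proof -
    obtain n where n: "R + max \<bar>a\<bar> \<bar>b\<bar> \<le> real n" using real_arch_simple by blast
    define F where "F t = (\<Sum>k\<in>{- int n..int n}. f (of_int k + t))" for t
    define G where "G t = (\<Sum>k\<in>{- int n..int n}. g (of_int k + t))" for t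
    have FG: "primitive F G" unfolding F_def G_def by (intro primitive_sum primitive_shift fg)
    have eq: "periodize f t = F t" "periodize g t = G t" if "t \<in> {a..b}" for t
    proof -
      have "R + \<bar>t\<bar> \<le> real n" using n that by (auto simp: max_def split: if_splits)
      then show "periodize f t = F t" "periodize g t = G t"
        unfolding F_def G_def using periodize_eq[of R f t n, OF f] periodize_eq[of R g t n, OF g] by blast+
    qed
    have "set_integrable lebesgue {a..b} (periodize g) \<longleftrightarrow> set_integrable lebesgue {a..b} G"
      by (rule set_integrable_cong) (auto simp: eq)
    moreover have "(LINT t:{a..b}|lebesgue. periodize g t) = (LINT t:{a..b}|lebesgue. G t)"
      by (rule set_lebesgue_integral_cong) (auto simp: eq)
    ultimately show ?thesis using primitiveD(2,3)[OF FG, of a b] eq(1)[of a] eq(1)[of b] by auto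
  qed
  then show ?thesis by (simp add: primitive_def locally_integrable_UNIV_iff)
qed

lemma periodize_locally_L2:
  fixes f :: "real \<Rightarrow> 'a::{banach,second_countable_topology}"
  assumes "locally_L2 f" and f: "\<And>s. s \<notin> {-R<..<R} \<Longrightarrow> f s = 0"
  shows "locally_L2 (periodize f)"
  unfolding locally_L2_def
proof (intro allI impI)
  fix a b :: real assume ab: "a < b"
  obtain n where n: "R + max \<bar>a\<bar> \<bar>b\<bar> \<le> real n" using real_arch_simple by blast
  have "locally_L2 (\<lambda>t. \<Sum>k\<in>{- int n..int n}. f (of_int k + t))"
    by (intro locally_L2_sum locally_L2_shift assms(1))
  then have "L2_on a b (\<lambda>t. \<Sum>k\<in>{- int n..int n}. f (of_int k + t))" using ab by (simp add: locally_L2_def)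
  then show "L2_on a b (periodize f)"
  proof (rule L2_on_cong_AE, intro AE_I2 impI)
    fix t assume "t \<in> {a<..<b}"
    then have "R + \<bar>t\<bar> \<le> real n" using n by (auto simp: max_def split: if_splits)
    from periodize_eq[of R f t n, OF f this] show "(\<Sum>k\<in>{- int n..int n}. f (of_int k + t)) = periodize f t" by simp
  qed
qed

lemma sum_int_telescope:
  fixes p :: "real \<Rightarrow> 'a::ab_group_add"
  shows "(\<Sum>k\<in>{- int n..int n}. p (of_int k + 1) - p (of_int k)) = p (real n + 1) - p (- real n)"
proof (induction n)
  case (Suc n)
  have eq: "{- int (Suc n)..int (Suc n)} = insert (- int (Suc n)) (insert (int (Suc n)) {- int n..int n})" by auto
  have "- 1 - real n + 1 = - real n" by simp
  then show ?case unfolding eq using Suc by (simp add: algebra_simps)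
qed simp

text \<open>Unfolding: a unit interval is translated by all integers, and \<open>\<psi>\<close> is invariant under these
  translations almost everywhere.\<close>

lemma integral_periodize:
  fixes f :: "real \<Rightarrow> 'a::{banach,second_countable_topology}"
    and \<psi> :: "real \<Rightarrow> 'b::{banach,second_countable_topology}"
    and B :: "'a \<Rightarrow> 'b \<Rightarrow> 'c::{banach,second_countable_topology}"
  assumes B: "bounded_bilinear B" and f: "locally_L2 f" and supp: "\<And>s. s \<notin> {-R<..<R} \<Longrightarrow> f s = 0"
    and \<psi>: "locally_L2 \<psi>" and per: "ae_eq (\<lambda>t. \<psi> (t + 1)) \<psi>"
  shows "(LINT t:{0<..<1}|lebesgue. B (periodize f t) (\<psi> t)) = (LINT t:UNIV|lebesgue. B (f t) (\<psi> t))"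
proof -
  interpret bounded_bilinear B by fact
  define H where "H t = B (f t) (\<psi> t)" for t
  have H: "locally_integrable_on H UNIV"
    unfolding H_def by (rule locally_L2_bilinear_integrable[OF B f \<psi>])
  have H0: "H s = 0" if "s \<notin> {-R<..<R}" for s using supp[OF that] by (simp add: H_def zero_left)
  obtain p where p: "primitive p H" using primitive_exists[OF H] .
  \<comment> \<open>Translates of the unit interval by integers of modulus greater than \<open>n\<close> miss the support of \<open>f\<close>.\<close>
  obtain n where n: "R + 1 \<le> real n" using real_arch_simple by blast
  have "AE t in lebesgue. \<forall>k::int. \<psi> (t + of_int k + 1) = \<psi> (t + of_int k)"
    using AE_int_shift[OF per[unfolded ae_eq_def]] by simp
  then have per': "AE t in lebesgue. \<forall>k::int. \<psi> (of_int k + t) = \<psi> t"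
  proof eventually_elim
    case (elim t)
    show ?case
    proof
      fix k :: int
      show "\<psi> (of_int k + t) = \<psi> t"
      proof (induction k rule: int_induct[where k=0])
        case (step1 i) then show ?case using elim[rule_format, of i] by (simp add: algebra_simps)
      next
        case (step2 i) then show ?case using elim[rule_format, of "i - 1"] by (simp add: algebra_simps)
      qed simp
    qed
  qed
  have H1: "set_integrable lebesgue {0..1} (\<lambda>t. H (of_int k + t))" for k :: int
    by (rule set_integral_shift(1)[OF locally_integrableD[OF H]])
  have "(LINT t:{0<..<1}|lebesgue. B (periodize f t) (\<psi> t)) = (LINT t:{0..1}|lebesgue. B (periodize f t) (\<psi> t))"
  proof -
    have "AE x in lebesgue. x \<noteq> (0::real)" "AE x in lebesgue. x \<noteq> (1::real)"
      by (auto intro: AE_I'[of "{0}"] AE_I'[of "{1}"])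
    then have "AE x in lebesgue. indicator {0<..<1} x *\<^sub>R B (periodize f x) (\<psi> x) = indicator {0..1} x *\<^sub>R B (periodize f x) (\<psi> x)"
      by eventually_elim (auto simp: indicator_def)
    then show ?thesis
      using set_integral_AE_eq[of UNIV "\<lambda>x. indicator {0<..<1} x *\<^sub>R B (periodize f x) (\<psi> x)" "\<lambda>x. indicator {0..1} x *\<^sub>R B (periodize f x) (\<psi> x)"]
      by (simp add: set_lebesgue_integral_def)
  qed
  also have "\<dots> = (LINT t:{0..1}|lebesgue. \<Sum>k\<in>{- int n..int n}. H (of_int k + t))"
  proof (rule set_integral_AE_eq)
    show "AE t in lebesgue. t \<in> {0..1} \<longrightarrow> B (periodize f t) (\<psi> t) = (\<Sum>k\<in>{- int n..int n}. H (of_int k + t))"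
      using per'
    proof eventually_elim
      case (elim t)
      show ?case
      proof
        assume "t \<in> {0..1}"
        then have "R + \<bar>t\<bar> \<le> real n" using n by auto
        from periodize_eq[of R f t n, OF supp this]
        show "B (periodize f t) (\<psi> t) = (\<Sum>k\<in>{- int n..int n}. H (of_int k + t))"
          using elim by (simp add: H_def sum_left)
      qed
    qed
  qed
  also have "\<dots> = (\<Sum>k\<in>{- int n..int n}. LINT t:{0..1}|lebesgue. H (of_int k + t))"
    unfolding set_lebesgue_integral_def scaleR_sum_right
    by (rule Bochner_Integration.integral_sum) (rule H1[unfolded set_integrable_def])
  also have "\<dots> = (\<Sum>k\<in>{- int n..int n}. p (of_int k + 1) - p (of_int k))"
    using primitiveD(3)[OF p] set_integral_shift(2)[OF locally_integrableD[OF H]] by simp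
  also have "\<dots> = p (real n + 1) - p (- real n)" by (rule sum_int_telescope)
  also have "\<dots> = (LINT t:{- real n..real n + 1}|lebesgue. H t)" by (rule primitiveD(3)[OF p]) simp
  also have "\<dots> = (LINT t:UNIV|lebesgue. H t)"
    by (rule set_integral_support(1)[symmetric]) (use n H0 in auto)
  finally show ?thesis by (simp add: H_def)
qed

lemma has_weak_deriv_locally_L2:
  assumes "has_weak_deriv UNIV u v"
  shows "locally_L2 u"
proof -
  obtain w where "primitive w v" "ae_eq w u" using has_weak_deriv_imp_primitive[OF assms] .
  then show ?thesis using locally_L2_cong[OF locally_L2_continuous[OF primitive_continuous]] by blast
qed

lemma has_weak_deriv_add:
  fixes u v :: "real \<Rightarrow> 'a::{banach,second_countable_topology}"
  assumes "has_weak_deriv UNIV u v" "has_weak_deriv UNIV u' v'"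
  shows "has_weak_deriv UNIV (\<lambda>t. u t + u' t) (\<lambda>t. v t + v' t)"
proof -
  obtain w where w: "primitive w v" "ae_eq w u" using has_weak_deriv_imp_primitive[OF assms(1)] .
  obtain w' where w': "primitive w' v'" "ae_eq w' u'" using has_weak_deriv_imp_primitive[OF assms(2)] .
  have "ae_eq (\<lambda>t. w t + w' t) (\<lambda>t. u t + u' t)"
    using w(2) w'(2) unfolding ae_eq_def by eventually_elim simp
  then show ?thesis
    using has_weak_deriv_cong[OF primitive_has_weak_deriv[OF primitive_add[OF w(1) w'(1)]]] by simp
qed

lemma periodize_cong_ae:
  assumes "ae_eq f g"
  shows "ae_eq (periodize f) (periodize g)"
proof -
  have "AE t in lebesgue. \<forall>k::int. f (t + of_int k) = g (t + of_int k)"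
    using AE_int_shift[OF assms[unfolded ae_eq_def]] .
  then show ?thesis
    unfolding ae_eq_def by eventually_elim (simp add: periodize_def add.commute)
qed

lemma periodize_add:
  assumes f: "\<And>s. s \<notin> {-R<..<R} \<Longrightarrow> f s = 0" and g: "\<And>s. s \<notin> {-R<..<R} \<Longrightarrow> g s = 0"
  shows "periodize (\<lambda>s. f s + g s) t = periodize f t + periodize g t"
proof -
  obtain n where n: "R + \<bar>t\<bar> \<le> real n" using real_arch_simple by blast
  have "f s + g s = 0" if "s \<notin> {-R<..<R}" for s using f[OF that] g[OF that] by simp
  from periodize_eq[of R "\<lambda>s. f s + g s" t n, OF this n] show ?thesis
    using periodize_eq[of R f t n, OF f n] periodize_eq[of R g t n, OF g n] by (simp add: sum.distrib)
qed

lemma periodize_linear_image: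
  assumes f: "\<And>s. s \<notin> {-R<..<R} \<Longrightarrow> f s = 0" and g: "\<And>s. s \<notin> {-R<..<R} \<Longrightarrow> g s = 0"
    and T: "bounded_linear T" and eq: "\<And>k::int. T (f (of_int k + t)) = g (of_int k + t)"
  shows "T (periodize f t) = periodize g t"
proof -
  obtain n where n: "R + \<bar>t\<bar> \<le> real n" using real_arch_simple by blast
  show ?thesis
    using periodize_eq[of R f t n, OF f n] periodize_eq[of R g t n, OF g n]
    by (simp add: linear_sum[OF bounded_linear.linear[OF T]] eq)
qed

section \<open>The differential equation for pairings with the adjoint chains\<close>

locale periodic_evolution =
  fixes \<iota> :: "'x::{complex_hilbert,second_countable_topology} \<Rightarrow>
              'y::{complex_hilbert,second_countable_topology}"
    and A :: "real \<Rightarrow> 'x \<Rightarrow>\<^sub>L 'y"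
  assumes embedding: "compact_dense_embedding \<iota>"
    and A_clinear: "\<And>t. bounded_clinear (blinfun_apply (A t))"
    and A_periodic: "\<And>t. A (t + 1) = A t"
    and A_continuous: "continuous_on UNIV A"
begin

lemma \<iota>_linear: "bounded_linear \<iota>" and \<iota>_scaleC: "\<iota> (c *\<^sub>C x) = c *\<^sub>C \<iota> x"
  and inv_\<iota>: "inv \<iota> (\<iota> x) = x" and \<iota>_dense: "closure (range \<iota>) = UNIV"
  using embedding by (auto simp: compact_dense_embedding_def bounded_clinear_def)

lemma A_scaleC: "A t (c *\<^sub>C x) = c *\<^sub>C A t x"
  using A_clinear[of t] by (simp add: bounded_clinear_def)

lemma A_int_periodic: "A (of_int k + t) = A t"
proof (induction k rule: int_induct[where k=0])
  case (step1 i) then show ?case using A_periodic[of "of_int i + t"] by (simp add: algebra_simps)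
next
  case (step2 i) then show ?case using A_periodic[of "of_int (i - 1) + t"] by (simp add: algebra_simps)
qed simp

text \<open>The space of operators need not be second countable, so measurability is read off from joint
  continuity of \<open>(t, x) \<mapsto> A t x\<close> on the second countable product of the line and \<open>X\<close>.\<close>

lemma locally_L2_A:
  assumes "locally_L2 w"
  shows "locally_L2 (\<lambda>t. A t (w t))"
proof (rule locally_L2_bound[OF assms])
  have "continuous_on UNIV (\<lambda>p. blinfun_apply (A (fst p)) (snd p))"
    by (intro continuous_intros continuous_on_compose2[OF A_continuous]) auto
  then show "(\<lambda>t. A t (w t)) \<in> borel_measurable lebesgue"
    using borel_measurable_continuous_Pair[of "\<lambda>t. t" lebesgue w "\<lambda>t x. A t x"]
      continuous_measurable[OF continuous_on_id] locally_L2_measurable[OF assms] by simp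
  fix a b
  obtain C where C: "\<forall>t\<in>{a..b}. norm (A t) \<le> C" using continuous_locally_bounded[OF A_continuous] by blast
  have "norm (A t (w t)) \<le> C * norm (w t)" if "t \<in> {a..b}" for t
    using norm_blinfun[of "A t" "w t"] C that by (meson mult_right_mono norm_ge_zero order_trans)
  then show "\<exists>C. AE t in lebesgue. t \<in> {a..b} \<longrightarrow> norm (A t (w t)) \<le> C * norm (w t)" by blast
qed

lemma L_op_ae:
  assumes "has_weak_deriv UNIV u v"
  shows "ae_eq (L_op \<iota> A UNIV u) (\<lambda>t. v t + A t (inv \<iota> (u t)))"
  using Dt_ae_eq[OF assms] unfolding ae_eq_def L_op_def by eventually_elim simp

lemma locally_L2_L_op:
  assumes u: "u \<in> X_loc \<iota>"
  shows "locally_L2 (L_op \<iota> A UNIV u)"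
proof -
  obtain v where v: "has_weak_deriv UNIV u v" "locally_L2 v" and U: "locally_L2 (\<lambda>t. inv \<iota> (u t))"
    using u unfolding X_loc_iff by blast
  show ?thesis
    by (rule locally_L2_cong[OF locally_L2_add[OF v(2) locally_L2_A[OF U]] ae_eq_sym[OF L_op_ae[OF v(1)]]])
qed

text \<open>Linearity of \<open>\<iota>\<close> and periodicity of \<open>A\<close> let the embedding, the derivative and the pencil pass through
  the sum of translates.\<close>

lemma periodize_X_hat:
  assumes u: "u \<in> X_loc \<iota>" and \<eta>: "test_function UNIV \<eta>"
  defines "w \<equiv> periodize (\<lambda>t. \<eta> t *\<^sub>R u t)"
  shows "w \<in> X_hat \<iota>"
    "ae_eq (pencil \<iota> A l w) (periodize (\<lambda>t. deriv \<eta> t *\<^sub>R u t + \<eta> t *\<^sub>R (L_op \<iota> A UNIV u t + l *\<^sub>C u t)))"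
proof -
  obtain v where v: "has_weak_deriv UNIV u v" "locally_L2 v" and U: "locally_L2 (\<lambda>t. inv \<iota> (u t))"
    and ran: "AE t in lebesgue. u t \<in> range \<iota>"
    using u unfolding X_loc_iff by blast
  obtain u0 where u0: "primitive u0 v" "ae_eq u0 u" using has_weak_deriv_imp_primitive[OF v(1)] .
  obtain R where R: "\<And>t. t \<notin> {-R<..<R} \<Longrightarrow> \<eta> t = 0" "\<And>t. t \<notin> {-R<..<R} \<Longrightarrow> deriv \<eta> t = 0"
    using test_function_support[OF \<eta>] by metis
  have \<eta>s: "smooth \<eta>" using \<eta> by (simp add: test_function_iff)
  define F1 where "F1 t = deriv \<eta> t *\<^sub>R u t + \<eta> t *\<^sub>R v t" for t
  define F2 where "F2 t = \<eta> t *\<^sub>R A t (inv \<iota> (u t))" for t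
  define F3 where "F3 t = \<eta> t *\<^sub>R (l *\<^sub>C u t)" for t
  define W where "W t = \<eta> t *\<^sub>R inv \<iota> (u t)" for t
  have supp: "F1 s = 0" "F2 s = 0" "F3 s = 0" "W s = 0" "\<eta> s *\<^sub>R u s = 0" if "s \<notin> {-R<..<R}" for s
    using R(1)[OF that] R(2)[OF that] by (simp_all add: F1_def F2_def F3_def W_def)
  have "primitive (\<lambda>t. \<eta> t *\<^sub>R u0 t) (\<lambda>t. deriv \<eta> t *\<^sub>R u0 t + \<eta> t *\<^sub>R v t)"
    by (rule primitive_bilinear[OF bounded_bilinear_scaleR primitive_smooth[OF \<eta>s] u0(1)])
  then have "primitive (periodize (\<lambda>t. \<eta> t *\<^sub>R u0 t)) (periodize (\<lambda>t. deriv \<eta> t *\<^sub>R u0 t + \<eta> t *\<^sub>R v t))"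
    by (rule periodize_primitive[where R=R]) (simp_all add: R)
  moreover have "ae_eq (periodize (\<lambda>t. \<eta> t *\<^sub>R u0 t)) w"
    unfolding w_def using u0(2) by (intro periodize_cong_ae) (auto simp: ae_eq_def elim!: eventually_mono)
  moreover have "ae_eq (periodize (\<lambda>t. deriv \<eta> t *\<^sub>R u0 t + \<eta> t *\<^sub>R v t)) (periodize F1)"
    unfolding F1_def using u0(2) by (intro periodize_cong_ae) (auto simp: ae_eq_def elim!: eventually_mono)
  ultimately have dw: "has_weak_deriv UNIV w (periodize F1)"
    using has_weak_deriv_cong[OF primitive_has_weak_deriv] by blast
  have L2F1: "locally_L2 F1"
    unfolding F1_def
    by (intro locally_L2_add locally_L2_bilinear_continuous[OF bounded_bilinear.flip[OF bounded_bilinear_scaleR]]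
        smooth_continuous smooth_deriv \<eta>s has_weak_deriv_locally_L2[OF v(1)] v(2))
  have L2W: "locally_L2 W"
    unfolding W_def
    by (intro locally_L2_bilinear_continuous[OF bounded_bilinear.flip[OF bounded_bilinear_scaleR]] smooth_continuous \<eta>s U)
  have "AE t in lebesgue. \<forall>k::int. u (t + of_int k) \<in> range \<iota>" by (rule AE_int_shift[OF ran])
  then have wW: "AE t in lebesgue. w t = \<iota> (periodize W t)"
  proof eventually_elim
    case (elim t)
    have "\<iota> (W (of_int k + t)) = \<eta> (of_int k + t) *\<^sub>R u (of_int k + t)" for k :: int
      using elim[rule_format, of k] by (auto simp: W_def inv_\<iota> linear_simps[OF \<iota>_linear] add.commute)
    from periodize_linear_image[of R W "\<lambda>t. \<eta> t *\<^sub>R u t" \<iota> t, OF supp(4,5) \<iota>_linear this]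
    show ?case by (simp add: w_def)
  qed
  have w_loc: "w \<in> X_loc \<iota>"
    unfolding X_loc_iff
  proof (intro conjI exI[of _ "periodize F1"] dw)
    show "AE t in lebesgue. w t \<in> range \<iota>" using wW by eventually_elim simp
    have "ae_eq (periodize W) (\<lambda>t. inv \<iota> (w t))"
      unfolding ae_eq_def using wW by eventually_elim (simp add: inv_\<iota>)
    moreover have "locally_L2 (periodize W)" by (rule periodize_locally_L2[OF L2W]) (rule supp(4))
    ultimately show "locally_L2 (\<lambda>t. inv \<iota> (w t))" by (rule locally_L2_cong[rotated])
    show "locally_L2 (periodize F1)" by (rule periodize_locally_L2[OF L2F1]) (rule supp(1))
  qed
  have "ae_eq (\<lambda>t. w (t + 1)) w" by (simp add: w_def periodize_periodic)
  with w_loc show "w \<in> X_hat \<iota>" by (simp add: X_hat_def)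
  have "ae_eq (pencil \<iota> A l w) (periodize (\<lambda>t. F1 t + F2 t + F3 t))"
    using L_op_ae[OF dw] wW unfolding ae_eq_def
  proof eventually_elim
    case (elim t)
    have "A t (W (of_int k + t)) = F2 (of_int k + t)" for k :: int
      by (simp add: W_def F2_def A_int_periodic blinfun.scaleR_right)
    from periodize_linear_image[of R W F2 "A t" t, OF supp(4,2) blinfun.bounded_linear_right this]
    have 2: "A t (inv \<iota> (w t)) = periodize F2 t" by (simp add: elim(2) inv_\<iota>)
    have "l *\<^sub>C (\<eta> s *\<^sub>R u s) = F3 s" for s by (simp add: F3_def scaleC.scaleR_right)
    from periodize_linear_image[of R "\<lambda>t. \<eta> t *\<^sub>R u t" F3 "scaleC l" t, OF supp(5,3) scaleC.bounded_linear_right this]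
    have 3: "l *\<^sub>C w t = periodize F3 t" by (simp add: w_def)
    have F12: "F1 s + F2 s = 0" if "s \<notin> {-R<..<R}" for s using supp[OF that] by simp
    show ?case
      using periodize_add[of R "\<lambda>t. F1 t + F2 t" F3 t, OF F12 supp(3)] periodize_add[of R F1 F2 t, OF supp(1,2)]
      by (simp add: pencil_def elim(1) 2 3)
  qed
  moreover have "ae_eq (periodize (\<lambda>t. F1 t + F2 t + F3 t))
      (periodize (\<lambda>t. deriv \<eta> t *\<^sub>R u t + \<eta> t *\<^sub>R (L_op \<iota> A UNIV u t + l *\<^sub>C u t)))"
  proof (rule periodize_cong_ae)
    show "ae_eq (\<lambda>t. F1 t + F2 t + F3 t) (\<lambda>t. deriv \<eta> t *\<^sub>R u t + \<eta> t *\<^sub>R (L_op \<iota> A UNIV u t + l *\<^sub>C u t))"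
      using L_op_ae[OF v(1)] unfolding ae_eq_def
      by eventually_elim (simp add: F1_def F2_def F3_def algebra_simps)
  qed
  ultimately show "ae_eq (pencil \<iota> A l w) (periodize (\<lambda>t. deriv \<eta> t *\<^sub>R u t + \<eta> t *\<^sub>R (L_op \<iota> A UNIV u t + l *\<^sub>C u t)))"
    by (rule ae_eq_trans)
qed

text \<open>The adjoint equation is tested with the periodization of \<open>\<eta> u\<close>, and both sides are unfolded to
  integrals over the line.\<close>

lemma has_weak_deriv_cinner:
  assumes u: "u \<in> X_loc \<iota>" and \<psi>: "\<psi> \<in> Y_hat" and \<theta>: "\<theta> \<in> Y_hat"
    and adj: "\<And>w. w \<in> X_hat \<iota> \<Longrightarrow> Y_hat_inner (pencil \<iota> A l w) \<psi> = - Y_hat_inner w \<theta>"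
  shows "has_weak_deriv UNIV (\<lambda>t. cinner (u t) (\<psi> t))
    (\<lambda>t. cinner (L_op \<iota> A UNIV u t + l *\<^sub>C u t) (\<psi> t) + cinner (u t) (\<theta> t))"
proof -
  obtain v where v: "has_weak_deriv UNIV u v" using u unfolding X_loc_iff by blast
  have uL: "locally_L2 u" by (rule has_weak_deriv_locally_L2[OF v])
  have \<psi>L: "locally_L2 \<psi>" "ae_eq (\<lambda>t. \<psi> (t + 1)) \<psi>" and \<theta>L: "locally_L2 \<theta>" "ae_eq (\<lambda>t. \<theta> (t + 1)) \<theta>"
    using \<psi> \<theta> by (auto simp: Y_hat_def Y_loc_iff)
  define g where "g t = L_op \<iota> A UNIV u t + l *\<^sub>C u t" for t
  have gL: "locally_L2 g"
    unfolding g_def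
    by (intro locally_L2_add locally_L2_L_op[OF u]
        locally_L2_bilinear_continuous[OF bounded_bilinear.flip[OF bounded_bilinear_scaleC] uL] continuous_on_const)
  have i1: "locally_integrable_on (\<lambda>t. cinner (u t) (\<psi> t)) UNIV"
    and i2: "locally_integrable_on (\<lambda>t. cinner (g t) (\<psi> t)) UNIV"
    and i3: "locally_integrable_on (\<lambda>t. cinner (u t) (\<theta> t)) UNIV"
    by (intro locally_L2_bilinear_integrable[OF bounded_bilinear_cinner] uL \<psi>L gL \<theta>L)+
  show ?thesis
    unfolding has_weak_deriv_def g_def[symmetric]
  proof (intro conjI allI impI i1 locally_integrable_add i2 i3)
    fix \<eta> assume \<eta>: "test_function UNIV \<eta>"
    obtain R where R: "\<And>t. t \<notin> {-R<..<R} \<Longrightarrow> \<eta> t = 0" "\<And>t. t \<notin> {-R<..<R} \<Longrightarrow> deriv \<eta> t = 0"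
      using test_function_support[OF \<eta>] by metis
    have \<eta>s: "smooth \<eta>" using \<eta> by (simp add: test_function_iff)
    define w where "w = periodize (\<lambda>t. \<eta> t *\<^sub>R u t)"
    define F where "F t = deriv \<eta> t *\<^sub>R u t + \<eta> t *\<^sub>R g t" for t
    have FL: "locally_L2 F" and \<eta>uL: "locally_L2 (\<lambda>t. \<eta> t *\<^sub>R u t)"
      unfolding F_def
      by (intro locally_L2_add locally_L2_bilinear_continuous[OF bounded_bilinear.flip[OF bounded_bilinear_scaleR]]
          smooth_continuous smooth_deriv \<eta>s uL gL)+
    have pw: "w \<in> X_hat \<iota>" "ae_eq (pencil \<iota> A l w) (periodize F)"
      using periodize_X_hat[OF u \<eta>] by (simp_all add: w_def F_def[abs_def] g_def)
    have "(LINT t:UNIV|lebesgue. cinner (F t) (\<psi> t)) = (LINT t:{0<..<1}|lebesgue. cinner (periodize F t) (\<psi> t))"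
      by (rule integral_periodize[OF bounded_bilinear_cinner FL _ \<psi>L, where R=R, symmetric]) (simp add: F_def R)
    also have "\<dots> = Y_hat_inner (pencil \<iota> A l w) \<psi>"
      unfolding Y_hat_inner_def
      by (rule set_integral_AE_eq) (use pw(2) in \<open>auto simp: ae_eq_def elim!: eventually_mono\<close>)
    also have "\<dots> = - Y_hat_inner w \<theta>" by (rule adj[OF pw(1)])
    also have "Y_hat_inner w \<theta> = (LINT t:UNIV|lebesgue. cinner (\<eta> t *\<^sub>R u t) (\<theta> t))"
      unfolding Y_hat_inner_def w_def
      by (rule integral_periodize[OF bounded_bilinear_cinner \<eta>uL _ \<theta>L, where R=R]) (simp add: R)
    finally have eq: "(LINT t:UNIV|lebesgue. cinner (F t) (\<psi> t)) = - (LINT t:UNIV|lebesgue. cinner (\<eta> t *\<^sub>R u t) (\<theta> t))" .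
    note t1 = test_function_integrable[OF i1 test_function_deriv[OF \<eta>]]
      and t2 = test_function_integrable[OF i2 \<eta>] and t3 = test_function_integrable[OF i3 \<eta>]
    have "(LINT t:UNIV|lebesgue. deriv \<eta> t *\<^sub>R cinner (u t) (\<psi> t)) + (LINT t:UNIV|lebesgue. \<eta> t *\<^sub>R cinner (g t) (\<psi> t))
        = (LINT t:UNIV|lebesgue. cinner (F t) (\<psi> t))"
      unfolding set_integral_add(2)[OF t1 t2, symmetric]
      by (simp add: F_def cinner.add_left cinner.scaleR_left)
    also have "\<dots> = - (LINT t:UNIV|lebesgue. \<eta> t *\<^sub>R cinner (u t) (\<theta> t))"
      unfolding eq by (simp add: cinner.scaleR_left)
    finally have "(LINT t:UNIV|lebesgue. deriv \<eta> t *\<^sub>R cinner (u t) (\<psi> t))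
          + (LINT t:UNIV|lebesgue. \<eta> t *\<^sub>R cinner (g t) (\<psi> t))
        = - (LINT t:UNIV|lebesgue. \<eta> t *\<^sub>R cinner (u t) (\<theta> t))" .
    moreover have "a = - (b + c)" if "a + b = - c" for a b c :: complex
      using that by (metis add.assoc eq_neg_iff_add_eq_0)
    ultimately show "(LINT t:UNIV|lebesgue. deriv \<eta> t *\<^sub>R cinner (u t) (\<psi> t))
        = - (LINT t:UNIV|lebesgue. \<eta> t *\<^sub>R (cinner (g t) (\<psi> t) + cinner (u t) (\<theta> t)))"
      unfolding scaleR_add_right set_integral_add(2)[OF t2 t3] by blast
  qed
qed

end

section \<open>Weakly continuous representatives\<close>

text \<open>A nonempty open set is not a null set; this turns closed conditions that hold almost everywhere
  into pointwise ones.\<close>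

lemma closed_AE_imp_all:
  assumes "closed {t. P (t::real)}" "AE t in lebesgue. P t"
  shows "P t"
proof -
  have "negligible {t. \<not> P t}"
    using assms(2) by (simp add: negligible_iff_null_sets completion.AE_iff_null_sets)
  moreover have "open {t. \<not> P t}" using assms(1) by (simp add: closed_def Collect_neg_eq)
  ultimately have "{t. \<not> P t} = {}" using open_not_negligible by blast
  then show ?thesis by blast
qed

lemma continuous_ae_eq_imp_eq:
  fixes f g :: "real \<Rightarrow> 'a::real_normed_vector"
  assumes "continuous_on UNIV f" "continuous_on UNIV g" "ae_eq f g"
  shows "f t = g t"
  using assms by (intro closed_AE_imp_all[of "\<lambda>t. f t = g t"] closed_Collect_eq) (auto simp: ae_eq_def)

lemma weakly_continuous_of_continuous:
  fixes g :: "real \<Rightarrow> 'a::complex_hilbert"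
  shows "continuous_on UNIV g \<Longrightarrow> weakly_continuous g"
  unfolding weakly_continuous_def by (intro allI cinner.continuous_on continuous_intros)

lemma AE_bound_nonneg:
  assumes "AE t::real in lebesgue. norm (g t) \<le> C"
  shows "0 \<le> C"
proof -
  have "AE t::real in lebesgue. 0 \<le> C" by (rule eventually_mono[OF assms]) (rule order_trans[OF norm_ge_zero])
  then show ?thesis by (rule closed_AE_imp_all[of "\<lambda>_. 0 \<le> C", rotated]) simp
qed

text \<open>If \<open>y\<^sub>n\<close> tends to \<open>l\<close>, the continuous representatives of the coefficients with respect to \<open>y\<^sub>n\<close>
  converge uniformly, because \<open>g\<close> is essentially bounded.\<close>

lemma closed_continuous_coefficients:
  fixes g :: "real \<Rightarrow> 'a::complex_hilbert"
  assumes bd: "AE t in lebesgue. norm (g t) \<le> C"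
  shows "closed {y. \<exists>c. continuous_on UNIV c \<and> ae_eq c (\<lambda>t. cinner y (g t))}"
  unfolding closed_sequential_limits
proof (intro allI impI, elim conjE)
  fix y l assume "\<forall>n. y n \<in> {y. \<exists>c. continuous_on UNIV c \<and> ae_eq c (\<lambda>t. cinner y (g t))}" and lim: "y \<longlonglongrightarrow> l"
  then have "\<forall>n. \<exists>c. continuous_on UNIV c \<and> ae_eq c (\<lambda>t. cinner (y n) (g t))" by blast
  then obtain c where c: "\<And>n. continuous_on UNIV (c n)" "\<And>n. ae_eq (c n) (\<lambda>t. cinner (y n) (g t))" by metis
  have C: "0 \<le> C" by (rule AE_bound_nonneg[OF bd])
  have le: "cmod (c n t - c m t) \<le> norm (y n - y m) * C * 2" for n m t
  proof (rule closed_AE_imp_all[where P="\<lambda>t. cmod (c n t - c m t) \<le> norm (y n - y m) * C * 2"])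
    show "closed {t. cmod (c n t - c m t) \<le> norm (y n - y m) * C * 2}"
      by (intro closed_Collect_le continuous_intros c(1))
    show "AE t in lebesgue. cmod (c n t - c m t) \<le> norm (y n - y m) * C * 2"
      using c(2)[of n, unfolded ae_eq_def] c(2)[of m, unfolded ae_eq_def] bd
    proof eventually_elim
      case (elim t)
      have "cmod (c n t - c m t) = cmod (cinner (y n - y m) (g t))" using elim by (simp add: cinner.diff_left)
      also have "\<dots> \<le> norm (y n - y m) * norm (g t) * 2" by (rule norm_cinner_le)
      also have "\<dots> \<le> norm (y n - y m) * C * 2" using elim by (intro mult_right_mono mult_left_mono) auto
      finally show ?case .
    qed
  qed
  have "uniformly_Cauchy_on UNIV c"
    unfolding uniformly_Cauchy_on_def
  proof (intro allI impI)
    fix e :: real assume e: "e > 0"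
    have "Cauchy y" using lim by (rule LIMSEQ_imp_Cauchy)
    then obtain M where M: "\<And>m n. m \<ge> M \<Longrightarrow> n \<ge> M \<Longrightarrow> dist (y m) (y n) < e / (2 * C + 1)"
      using e C unfolding Cauchy_def by (metis add_nonneg_pos divide_pos_pos mult_nonneg_nonneg zero_le_numeral zero_less_one)
    have "dist (c m t) (c n t) < e" if "m \<ge> M" "n \<ge> M" for m n t
    proof -
      have "dist (c m t) (c n t) \<le> norm (y m - y n) * (2 * C)" using le[of m t n] by (simp add: dist_norm mult_ac)
      also have "\<dots> \<le> e / (2 * C + 1) * (2 * C)"
        using M[OF that] C by (intro mult_right_mono) (auto simp: dist_norm)
      also have "\<dots> < e" using e C by (simp add: divide_less_eq mult_ac)
      finally show ?thesis .
    qed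
    then show "\<exists>M. \<forall>x\<in>UNIV. \<forall>m\<ge>M. \<forall>n\<ge>M. dist (c m x) (c n x) < e" by blast
  qed
  then obtain k where k: "uniform_limit UNIV c k sequentially"
    using Cauchy_uniformly_convergent uniformly_convergent_on_def by blast
  have "continuous_on UNIV k"
    by (rule uniform_limit_theorem[OF _ k]) (simp_all add: c(1))
  moreover have "AE t in lebesgue. \<forall>n. c n t = cinner (y n) (g t)"
    unfolding AE_all_countable using c(2) by (simp add: ae_eq_def)
  then have "ae_eq k (\<lambda>t. cinner l (g t))"
    unfolding ae_eq_def
  proof eventually_elim
    case (elim t)
    have "(\<lambda>n. c n t) \<longlonglongrightarrow> k t" using tendsto_uniform_limitI[OF k] by simp
    moreover have "(\<lambda>n. c n t) \<longlonglongrightarrow> cinner l (g t)"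
      using cinner.tendsto[OF lim tendsto_const] by (simp add: elim)
    ultimately show ?case by (rule LIMSEQ_unique)
  qed
  ultimately show "l \<in> {y. \<exists>c. continuous_on UNIV c \<and> ae_eq c (\<lambda>t. cinner y (g t))}" by blast
qed

text \<open>For all \<open>y\<close> the coefficient \<open>(y, g)\<close> has a continuous representative. It is linear in \<open>y\<close> and bounded
  at every \<open>t\<close>, because these are closed conditions that hold almost everywhere, and the Riesz theorem
  represents it by a vector \<open>h t\<close>. That \<open>h = g\<close> almost everywhere is checked on a countable dense set.\<close>

lemma weakly_continuous_representative:
  fixes g :: "real \<Rightarrow> 'a::{complex_hilbert,second_countable_topology}"
  assumes bd: "AE t in lebesgue. norm (g t) \<le> C"
    and D: "closure D = UNIV"
    and rep: "\<And>d. d \<in> D \<Longrightarrow> \<exists>c. continuous_on UNIV c \<and> ae_eq c (\<lambda>t. cinner d (g t))"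
  obtains h where "weakly_continuous h" "ae_eq h g" "\<And>t. norm (h t) \<le> 2 * C"
proof -
  have "closure D \<subseteq> {y. \<exists>c. continuous_on UNIV c \<and> ae_eq c (\<lambda>t. cinner y (g t))}"
    using rep by (intro closure_minimal closed_continuous_coefficients[OF bd]) auto
  then have "\<forall>y. \<exists>c. continuous_on UNIV c \<and> ae_eq c (\<lambda>t. cinner y (g t))" using D by blast
  then obtain c where c: "\<And>y. continuous_on UNIV (c y)" "\<And>y. ae_eq (c y) (\<lambda>t. cinner y (g t))" by metis
  have add: "c (x + y) t = c x t + c y t" for x y t
  proof (rule continuous_ae_eq_imp_eq[of "c (x + y)" "\<lambda>t. c x t + c y t"])
    show "ae_eq (c (x + y)) (\<lambda>t. c x t + c y t)"
      using c(2)[of x] c(2)[of y] c(2)[of "x + y"] unfolding ae_eq_def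
      by eventually_elim (simp add: cinner.add_left)
  qed (intro continuous_intros c(1))+
  have scale: "c (a *\<^sub>C x) t = a * c x t" for a x t
  proof (rule continuous_ae_eq_imp_eq[of "c (a *\<^sub>C x)" "\<lambda>t. a * c x t"])
    show "ae_eq (c (a *\<^sub>C x)) (\<lambda>t. a * c x t)"
      using c(2)[of x] c(2)[of "a *\<^sub>C x"] unfolding ae_eq_def
      by eventually_elim (simp add: cinner_scaleC_left)
  qed (intro continuous_intros c(1))+
  have le: "cmod (c y t) \<le> norm y * (C * 2)" for y t
  proof (rule closed_AE_imp_all[where P="\<lambda>t. cmod (c y t) \<le> norm y * (C * 2)"])
    show "closed {t. cmod (c y t) \<le> norm y * (C * 2)}" by (intro closed_Collect_le continuous_intros c(1))
    show "AE t in lebesgue. cmod (c y t) \<le> norm y * (C * 2)"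
      using c(2)[of y, unfolded ae_eq_def] bd
    proof eventually_elim
      case (elim t)
      have "cmod (cinner y (g t)) \<le> norm y * norm (g t) * 2" by (rule norm_cinner_le)
      also have "\<dots> \<le> norm y * C * 2" using elim by (intro mult_right_mono mult_left_mono) auto
      finally show ?case using elim by (simp add: mult_ac)
    qed
  qed
  have "\<exists>z. \<forall>y. c y t = cinner y z" for t
  proof (rule riesz_representation)
    have "c (r *\<^sub>R x) t = r *\<^sub>R c x t" for r x
      by (simp add: scaleR_eq_scaleC scale scaleR_conv_of_real)
    then show "bounded_linear (\<lambda>y. c y t)" using add le by (intro bounded_linear_intro[of _ "C * 2"]) auto
  qed (rule scale)
  then obtain h where h: "\<And>y t. c y t = cinner y (h t)" by metis
  show thesis
  proof (rule that[of h])
    have "continuous_on UNIV (\<lambda>t. cnj (c y t))" for y by (intro continuous_intros c(1))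
    then show "weakly_continuous h"
      unfolding weakly_continuous_def h by (simp add: cinner_commute[symmetric])
    show "norm (h t) \<le> 2 * C" for t
    proof -
      have "norm (h t) * norm (h t) = Re (c (h t) t)"
        by (simp add: h inner_eq_Re_cinner[symmetric] power2_norm_eq_inner[symmetric] power2_eq_square)
      also have "\<dots> \<le> norm (h t) * (C * 2)" using le[of "h t" t] complex_Re_le_cmod[of "c (h t) t"] by linarith
      finally show ?thesis
        using AE_bound_nonneg[OF bd] by (cases "norm (h t) = 0") (auto simp: mult_ac)
    qed
    obtain E :: "'a set" where E: "countable E" "\<And>U. open U \<Longrightarrow> U \<noteq> {} \<Longrightarrow> \<exists>e\<in>E. e \<in> U"
      using countable_dense_exists by metis
    have Ecl: "closure E = UNIV"
      unfolding closure_approachable set_eq_iff using E(2)[of "ball _ _"] by (auto simp: dist_commute)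
    have "AE t in lebesgue. \<forall>e\<in>E. c e t = cinner e (g t)"
      using E(1) c(2) by (intro AE_ball_countable[THEN iffD2]) (auto simp: ae_eq_def)
    then show "ae_eq h g"
      unfolding ae_eq_def by eventually_elim (rule eq_of_cinner_dense[OF Ecl], simp add: h)
  qed
qed

lemma continuous_cinner_weak:
  fixes f h :: "real \<Rightarrow> 'a::complex_hilbert"
  assumes f: "continuous_on UNIV f" and h: "weakly_continuous h" and bd: "\<And>t. norm (h t) \<le> C"
  shows "continuous_on UNIV (\<lambda>t. cinner (f t) (h t))"
proof -
  have "isCont (\<lambda>t. cinner (f t) (h t)) t" for t
  proof -
    have w: "((\<lambda>s. cinner (f t) (h s)) \<longlongrightarrow> cinner (f t) (h t)) (at t)"
    proof -
      have "isCont (\<lambda>s. cinner (h s) (f t)) t"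
        using h by (simp add: weakly_continuous_def continuous_on_eq_continuous_at)
      then have "((\<lambda>s. cnj (cinner (h s) (f t))) \<longlongrightarrow> cnj (cinner (h t) (f t))) (at t)"
        unfolding isCont_def by (rule tendsto_cnj)
      then show ?thesis by (simp add: cinner_commute[symmetric])
    qed
    have "((\<lambda>s. norm (f s - f t) * (C * 2)) \<longlongrightarrow> norm (f t - f t) * (C * 2)) (at t)"
      using f by (intro tendsto_intros) (simp add: continuous_on_eq_continuous_at isCont_def)
    then have "((\<lambda>s. norm (f s - f t) * (C * 2)) \<longlongrightarrow> 0) (at t)" by simp
    moreover have "norm (cinner (f s - f t) (h s)) \<le> norm (f s - f t) * (C * 2)" for s
    proof -
      have "norm (f s - f t) * norm (h s) * 2 \<le> norm (f s - f t) * C * 2"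
        using bd by (intro mult_right_mono mult_left_mono) auto
      then show ?thesis using norm_cinner_le[of "f s - f t" "h s"] by (simp add: mult_ac)
    qed
    ultimately have "((\<lambda>s. cinner (f s - f t) (h s)) \<longlongrightarrow> 0) (at t)"
      by (intro Lim_null_comparison[of "\<lambda>s. cinner (f s - f t) (h s)"]) auto
    from tendsto_add[OF this w] show ?thesis by (simp add: isCont_def cinner.diff_left)
  qed
  then show ?thesis by (simp add: continuous_on_eq_continuous_at)
qed

text \<open>The indefinite integral of \<open>g\<close> that equals \<open>f\<close> almost everywhere is continuous, so the two agree at
  every point.\<close>

lemma has_vector_derivative_of_weak:
  fixes f g :: "real \<Rightarrow> 'a::{banach,second_countable_topology}"
  assumes w: "has_weak_deriv UNIV f g" and f: "continuous_on UNIV f" and g: "continuous_on UNIV g"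
  shows "(f has_vector_derivative g t) (at t)"
proof -
  obtain u where u: "primitive u g" "ae_eq u f" using has_weak_deriv_imp_primitive[OF w] .
  have "u s = f s" for s by (rule continuous_ae_eq_imp_eq[OF primitive_continuous[OF u(1)] f u(2)])
  then have "u = f" by blast
  then show ?thesis
    using primitive_has_vector_derivative[OF u(1), of t] g by (simp add: continuous_on_eq_continuous_at)
qed

section \<open>Periodic solutions of the triangular system of pairings\<close>

text \<open>The difference is an integer multiple of \<open>2 \<pi> \<i>\<close>, and its imaginary part is less than \<open>2 \<pi>\<close> in
  absolute value.\<close>

lemma exp_eq_1_strip:
  fixes l l' :: complex
  assumes "exp (l' - l) = 1" "0 \<le> Im l" "Im l < 2 * pi" "0 \<le> Im l'" "Im l' < 2 * pi"
  shows "l' = l"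
proof -
  obtain n :: int where n: "Re (l' - l) = 0" "Im (l' - l) = of_int (2 * n) * pi"
    using assms(1) unfolding exp_eq_1 by blast
  then have eq: "of_int n * (2 * pi) = Im l' - Im l" by simp
  have "n < 1"
  proof (rule ccontr)
    assume "\<not> n < 1"
    then have "1 * (2 * pi) \<le> of_int n * (2 * pi)" by (intro mult_right_mono) auto
    with eq assms(2-) show False by linarith
  qed
  moreover have "- 1 < n"
  proof (rule ccontr)
    assume "\<not> - 1 < n"
    then have "of_int n * (2 * pi) \<le> (- 1) * (2 * pi)" by (intro mult_right_mono) auto
    with eq assms(2-) show False by linarith
  qed
  ultimately have "n = 0" by simp
  with n show ?thesis by (simp add: complex_eq_iff)
qed

lemma periodic_constant_derivative:
  fixes f :: "real \<Rightarrow> complex"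
  assumes d: "\<And>t. (f has_vector_derivative c) (at t)" and per: "\<And>t. f (t + 1) = f t"
  shows "c = 0" "f t = f 0"
proof -
  have "((\<lambda>s. f s - s *\<^sub>R c) has_derivative (\<lambda>h. 0)) (at t)" for t
    using has_vector_derivative_diff[OF d[of t] has_vector_derivative_scaleR[OF DERIV_ident has_vector_derivative_const], of c]
    by (simp add: has_vector_derivative_def)
  then obtain k where k: "\<And>t. f t - t *\<^sub>R c = k"
    using has_derivative_zero_constant[of UNIV "\<lambda>s. f s - s *\<^sub>R c"] by auto
  show "c = 0" using k[of 0] k[of 1] per[of 0] by simp
  then show "f t = f 0" using k[of 0] k[of t] by simp
qed

lemma periodic_exponential_ode:
  fixes f :: "real \<Rightarrow> complex"
  assumes d: "\<And>t. (f has_vector_derivative \<delta> * f t) (at t)" and per: "\<And>t. f (t + 1) = f t"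
    and \<delta>: "exp \<delta> \<noteq> 1"
  shows "f t = 0"
proof -
  have "((\<lambda>s. exp (- (of_real s * \<delta>)) * f s) has_vector_derivative 0) (at t)" for t
  proof -
    have "((\<lambda>z. exp (- (z * \<delta>))) has_field_derivative - \<delta> * exp (- (of_real t * \<delta>))) (at (of_real t))"
      by (auto intro!: derivative_eq_intros)
    then have "((\<lambda>s. exp (- (of_real s * \<delta>))) has_vector_derivative - \<delta> * exp (- (of_real t * \<delta>))) (at t)"
      by (rule has_vector_derivative_real_field)
    from has_vector_derivative_mult[OF this d[of t]] show ?thesis by (simp add: algebra_simps)
  qed
  then obtain k where k: "\<And>t. exp (- (of_real t * \<delta>)) * f t = k"
    using has_derivative_zero_constant[of UNIV "\<lambda>s. exp (- (of_real s * \<delta>)) * f s"]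
    by (auto simp: has_vector_derivative_def)
  have f: "f t = exp (of_real t * \<delta>) * k" for t
    using k[of t] by (simp add: exp_minus field_simps)
  have "exp \<delta> * k = k" using f[of 1] f[of 0] per[of 0] by simp
  then have "k = 0" using \<delta> by simp
  then show ?thesis by (simp add: f)
qed

text \<open>The equations for the pairings of a Jordan chain of length \<open>M\<close> with an adjoint chain of length
  \<open>M'\<close>, where \<open>\<delta>\<close> is the difference of the two eigenvalues.\<close>

locale pairing_system =
  fixes f :: "nat \<Rightarrow> nat \<Rightarrow> real \<Rightarrow> complex" and M M' :: nat and \<delta> :: complex
  assumes ode: "\<And>a m t. a < M \<Longrightarrow> m < M' \<Longrightarrow> (f a m has_vector_derivative
      \<delta> * f a m t - (if a = 0 then 0 else f (a - 1) m t) + (if m = 0 then 0 else f a (m - 1) t)) (at t)"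
    and periodic: "\<And>a m t. a < M \<Longrightarrow> m < M' \<Longrightarrow> f a m (t + 1) = f a m t"
begin

text \<open>By induction on \<open>a + m\<close> the inhomogeneous terms are zero, and a nonzero solution of \<open>f' = \<delta> f\<close> has period 1
  only if \<open>exp \<delta> = 1\<close>.\<close>

lemma pairing_vanishes:
  assumes "exp \<delta> \<noteq> 1" "a < M" "m < M'"
  shows "f a m t = 0"
  using assms(2,3)
proof (induction "a + m" arbitrary: a m t rule: less_induct)
  case less
  have a: "(if a = 0 then 0 else f (a - 1) m s) = 0" for s
    using less.hyps[of "a - 1" m s] less.prems by auto
  have m: "(if m = 0 then 0 else f a (m - 1) s) = 0" for s
    using less.hyps[of a "m - 1" s] less.prems by auto
  show ?case
    by (rule periodic_exponential_ode[where f="f a m", OF _ periodic[OF less.prems] assms(1)])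
       (use ode[OF less.prems] in \<open>simp only: a m diff_0_right add_0_right\<close>)
qed

text \<open>By induction on \<open>a + m\<close> the right-hand side is constant, hence zero since \<open>f\<close> is periodic. The second
  claim is this vanishing; it says that the pairings depend only on \<open>a + m\<close>.\<close>

lemma pairing_constant:
  assumes \<delta>: "\<delta> = 0" and "a < M" "m < M'"
  shows "f a m t = f a m 0"
    "(if a = 0 then 0 else f (a - 1) m t) = (if m = 0 then 0 else f a (m - 1) t)"
proof -
  have "(\<forall>t. f a m t = f a m 0) \<and> (\<forall>t. (if a = 0 then 0 else f (a - 1) m t) = (if m = 0 then 0 else f a (m - 1) t))"
    using assms(2,3)
  proof (induction "a + m" arbitrary: a m rule: less_induct)
    case less
    define c where "c = (if m = 0 then 0 else f a (m - 1) 0) - (if a = 0 then 0 else f (a - 1) m 0)"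
    have a: "(if a = 0 then 0 else f (a - 1) m s) = (if a = 0 then 0 else f (a - 1) m 0)" for s
    proof (cases "a = 0")
      case False
      then have "\<forall>t. f (a - 1) m t = f (a - 1) m 0"
        using less.prems by (intro conjunct1[OF less.hyps]) simp_all
      then show ?thesis using False by metis
    qed simp
    have m: "(if m = 0 then 0 else f a (m - 1) s) = (if m = 0 then 0 else f a (m - 1) 0)" for s
    proof (cases "m = 0")
      case False
      then have "\<forall>t. f a (m - 1) t = f a (m - 1) 0"
        using less.prems by (intro conjunct1[OF less.hyps]) simp_all
      then show ?thesis using False by metis
    qed simp
    have d: "(f a m has_vector_derivative c) (at t)" for t
    proof -
      have "\<delta> * f a m t - (if a = 0 then 0 else f (a - 1) m t) + (if m = 0 then 0 else f a (m - 1) t) = c"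
        unfolding a[of t] m[of t] c_def \<delta> by simp
      then show ?thesis using ode[OF less.prems, of t] by simp
    qed
    note p = periodic_constant_derivative[where f="f a m", OF d periodic[OF less.prems]]
    have z: "(if a = 0 then 0 else f (a - 1) m 0) = (if m = 0 then 0 else f a (m - 1) 0)"
      using p(1) unfolding c_def by simp
    show ?case
    proof (intro conjI allI)
      show "f a m t = f a m 0" for t by (rule p(2))
      show "(if a = 0 then 0 else f (a - 1) m t) = (if m = 0 then 0 else f a (m - 1) t)" for t
        unfolding a[of t] m[of t] by (rule z)
    qed
  qed
  then show "f a m t = f a m 0"
    "(if a = 0 then 0 else f (a - 1) m t) = (if m = 0 then 0 else f a (m - 1) t)" by blast+
qed

text \<open>Moving along the antidiagonal \<open>a + m = const\<close> leads either to the row \<open>M - 1\<close>, where the values are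
  prescribed, or to \<open>m = 0\<close>, beyond which the pairing is zero.\<close>

lemma pairing_normalized:
  assumes \<delta>: "\<delta> = 0" and a: "a < M" and m: "m < M'"
    and norm: "\<And>m. m < M' \<Longrightarrow> f (M - 1) m 0 = (if e \<and> m = 0 then 1 else 0)"
  shows "f (M - 1 - a) m t = (if e \<and> m = a then 1 else 0)"
  using a m
proof (induction a arbitrary: m)
  case 0
  then show ?case using pairing_constant(1)[OF \<delta>, of "M - 1" m t] norm[of m] by simp
next
  case (Suc a)
  have eq: "M - 1 - a - 1 = M - 1 - Suc a" "M - 1 - a \<noteq> 0" "M - 1 - a < M" using Suc.prems by auto
  have "f (M - 1 - Suc a) m t = (if m = 0 then 0 else f (M - 1 - a) (m - 1) t)"
    using pairing_constant(2)[OF \<delta> eq(3) Suc.prems(2), of t] eq(2) unfolding eq(1) by simp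
  then show ?case using Suc.IH[of "m - 1"] Suc.prems by auto
qed

end

section \<open>Algebra of the operator on locally Sobolev functions\<close>

lemma wc_rep_X_loc:
  assumes "u \<in> X_loc \<iota>"
  shows "continuous_on UNIV (wc_rep u)" "ae_eq (wc_rep u) u"
proof -
  obtain v where v: "has_weak_deriv UNIV u v" using assms unfolding X_loc_iff by blast
  obtain w where w: "primitive w v" "ae_eq w u" using has_weak_deriv_imp_primitive[OF v] .
  have "wc_rep u = w"
    by (rule wc_rep_eq[OF weakly_continuous_of_continuous[OF primitive_continuous[OF w(1)]] w(2)])
  then show "continuous_on UNIV (wc_rep u)" "ae_eq (wc_rep u) u"
    using w primitive_continuous[OF w(1)] by simp_all
qed

lemma X_loc_cong:
  assumes u: "u \<in> X_loc \<iota>" and eq: "ae_eq u u'"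
  shows "u' \<in> X_loc \<iota>"
proof -
  obtain v where v: "has_weak_deriv UNIV u v" "locally_L2 v" and U: "locally_L2 (\<lambda>t. inv \<iota> (u t))"
    and ran: "AE t in lebesgue. u t \<in> range \<iota>"
    using u unfolding X_loc_iff by blast
  have "AE t in lebesgue. u' t \<in> range \<iota>"
    using ran eq unfolding ae_eq_def by eventually_elim simp
  moreover have "ae_eq (\<lambda>t. inv \<iota> (u t)) (\<lambda>t. inv \<iota> (u' t))"
    using eq unfolding ae_eq_def by eventually_elim simp
  then have "locally_L2 (\<lambda>t. inv \<iota> (u' t))" by (rule locally_L2_cong[OF U])
  moreover have "has_weak_deriv UNIV u' v" by (rule has_weak_deriv_cong[OF v(1) eq ae_eq_refl])
  ultimately show ?thesis unfolding X_loc_iff using v(2) by blast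
qed

context periodic_evolution begin

lemma L_op_cong:
  assumes "u \<in> X_loc \<iota>" "ae_eq u u'"
  shows "ae_eq (L_op \<iota> A UNIV u) (L_op \<iota> A UNIV u')"
proof -
  obtain v where v: "has_weak_deriv UNIV u v" using assms(1) unfolding X_loc_iff by blast
  have v': "has_weak_deriv UNIV u' v" by (rule has_weak_deriv_cong[OF v assms(2) ae_eq_refl])
  show ?thesis
    using L_op_ae[OF v] L_op_ae[OF v'] assms(2) unfolding ae_eq_def by eventually_elim simp
qed

lemma X_loc_zero: "(\<lambda>_. 0) \<in> X_loc \<iota>" "ae_eq (L_op \<iota> A UNIV (\<lambda>_. 0)) (\<lambda>_. 0)"
proof -
  have z: "\<iota> 0 = 0" using \<iota>_linear by (simp add: linear_simps)
  have i: "inv \<iota> 0 = 0" using inv_\<iota>[of 0] z by simp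
  have d: "has_weak_deriv UNIV (\<lambda>_. 0 :: 'y) (\<lambda>_. 0)" by (rule primitive_has_weak_deriv[OF primitive_const])
  show "(\<lambda>_. 0) \<in> X_loc \<iota>"
    unfolding X_loc_iff using d z by (auto simp: i intro!: locally_L2_zero exI[of _ "\<lambda>_. 0"] range_eqI[of _ _ 0])
  show "ae_eq (L_op \<iota> A UNIV (\<lambda>_. 0)) (\<lambda>_. 0)"
    using L_op_ae[OF d] by (simp add: i blinfun.zero_right)
qed

lemma X_loc_add:
  assumes u: "u \<in> X_loc \<iota>" and w: "w \<in> X_loc \<iota>"
  shows "(\<lambda>t. u t + w t) \<in> X_loc \<iota>"
    "ae_eq (L_op \<iota> A UNIV (\<lambda>t. u t + w t)) (\<lambda>t. L_op \<iota> A UNIV u t + L_op \<iota> A UNIV w t)"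
proof -
  obtain v where v: "has_weak_deriv UNIV u v" "locally_L2 v" and U: "locally_L2 (\<lambda>t. inv \<iota> (u t))"
    and ru: "AE t in lebesgue. u t \<in> range \<iota>"
    using u unfolding X_loc_iff by blast
  obtain z where z: "has_weak_deriv UNIV w z" "locally_L2 z" and W: "locally_L2 (\<lambda>t. inv \<iota> (w t))"
    and rw: "AE t in lebesgue. w t \<in> range \<iota>"
    using w unfolding X_loc_iff by blast
  have sum: "AE t in lebesgue. u t + w t \<in> range \<iota> \<and> inv \<iota> (u t + w t) = inv \<iota> (u t) + inv \<iota> (w t)"
    using ru rw
  proof eventually_elim
    case (elim t)
    then obtain x y where xy: "u t = \<iota> x" "w t = \<iota> y" by blast
    then have "u t + w t = \<iota> (x + y)" using \<iota>_linear by (simp add: linear_simps)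
    then show ?case by (simp add: inv_\<iota> xy)
  qed
  note d = has_weak_deriv_add[OF v(1) z(1)]
  show "(\<lambda>t. u t + w t) \<in> X_loc \<iota>"
    unfolding X_loc_iff
  proof (intro conjI exI[of _ "\<lambda>t. v t + z t"] d locally_L2_add v z)
    show "AE t in lebesgue. u t + w t \<in> range \<iota>" using sum by eventually_elim simp
    have "ae_eq (\<lambda>t. inv \<iota> (u t) + inv \<iota> (w t)) (\<lambda>t. inv \<iota> (u t + w t))"
      using sum unfolding ae_eq_def by eventually_elim simp
    then show "locally_L2 (\<lambda>t. inv \<iota> (u t + w t))" by (rule locally_L2_cong[OF locally_L2_add[OF U W]])
  qed
  show "ae_eq (L_op \<iota> A UNIV (\<lambda>t. u t + w t)) (\<lambda>t. L_op \<iota> A UNIV u t + L_op \<iota> A UNIV w t)"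
    using L_op_ae[OF d] L_op_ae[OF v(1)] L_op_ae[OF z(1)] sum unfolding ae_eq_def
    by eventually_elim (simp add: blinfun.add_right)
qed

lemma X_loc_sum:
  assumes "finite I" "\<And>i. i \<in> I \<Longrightarrow> u i \<in> X_loc \<iota>" "\<And>i. i \<in> I \<Longrightarrow> ae_eq (L_op \<iota> A UNIV (u i)) (g i)"
  shows "(\<lambda>t. \<Sum>i\<in>I. u i t) \<in> X_loc \<iota> \<and> ae_eq (L_op \<iota> A UNIV (\<lambda>t. \<Sum>i\<in>I. u i t)) (\<lambda>t. \<Sum>i\<in>I. g i t)"
  using assms
proof (induction I rule: finite_induct)
  case empty
  then show ?case using X_loc_zero by simp
next
  case (insert i I)
  then have IH: "(\<lambda>t. \<Sum>i\<in>I. u i t) \<in> X_loc \<iota>"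
    "ae_eq (L_op \<iota> A UNIV (\<lambda>t. \<Sum>i\<in>I. u i t)) (\<lambda>t. \<Sum>i\<in>I. g i t)" by auto
  have ui: "u i \<in> X_loc \<iota>" "ae_eq (L_op \<iota> A UNIV (u i)) (g i)" using insert by auto
  have eq: "(\<lambda>t. \<Sum>i\<in>insert i I. u i t) = (\<lambda>t. u i t + (\<Sum>i\<in>I. u i t))"
    "(\<lambda>t. \<Sum>i\<in>insert i I. g i t) = (\<lambda>t. g i t + (\<Sum>i\<in>I. g i t))"
    using insert by simp_all
  have "ae_eq (L_op \<iota> A UNIV (\<lambda>t. u i t + (\<Sum>i\<in>I. u i t))) (\<lambda>t. g i t + (\<Sum>i\<in>I. g i t))"
    using X_loc_add(2)[OF ui(1) IH(1)] ui(2) IH(2) unfolding ae_eq_def by eventually_elim simp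
  then show ?case unfolding eq using X_loc_add(1)[OF ui(1) IH(1)] by blast
qed

text \<open>The product rule for \<open>D\<^sub>t\<close>, combined with the complex linearity of \<open>A t\<close>.\<close>

lemma X_loc_scaleC:
  fixes f f' :: "real \<Rightarrow> complex"
  assumes f: "has_weak_deriv UNIV f f'" "locally_L2 f'" and u: "u \<in> X_loc \<iota>"
  shows "(\<lambda>t. f t *\<^sub>C u t) \<in> X_loc \<iota>"
    "ae_eq (L_op \<iota> A UNIV (\<lambda>t. f t *\<^sub>C u t)) (\<lambda>t. f' t *\<^sub>C u t + f t *\<^sub>C L_op \<iota> A UNIV u t)"
proof -
  obtain v where v: "has_weak_deriv UNIV u v" "locally_L2 v" and U: "locally_L2 (\<lambda>t. inv \<iota> (u t))"
    and ru: "AE t in lebesgue. u t \<in> range \<iota>"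
    using u unfolding X_loc_iff by blast
  obtain f0 where f0: "primitive f0 f'" "ae_eq f0 f" using has_weak_deriv_imp_primitive[OF f(1)] .
  obtain u0 where u0: "primitive u0 v" "ae_eq u0 u" using has_weak_deriv_imp_primitive[OF v(1)] .
  note f0c = primitive_continuous[OF f0(1)] and u0c = primitive_continuous[OF u0(1)]
  have d: "has_weak_deriv UNIV (\<lambda>t. f t *\<^sub>C u t) (\<lambda>t. f' t *\<^sub>C u0 t + f0 t *\<^sub>C v t)"
  proof (rule has_weak_deriv_cong[OF primitive_has_weak_deriv[OF primitive_bilinear[OF bounded_bilinear_scaleC f0(1) u0(1)]]])
    show "ae_eq (\<lambda>t. f0 t *\<^sub>C u0 t) (\<lambda>t. f t *\<^sub>C u t)"
      using f0(2) u0(2) unfolding ae_eq_def by eventually_elim simp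
  qed simp
  have mult: "AE t in lebesgue. f t *\<^sub>C u t \<in> range \<iota> \<and> inv \<iota> (f t *\<^sub>C u t) = f t *\<^sub>C inv \<iota> (u t)"
    using ru
  proof eventually_elim
    case (elim t)
    then obtain x where x: "u t = \<iota> x" by blast
    then have "f t *\<^sub>C u t = \<iota> (f t *\<^sub>C x)" by (simp add: \<iota>_scaleC)
    then show ?case by (simp add: inv_\<iota> x)
  qed
  show "(\<lambda>t. f t *\<^sub>C u t) \<in> X_loc \<iota>"
    unfolding X_loc_iff
  proof (intro conjI exI[of _ "\<lambda>t. f' t *\<^sub>C u0 t + f0 t *\<^sub>C v t"] d)
    show "AE t in lebesgue. f t *\<^sub>C u t \<in> range \<iota>" using mult by eventually_elim simp
    have "locally_L2 (\<lambda>t. f0 t *\<^sub>C inv \<iota> (u t))"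
      by (rule locally_L2_bilinear_continuous[OF bounded_bilinear.flip[OF bounded_bilinear_scaleC] U f0c])
    moreover have "ae_eq (\<lambda>t. f0 t *\<^sub>C inv \<iota> (u t)) (\<lambda>t. inv \<iota> (f t *\<^sub>C u t))"
      using mult f0(2) unfolding ae_eq_def by eventually_elim simp
    ultimately show "locally_L2 (\<lambda>t. inv \<iota> (f t *\<^sub>C u t))" by (rule locally_L2_cong)
    show "locally_L2 (\<lambda>t. f' t *\<^sub>C u0 t + f0 t *\<^sub>C v t)"
      by (intro locally_L2_add locally_L2_bilinear_continuous[OF bounded_bilinear_scaleC f(2) u0c]
          locally_L2_bilinear_continuous[OF bounded_bilinear.flip[OF bounded_bilinear_scaleC] v(2) f0c])
  qed
  show "ae_eq (L_op \<iota> A UNIV (\<lambda>t. f t *\<^sub>C u t)) (\<lambda>t. f' t *\<^sub>C u t + f t *\<^sub>C L_op \<iota> A UNIV u t)"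
    using L_op_ae[OF d] L_op_ae[OF v(1)] mult f0(2) u0(2) unfolding ae_eq_def
    by eventually_elim (simp add: A_scaleC scaleC_add_right)
qed

lemma jordan_chain_X_loc:
  assumes w: "jordan_chain \<iota> A l M w" and a: "a < M"
  shows "wc_rep (w a) \<in> X_loc \<iota>"
proof -
  have "w a \<in> X_loc \<iota>" using w a by (auto simp: jordan_chain_def X_hat_def)
  then show ?thesis by (rule X_loc_cong) (rule ae_eq_sym[OF wc_rep_X_loc(2)[OF \<open>w a \<in> X_loc \<iota>\<close>]])
qed

lemma jordan_chain_L_op:
  assumes w: "jordan_chain \<iota> A l M w" and a: "a < M"
  shows "ae_eq (L_op \<iota> A UNIV (wc_rep (w a)))
    (\<lambda>t. - (l *\<^sub>C wc_rep (w a) t) - (if a = 0 then 0 else wc_rep (w (a - 1)) t))"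
proof -
  have wX: "w a \<in> X_loc \<iota>" if "a < M" for a
    using w that by (auto simp: jordan_chain_def X_hat_def)
  have a1: "a - 1 < M" using a by simp
  have pen: "ae_eq (pencil \<iota> A l (w a)) (\<lambda>t. if a = 0 then 0 else - w (a - 1) t)"
    using w a unfolding jordan_chain_def by blast
  show ?thesis
    using L_op_cong[OF jordan_chain_X_loc[OF w a] wc_rep_X_loc(2)[OF wX[OF a]]] pen
      wc_rep_X_loc(2)[OF wX[OF a]] wc_rep_X_loc(2)[OF wX[OF a1]]
    unfolding ae_eq_def
  proof eventually_elim
    case (elim t)
    then have "L_op \<iota> A UNIV (w a) t + l *\<^sub>C w a t = (if a = 0 then 0 else - w (a - 1) t)" by (simp add: pencil_def)
    then show ?case using elim by (auto simp: algebra_simps eq_neg_iff_add_eq_0)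
  qed
qed

end

section \<open>Coefficients and biorthogonality of the chains\<close>

text \<open>A Jordan chain of the adjoint pencil at \<open>l\<close>. The last assumption expresses that its members are
  essentially bounded with values in \<open>Y\<close>.\<close>

locale adjoint_chain = periodic_evolution \<iota> A
  for \<iota> :: "'x::{complex_hilbert,second_countable_topology} \<Rightarrow>
            'y::{complex_hilbert,second_countable_topology}"
    and A :: "real \<Rightarrow> 'x \<Rightarrow>\<^sub>L 'y" +
  fixes l :: complex and n :: nat and \<psi> :: "nat \<Rightarrow> real \<Rightarrow> 'y" and C :: real
  assumes \<psi>_Y_hat: "\<And>m. m < n \<Longrightarrow> \<psi> m \<in> Y_hat"
    and adjoint: "\<And>m u. m < n \<Longrightarrow> u \<in> X_hat \<iota> \<Longrightarrow> Y_hat_inner (pencil \<iota> A l u) (\<psi> m) =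
        (if m = 0 then 0 else - Y_hat_inner u (\<psi> (m - 1)))"
    and bounded: "\<And>m. m < n \<Longrightarrow> AE t in lebesgue. \<forall>y. cmod (cinner y (\<psi> m t)) \<le> C * norm y"
begin

lemma \<psi>_weak_deriv:
  assumes u: "u \<in> X_loc \<iota>" and m: "m < n"
  shows "has_weak_deriv UNIV (\<lambda>t. cinner (u t) (\<psi> m t)) (\<lambda>t. cinner (L_op \<iota> A UNIV u t) (\<psi> m t)
     + l * cinner (u t) (\<psi> m t) + (if m = 0 then 0 else cinner (u t) (\<psi> (m - 1) t)))"
proof -
  define \<theta> where "\<theta> = (if m = 0 then (\<lambda>_. 0) else \<psi> (m - 1))"
  have "(\<lambda>_. 0 :: 'y) \<in> Y_hat" by (simp add: Y_hat_def Y_loc_iff locally_L2_zero)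
  then have \<theta>: "\<theta> \<in> Y_hat" using \<psi>_Y_hat m by (simp add: \<theta>_def)
  have "has_weak_deriv UNIV (\<lambda>t. cinner (u t) (\<psi> m t))
      (\<lambda>t. cinner (L_op \<iota> A UNIV u t + l *\<^sub>C u t) (\<psi> m t) + cinner (u t) (\<theta> t))"
  proof (rule has_weak_deriv_cinner[OF u \<psi>_Y_hat[OF m] \<theta>])
    fix w assume "w \<in> X_hat \<iota>"
    from adjoint[OF m this] show "Y_hat_inner (pencil \<iota> A l w) (\<psi> m) = - Y_hat_inner w \<theta>"
      by (simp add: \<theta>_def Y_hat_inner_def cinner.zero_right)
  qed
  moreover have "(\<lambda>t. cinner (L_op \<iota> A UNIV u t + l *\<^sub>C u t) (\<psi> m t) + cinner (u t) (\<theta> t))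
      = (\<lambda>t. cinner (L_op \<iota> A UNIV u t) (\<psi> m t) + l * cinner (u t) (\<psi> m t)
          + (if m = 0 then 0 else cinner (u t) (\<psi> (m - 1) t)))"
    by (intro ext) (simp add: \<theta>_def cinner.zero_right cinner_add_left cinner_scaleC_left)
  ultimately show ?thesis by simp
qed

lemma \<psi>_norm:
  assumes m: "m < n"
  shows "AE t in lebesgue. norm (\<psi> m t) \<le> \<bar>C\<bar>"
  using bounded[OF m]
proof eventually_elim
  case (elim t)
  have "norm (\<psi> m t) * norm (\<psi> m t) = Re (cinner (\<psi> m t) (\<psi> m t))"
    by (simp add: inner_eq_Re_cinner[symmetric] power2_norm_eq_inner[symmetric] power2_eq_square)
  also have "\<dots> \<le> C * norm (\<psi> m t)" using elim[rule_format, of "\<psi> m t"] complex_Re_le_cmod order_trans by blast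
  also have "\<dots> \<le> \<bar>C\<bar> * norm (\<psi> m t)" by (intro mult_right_mono) auto
  finally show ?case by (cases "norm (\<psi> m t) = 0") auto
qed

text \<open>For constant \<open>d\<close> in \<open>X\<close> the coefficient \<open>(d, \<psi> m)\<close> is weakly differentiable and therefore has a
  continuous representative.\<close>

lemma wc_rep_\<psi>:
  assumes m: "m < n"
  shows "weakly_continuous (wc_rep (\<psi> m))" "ae_eq (wc_rep (\<psi> m)) (\<psi> m)" "norm (wc_rep (\<psi> m) t) \<le> 2 * \<bar>C\<bar>"
proof -
  have rep: "\<exists>c. continuous_on UNIV c \<and> ae_eq c (\<lambda>t. cinner d (\<psi> m t))" if "d \<in> range \<iota>" for d
  proof -
    have "(\<lambda>_. d) \<in> X_loc \<iota>"
      unfolding X_loc_iff using that primitive_has_weak_deriv[OF primitive_const[of d]]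
      by (auto intro!: locally_L2_continuous exI[of _ "\<lambda>_. 0"])
    note d = \<psi>_weak_deriv[OF this m]
    obtain c where "primitive c (\<lambda>t. cinner (L_op \<iota> A UNIV (\<lambda>_. d) t) (\<psi> m t)
       + l * cinner d (\<psi> m t) + (if m = 0 then 0 else cinner d (\<psi> (m - 1) t)))"
      "ae_eq c (\<lambda>t. cinner d (\<psi> m t))"
      by (rule has_weak_deriv_imp_primitive[OF d])
    then show ?thesis using primitive_continuous by blast
  qed
  have "\<exists>h. weakly_continuous h \<and> ae_eq h (\<psi> m) \<and> (\<forall>t. norm (h t) \<le> 2 * \<bar>C\<bar>)"
    by (rule weakly_continuous_representative[OF \<psi>_norm[OF m] \<iota>_dense]) (use rep in blast)+
  then obtain h where h: "weakly_continuous h" "ae_eq h (\<psi> m)" "\<And>t. norm (h t) \<le> 2 * \<bar>C\<bar>"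
    by blast
  have "wc_rep (\<psi> m) = h" by (rule wc_rep_eq[OF h(1,2)])
  then show "weakly_continuous (wc_rep (\<psi> m))" "ae_eq (wc_rep (\<psi> m)) (\<psi> m)" "norm (wc_rep (\<psi> m) t) \<le> 2 * \<bar>C\<bar>"
    using h by simp_all
qed

lemma coef_locally_L2:
  assumes u: "locally_L2 u" and m: "m < n"
  shows "locally_L2 (coef (\<psi> m) u)"
  unfolding coef_def[abs_def]
proof (rule locally_L2_bilinear_bounded[OF bounded_bilinear_cinner u])
  have "locally_L2 (\<psi> m)" using \<psi>_Y_hat[OF m] by (simp add: Y_hat_def Y_loc_iff)
  from locally_L2_cong[OF this ae_eq_sym[OF wc_rep_\<psi>(2)[OF m]]]
  show "wc_rep (\<psi> m) \<in> borel_measurable lebesgue" by (rule locally_L2_measurable)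
  show "\<exists>C. AE t in lebesgue. t \<in> {a..b} \<longrightarrow> norm (wc_rep (\<psi> m) t) \<le> C" for a b
    using wc_rep_\<psi>(3)[OF m] by (intro exI[of _ "2 * \<bar>C\<bar>"] AE_I2) simp
qed

text \<open>The right-hand side of the differential equation for the coefficients.\<close>

definition coef_deriv :: "nat \<Rightarrow> (real \<Rightarrow> 'y) \<Rightarrow> real \<Rightarrow> complex" where
  "coef_deriv m u t = coef (\<psi> m) (L_op \<iota> A UNIV u) t + l * coef (\<psi> m) u t
     + (if m = 0 then 0 else coef (\<psi> (m - 1)) u t)"

lemma coef_has_weak_deriv:
  assumes u: "u \<in> X_loc \<iota>" and m: "m < n"
  shows "has_weak_deriv UNIV (coef (\<psi> m) u) (coef_deriv m u)"
proof (rule has_weak_deriv_cong[OF \<psi>_weak_deriv[OF u m]])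
  show "ae_eq (\<lambda>t. cinner (u t) (\<psi> m t)) (coef (\<psi> m) u)"
    using wc_rep_\<psi>(2)[OF m] unfolding ae_eq_def by eventually_elim (simp add: coef_def)
  have "m - 1 < n" using m by simp
  show "ae_eq (\<lambda>t. cinner (L_op \<iota> A UNIV u t) (\<psi> m t) + l * cinner (u t) (\<psi> m t)
      + (if m = 0 then 0 else cinner (u t) (\<psi> (m - 1) t))) (coef_deriv m u)"
    using wc_rep_\<psi>(2)[OF m] wc_rep_\<psi>(2)[OF \<open>m - 1 < n\<close>] unfolding ae_eq_def
    by eventually_elim (simp add: coef_def coef_deriv_def)
qed

lemma coef_deriv_locally_L2:
  assumes u: "u \<in> X_loc \<iota>" and m: "m < n"
  shows "locally_L2 (coef_deriv m u)"
proof -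
  obtain v where v: "has_weak_deriv UNIV u v" using u unfolding X_loc_iff by blast
  have uL: "locally_L2 u" by (rule has_weak_deriv_locally_L2[OF v])
  have "locally_L2 (\<lambda>t. l * coef (\<psi> m) u t)"
    by (rule locally_L2_bilinear_continuous[OF bounded_bilinear.flip[OF bounded_bilinear_mult] coef_locally_L2[OF uL m] continuous_on_const])
  moreover have "locally_L2 (\<lambda>t. if m = 0 then 0 else coef (\<psi> (m - 1)) u t)"
    using coef_locally_L2[OF uL, of "m - 1"] m by (cases m) (simp_all add: locally_L2_zero)
  ultimately show ?thesis
    unfolding coef_deriv_def[abs_def]
    by (intro locally_L2_add coef_locally_L2[OF locally_L2_L_op[OF u] m])
qed

text \<open>The equation for the coefficients, with the representative of \<open>w a\<close> in the place of \<open>u\<close>. All terms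
  are continuous, so the equation holds classically.\<close>

lemma chain_pairing_system:
  assumes w: "jordan_chain \<iota> A l' M w"
  shows "pairing_system (\<lambda>a m t. cinner (wc_rep (w a) t) (wc_rep (\<psi> m) t)) M n (l - l')"
proof
  define f where "f a m t = cinner (wc_rep (w a) t) (wc_rep (\<psi> m) t)" for a m t
  have wX: "w a \<in> X_hat \<iota>" "w a \<in> X_loc \<iota>" if "a < M" for a
    using w that by (auto simp: jordan_chain_def X_hat_def)
  have fc: "continuous_on UNIV (f a m)" if "a < M" "m < n" for a m
    unfolding f_def[abs_def]
    by (rule continuous_cinner_weak[OF wc_rep_X_loc(1)[OF wX(2)[OF that(1)]] wc_rep_\<psi>(1,3)[OF that(2)]])
  fix a m t assume a: "a < M" and m: "m < n"
  have "f a m (t + 1) = f a m t"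
  proof (rule continuous_ae_eq_imp_eq[of "\<lambda>t. f a m (t + 1)"])
    show "continuous_on UNIV (\<lambda>t. f a m (t + 1))"
      by (rule continuous_on_compose2[OF fc[OF a m]]) (auto intro!: continuous_intros)
    have "ae_eq (\<lambda>t. w a (t + 1)) (w a)" "ae_eq (\<lambda>t. \<psi> m (t + 1)) (\<psi> m)"
      using wX(1)[OF a] \<psi>_Y_hat[OF m] by (auto simp: X_hat_def Y_hat_def)
    then show "ae_eq (\<lambda>t. f a m (t + 1)) (f a m)"
      using wc_rep_X_loc(2)[OF wX(2)[OF a]] wc_rep_\<psi>(2)[OF m]
        AE_shift[OF wc_rep_X_loc(2)[OF wX(2)[OF a], unfolded ae_eq_def], of 1]
        AE_shift[OF wc_rep_\<psi>(2)[OF m, unfolded ae_eq_def], of 1]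
      unfolding ae_eq_def by eventually_elim (simp add: f_def add.commute)
  qed (rule fc[OF a m])
  then show "cinner (wc_rep (w a) (t + 1)) (wc_rep (\<psi> m) (t + 1)) = cinner (wc_rep (w a) t) (wc_rep (\<psi> m) t)"
    by (simp add: f_def)
  define g where "g t = (l - l') * f a m t - (if a = 0 then 0 else f (a - 1) m t) + (if m = 0 then 0 else f a (m - 1) t)" for t
  have gc: "continuous_on UNIV g"
    unfolding g_def[abs_def] using a m by (cases "a = 0"; cases "m = 0") (auto intro!: continuous_intros fc)
  note wr = jordan_chain_X_loc[OF w a] and Lw = jordan_chain_L_op[OF w a]
  have "has_weak_deriv UNIV (f a m) g"
  proof (rule has_weak_deriv_cong[OF coef_has_weak_deriv[OF wr m]])
    show "ae_eq (coef (\<psi> m) (wc_rep (w a))) (f a m)" by (simp add: ae_eq_def coef_def f_def)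
    show "ae_eq (coef_deriv m (wc_rep (w a))) g"
      using Lw unfolding ae_eq_def
    proof eventually_elim
      case (elim t)
      show ?case
        unfolding coef_deriv_def coef_def elim g_def f_def
        by (simp add: cinner.diff_left cinner.minus_left cinner_scaleC_left cinner.zero_left algebra_simps)
    qed
  qed
  from has_vector_derivative_of_weak[OF this fc[OF a m] gc, of t]
  show "((\<lambda>t. cinner (wc_rep (w a) t) (wc_rep (\<psi> m) t)) has_vector_derivative
      (l - l') * cinner (wc_rep (w a) t) (wc_rep (\<psi> m) t)
      - (if a = 0 then 0 else cinner (wc_rep (w (a - 1)) t) (wc_rep (\<psi> m) t))
      + (if m = 0 then 0 else cinner (wc_rep (w a) t) (wc_rep (\<psi> (m - 1)) t))) (at t)"
    by (simp only: f_def[abs_def] g_def)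
qed

lemma pairing_distinct:
  assumes w: "jordan_chain \<iota> A l' M w" and l: "exp (l - l') \<noteq> 1" and "a < M" "m < n"
  shows "cinner (wc_rep (w a) t) (wc_rep (\<psi> m) t) = 0"
  by (rule pairing_system.pairing_vanishes[OF chain_pairing_system[OF w] l assms(3,4)])

text \<open>The pairing of the last member of the chain is constant in \<open>t\<close>, so its value is the integral over
  the unit interval, which the normalization prescribes.\<close>

lemma pairing_same:
  assumes w: "jordan_chain \<iota> A l M w"
    and norm: "\<And>m. m < n \<Longrightarrow> Y_hat_inner (w (M - 1)) (\<psi> m) = (if e \<and> m = 0 then 1 else 0)"
    and a: "a < M" and m: "m < n"
  shows "cinner (wc_rep (w (M - 1 - a)) t) (wc_rep (\<psi> m) t) = (if e \<and> m = a then 1 else 0)"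
proof (rule pairing_system.pairing_normalized[OF chain_pairing_system[OF w] _ a m])
  show "l - l = 0" by simp
  fix m assume m: "m < n"
  have M: "M - 1 < M" using a by simp
  have wX: "w (M - 1) \<in> X_loc \<iota>" using w M by (auto simp: jordan_chain_def X_hat_def)
  define c where "c = cinner (wc_rep (w (M - 1)) 0) (wc_rep (\<psi> m) 0)"
  have const: "cinner (wc_rep (w (M - 1)) t) (wc_rep (\<psi> m) t) = c" for t
    unfolding c_def by (rule pairing_system.pairing_constant(1)[OF chain_pairing_system[OF w] _ M m]) simp
  have "Y_hat_inner (w (M - 1)) (\<psi> m) = (LINT t:{0<..<1::real}|lebesgue. c)"
    unfolding Y_hat_inner_def
  proof (rule set_integral_AE_eq)
    show "AE t in lebesgue. t \<in> {0<..<1} \<longrightarrow> cinner (w (M - 1) t) (\<psi> m t) = c"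
      using wc_rep_X_loc(2)[OF wX] wc_rep_\<psi>(2)[OF m] unfolding ae_eq_def
      by eventually_elim (use const in metis)
  qed
  also have "\<dots> = c" by (simp add: set_integral_const)
  finally show "cinner (wc_rep (w (M - 1)) 0) (wc_rep (\<psi> m) 0) = (if e \<and> m = 0 then 1 else 0)"
    using norm[OF m] by (simp add: c_def)
qed

end

section \<open>The projector and its commutation with the operator\<close>

lemma nested_sum_Sigma:
  fixes h :: "nat \<Rightarrow> nat \<Rightarrow> nat \<Rightarrow> 'a::comm_monoid_add"
  shows "(\<Sum>k=1..N. \<Sum>j=1..J k. \<Sum>m<\<mu> k j. h k j m)
    = (\<Sum>(k, j, m)\<in>(SIGMA k:{1..N}. SIGMA j:{1..J k}. {..<\<mu> k j}). h k j m)"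
  by (simp add: sum.Sigma)

lemma bounded_clinear_rank_one: "bounded_clinear (\<lambda>y. cinner y z *\<^sub>C w)"
  unfolding bounded_clinear_def
  by (auto simp: cinner_scaleC_left scaleC_scaleC
      intro!: bounded_linear_compose[OF scaleC.bounded_linear_left cinner.bounded_linear_left])

lemma bounded_clinear_sum:
  assumes "\<And>i. i \<in> I \<Longrightarrow> bounded_clinear (T i)"
  shows "bounded_clinear (\<lambda>y. \<Sum>i\<in>I. T i y)"
  using assms unfolding bounded_clinear_def
  by (auto intro!: bounded_linear_sum simp: scaleC.sum_right)

lemma projector_biorthogonal_sum:
  fixes v w :: "'i \<Rightarrow> 'a::complex_hilbert"
  assumes I: "finite I" and orth: "\<And>i i'. i \<in> I \<Longrightarrow> i' \<in> I \<Longrightarrow> cinner (v i) (w i') = (if i = i' then 1 else 0)"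
  shows "projector (\<lambda>y. \<Sum>i\<in>I. cinner y (w i) *\<^sub>C v i)"
  unfolding projector_def
proof (intro conjI allI)
  show "bounded_clinear (\<lambda>y. \<Sum>i\<in>I. cinner y (w i) *\<^sub>C v i)"
    by (intro bounded_clinear_sum bounded_clinear_rank_one)
  fix y
  have "cinner (\<Sum>i\<in>I. cinner y (w i) *\<^sub>C v i) (w i') = cinner y (w i')" if "i' \<in> I" for i'
  proof -
    have "cinner (\<Sum>i\<in>I. cinner y (w i) *\<^sub>C v i) (w i') = (\<Sum>i\<in>I. cinner y (w i) * cinner (v i) (w i'))"
      by (simp add: cinner.sum_left cinner_scaleC_left)
    also have "\<dots> = (\<Sum>i\<in>I. if i = i' then cinner y (w i) else 0)"
      using that by (intro sum.cong) (auto simp: orth)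
    also have "\<dots> = cinner y (w i')" using I that by simp
    finally show ?thesis .
  qed
  then show "(\<Sum>i\<in>I. cinner (\<Sum>i\<in>I. cinner y (w i) *\<^sub>C v i) (w i) *\<^sub>C v i) = (\<Sum>i\<in>I. cinner y (w i) *\<^sub>C v i)"
    by (intro sum.cong) auto
qed

text \<open>The substitution \<open>m \<mapsto> m + 1\<close>; the last member of the sum on the left and the first one on the right
  are zero.\<close>

lemma chain_shift_sum:
  fixes f :: "nat \<Rightarrow> complex" and \<Phi> :: "nat \<Rightarrow> 'a::complex_hilbert"
  shows "(\<Sum>m<M. f m *\<^sub>C (if M - 1 - m = 0 then 0 else \<Phi> (M - 1 - m - 1)))
       = (\<Sum>m<M. (if m = 0 then 0 else f (m - 1)) *\<^sub>C \<Phi> (M - 1 - m))"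
proof (cases M)
  case (Suc p)
  have "(\<Sum>m<M. f m *\<^sub>C (if M - 1 - m = 0 then 0 else \<Phi> (M - 1 - m - 1)))
      = (\<Sum>m<p. f m *\<^sub>C (if p - m = 0 then 0 else \<Phi> (p - m - 1)))"
    by (simp add: Suc scaleC.zero_right)
  also have "\<dots> = (\<Sum>m<p. f m *\<^sub>C \<Phi> (p - Suc m))" by (rule sum.cong) auto
  also have "\<dots> = (\<Sum>m<M. (if m = 0 then 0 else f (m - 1)) *\<^sub>C \<Phi> (M - 1 - m))"
    unfolding Suc sum.lessThan_Suc_shift by (simp add: scaleC.zero_left)
  finally show ?thesis .
qed simp

theorem theorem5p1:
  fixes \<iota> :: "'x::{complex_hilbert,second_countable_topology} \<Rightarrow>
              'y::{complex_hilbert,second_countable_topology}"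
    and A :: "real \<Rightarrow> 'x \<Rightarrow>\<^sub>L 'y"
    and \<beta>1 \<beta>2 :: real
    and N :: nat and lam :: "nat \<Rightarrow> complex"
    and J :: "nat \<Rightarrow> nat" and \<mu> :: "nat \<Rightarrow> nat \<Rightarrow> nat"
    and \<phi> \<psi> :: "nat \<Rightarrow> nat \<Rightarrow> nat \<Rightarrow> real \<Rightarrow> 'y"
  assumes embedding: "compact_dense_embedding \<iota>"
    and A_clinear: "\<forall>t. bounded_clinear (blinfun_apply (A t))"
    and A_periodic: "\<forall>t. A (t + 1) = A t"
    and A_continuous: "continuous_on UNIV A"
    and estimate: "local_estimate \<iota> A"
    and isomorphism: "\<exists>l0. pencil_isomorphism \<iota> A l0"
    and beta: "\<beta>1 < \<beta>2"
    and no_eigenvalues: "\<forall>l \<in> delta_line \<beta>1 \<union> delta_line \<beta>2. \<not> pencil_eigenvalue \<iota> A l"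
    and lam_distinct: "inj_on lam {1..N}"
    and lam_eigenvalues: "lam ` {1..N} = {l \<in> Q_strip \<beta>1 \<beta>2. pencil_eigenvalue \<iota> A l}"
    and phi: "\<forall>k\<in>{1..N}. canonical_system \<iota> A (lam k) (J k) (\<mu> k) (\<phi> k)"
    and psi: "\<forall>k\<in>{1..N}. adjoint_chains \<iota> A (lam k) (J k) (\<mu> k) (\<psi> k)"
    and normalization: "\<forall>k\<in>{1..N}. biorthonormal (J k) (\<mu> k) (\<phi> k) (\<psi> k)"
    and P_well_defined: "\<exists>C. \<forall>k\<in>{1..N}. \<forall>j\<in>{1..J k}. \<forall>m<\<mu> k j.
          AE t in lebesgue. \<forall>y. cmod (cinner y (\<psi> k j m t)) \<le> C * norm y"
  shows "(\<forall>t. projector (P_at N J \<mu> \<phi> \<psi> t)) \<and>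
    (\<forall>u \<in> X_loc \<iota>. P_op N J \<mu> \<phi> \<psi> u \<in> X_loc \<iota> \<and>
       ae_eq (L_op \<iota> A UNIV (P_op N J \<mu> \<phi> \<psi> u)) (P_op N J \<mu> \<phi> \<psi> (L_op \<iota> A UNIV u))) \<and>
    (\<forall>u \<in> X_loc \<iota>.
       (\<forall>k\<in>{1..N}. \<forall>j\<in>{1..J k}. \<forall>m<\<mu> k j. weakly_differentiable_on (coef (\<psi> k j m) u) UNIV) \<and>
       ae_eq (L_op \<iota> A UNIV (P_op N J \<mu> \<phi> \<psi> u))
         (\<lambda>t. \<Sum>k=1..N. \<Sum>j=1..J k. \<Sum>m<\<mu> k j.
            (Dt UNIV (coef (\<psi> k j m) u) t - lam k * coef (\<psi> k j m) u t
              - (if m = 0 then 0 else coef (\<psi> k j (m - 1)) u t))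
            *\<^sub>C wc_rep (\<phi> k j (\<mu> k j - 1 - m)) t))"
proof -
  interpret periodic_evolution \<iota> A
    by unfold_locales (use embedding A_clinear A_periodic A_continuous in auto)
  obtain C where C: "\<And>k j m. k \<in> {1..N} \<Longrightarrow> j \<in> {1..J k} \<Longrightarrow> m < \<mu> k j \<Longrightarrow>
      AE t in lebesgue. \<forall>y. cmod (cinner y (\<psi> k j m t)) \<le> C * norm y"
    using P_well_defined by blast
  have chain: "adjoint_chain \<iota> A (lam k) (\<mu> k j) (\<psi> k j) C" if "k \<in> {1..N}" "j \<in> {1..J k}" for k j
    by unfold_locales (use psi that C in \<open>auto simp: adjoint_chains_def\<close>)
  have jordan: "jordan_chain \<iota> A (lam k) (\<mu> k j) (\<phi> k j)" if "k \<in> {1..N}" "j \<in> {1..J k}" for k j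
    using phi that unfolding canonical_system_def by blast
  \<comment> \<open>Flattening the triple sum exhibits the operator as one sum over a biorthogonal system.\<close>
  define I where "I = (SIGMA k:{1..N}. SIGMA j:{1..J k}. {..<\<mu> k j})"
  define \<Phi> where "\<Phi> = (\<lambda>(k, j, m). wc_rep (\<phi> k j (\<mu> k j - 1 - m)))"
  define \<Psi> where "\<Psi> = (\<lambda>(k, j, m). wc_rep (\<psi> k j m))"
  have finI: "finite I" unfolding I_def by auto
  have P_op: "P_op N J \<mu> \<phi> \<psi> u = (\<lambda>t. \<Sum>(k, j, m)\<in>I. coef (\<psi> k j m) u t *\<^sub>C wc_rep (\<phi> k j (\<mu> k j - 1 - m)) t)" for u
    by (intro ext) (simp only: P_op_def nested_sum_Sigma I_def)

  have orth: "cinner (\<Phi> i t) (\<Psi> i' t) = (if i = i' then 1 else 0)" if "i \<in> I" "i' \<in> I" for i i' t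
  proof -
    obtain k j a where i: "i = (k, j, a)" "k \<in> {1..N}" "j \<in> {1..J k}" "a < \<mu> k j"
      using \<open>i \<in> I\<close> unfolding I_def by blast
    obtain k' j' m where i': "i' = (k', j', m)" "k' \<in> {1..N}" "j' \<in> {1..J k'}" "m < \<mu> k' j'"
      using \<open>i' \<in> I\<close> unfolding I_def by blast
    note chain' = chain[OF i'(2,3)] and jordan' = jordan[OF i(2,3)]
    show ?thesis
    proof (cases "k = k'")
      case True
      have "cinner (wc_rep (\<phi> k j (\<mu> k j - 1 - a)) t) (wc_rep (\<psi> k' j' m) t) = (if j = j' \<and> m = a then 1 else 0)"
      proof (rule adjoint_chain.pairing_same[OF chain' _ _ i(4) i'(4)])
        show "jordan_chain \<iota> A (lam k') (\<mu> k j) (\<phi> k j)" using jordan' True by simp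
        show "Y_hat_inner (\<phi> k j (\<mu> k j - 1)) (\<psi> k' j' m) = (if j = j' \<and> m = 0 then 1 else 0)"
          if "m < \<mu> k' j'" for m
          using normalization i(2,3) i'(3) that unfolding biorthonormal_def True by blast
      qed
      then show ?thesis using True by (auto simp: i(1) i'(1) \<Phi>_def \<Psi>_def)
    next
      case False
      have "lam k \<in> Q_strip \<beta>1 \<beta>2" "lam k' \<in> Q_strip \<beta>1 \<beta>2" using lam_eigenvalues i(2) i'(2) by blast+
      then have "lam k' = lam k" if "exp (lam k' - lam k) = 1"
        using exp_eq_1_strip[OF that] by (simp add: Q_strip_def)
      then have "exp (lam k' - lam k) \<noteq> 1"
        using False inj_onD[OF lam_distinct _ i'(2) i(2)] by blast
      then have "cinner (wc_rep (\<phi> k j (\<mu> k j - 1 - a)) t) (wc_rep (\<psi> k' j' m) t) = 0"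
        using i(4) by (intro adjoint_chain.pairing_distinct[OF chain' jordan' _ _ i'(4)]) auto
      then show ?thesis using False by (simp add: i(1) i'(1) \<Phi>_def \<Psi>_def)
    qed
  qed
  have proj: "projector (P_at N J \<mu> \<phi> \<psi> t)" for t
  proof -
    have "P_at N J \<mu> \<phi> \<psi> t = (\<lambda>y. \<Sum>i\<in>I. cinner y (\<Psi> i t) *\<^sub>C \<Phi> i t)"
      by (intro ext) (simp add: P_at_def P_op coef_def \<Phi>_def \<Psi>_def split_def)
    then show ?thesis using projector_biorthogonal_sum[OF finI orth] by simp
  qed

  have main: "P_op N J \<mu> \<phi> \<psi> u \<in> X_loc \<iota>"
    "ae_eq (L_op \<iota> A UNIV (P_op N J \<mu> \<phi> \<psi> u)) (P_op N J \<mu> \<phi> \<psi> (L_op \<iota> A UNIV u))" if u: "u \<in> X_loc \<iota>" for u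
  proof -
    \<comment> \<open>The summands of the operator, and what \<open>L\<close> makes of each of them by the product rule.\<close>
    define T where "T = (\<lambda>(k, j, m) t. coef (\<psi> k j m) u t *\<^sub>C wc_rep (\<phi> k j (\<mu> k j - 1 - m)) t)"
    define g where "g = (\<lambda>(k, j, m) t. adjoint_chain.coef_deriv \<iota> A (lam k) (\<psi> k j) m u t *\<^sub>C wc_rep (\<phi> k j (\<mu> k j - 1 - m)) t
       + coef (\<psi> k j m) u t *\<^sub>C (- (lam k *\<^sub>C wc_rep (\<phi> k j (\<mu> k j - 1 - m)) t)
           - (if \<mu> k j - 1 - m = 0 then 0 else wc_rep (\<phi> k j (\<mu> k j - 1 - m - 1)) t)))"
    have T: "T i \<in> X_loc \<iota> \<and> ae_eq (L_op \<iota> A UNIV (T i)) (g i)" if "i \<in> I" for i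
    proof -
      obtain k j m where i: "i = (k, j, m)" "k \<in> {1..N}" "j \<in> {1..J k}" "m < \<mu> k j"
        using \<open>i \<in> I\<close> unfolding I_def by blast
      interpret adjoint_chain \<iota> A "lam k" "\<mu> k j" "\<psi> k j" C by (rule chain[OF i(2,3)])
      let ?r = "\<mu> k j - 1 - m"
      have r: "?r < \<mu> k j" using i(4) by simp
      note \<phi> = jordan_chain_X_loc[OF jordan[OF i(2,3)] r] and L = jordan_chain_L_op[OF jordan[OF i(2,3)] r]
      note s = X_loc_scaleC[OF coef_has_weak_deriv[OF u i(4)] coef_deriv_locally_L2[OF u i(4)] \<phi>]
      have "ae_eq (L_op \<iota> A UNIV (T i)) (g i)"
        using s(2) L unfolding ae_eq_def by eventually_elim (simp add: T_def g_def i(1))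
      then show ?thesis using s(1) by (simp add: T_def i(1))
    qed
    have eqT: "P_op N J \<mu> \<phi> \<psi> u = (\<lambda>t. \<Sum>i\<in>I. T i t)"
      unfolding P_op T_def by (intro ext sum.cong) auto
    note S = X_loc_sum[OF finI, of T g]
    show "P_op N J \<mu> \<phi> \<psi> u \<in> X_loc \<iota>" unfolding eqT using S T by blast
    have "(\<lambda>t. \<Sum>i\<in>I. g i t) = P_op N J \<mu> \<phi> \<psi> (L_op \<iota> A UNIV u)"
    proof
      fix t
      have "(\<Sum>i\<in>I. g i t) = (\<Sum>k=1..N. \<Sum>j=1..J k. \<Sum>m<\<mu> k j. g (k, j, m) t)"
        unfolding nested_sum_Sigma I_def by (intro sum.cong) auto
      also have "\<dots> = P_op N J \<mu> \<phi> \<psi> (L_op \<iota> A UNIV u) t"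
        unfolding P_op_def
      proof (rule sum.cong[OF refl], rule sum.cong[OF refl])
        fix k j assume k: "k \<in> {1..N}" and j: "j \<in> {1..J k}"
        interpret adjoint_chain \<iota> A "lam k" "\<mu> k j" "\<psi> k j" C by (rule chain[OF k j])
        let ?\<Phi> = "\<lambda>r. wc_rep (\<phi> k j r) t" and ?c = "\<lambda>m. coef (\<psi> k j m) u t" and ?M = "\<mu> k j"
        have "(\<Sum>m<?M. g (k, j, m) t)
            = (\<Sum>m<?M. (coef_deriv m u t - lam k * ?c m) *\<^sub>C ?\<Phi> (?M - 1 - m))
              - (\<Sum>m<?M. ?c m *\<^sub>C (if ?M - 1 - m = 0 then 0 else ?\<Phi> (?M - 1 - m - 1)))"
          unfolding sum_subtractf[symmetric]
          by (intro sum.cong refl)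
            (simp add: g_def scaleC.diff_right scaleC.diff_left scaleC.minus_right scaleC_scaleC mult.commute[of "lam k"])
        also have "\<dots> = (\<Sum>m<?M. (coef_deriv m u t - lam k * ?c m - (if m = 0 then 0 else ?c (m - 1))) *\<^sub>C ?\<Phi> (?M - 1 - m))"
          unfolding chain_shift_sum[of ?c ?M ?\<Phi>] by (simp add: scaleC.diff_left sum_subtractf)
        also have "\<dots> = (\<Sum>m<?M. coef (\<psi> k j m) (L_op \<iota> A UNIV u) t *\<^sub>C ?\<Phi> (?M - 1 - m))"
          by (simp add: coef_deriv_def)
        finally show "(\<Sum>m<?M. g (k, j, m) t) = (\<Sum>m<?M. coef (\<psi> k j m) (L_op \<iota> A UNIV u) t *\<^sub>C ?\<Phi> (?M - 1 - m))" .
      qed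
      finally show "(\<Sum>i\<in>I. g i t) = P_op N J \<mu> \<phi> \<psi> (L_op \<iota> A UNIV u) t" .
    qed
    then show "ae_eq (L_op \<iota> A UNIV (P_op N J \<mu> \<phi> \<psi> u)) (P_op N J \<mu> \<phi> \<psi> (L_op \<iota> A UNIV u))"
      unfolding eqT using S T by simp
  qed

  have deriv: "has_weak_deriv UNIV (coef (\<psi> k j m) u) (adjoint_chain.coef_deriv \<iota> A (lam k) (\<psi> k j) m u)"
    if "u \<in> X_loc \<iota>" "k \<in> {1..N}" "j \<in> {1..J k}" "m < \<mu> k j" for u k j m
    by (rule adjoint_chain.coef_has_weak_deriv[OF chain[OF that(2,3)] that(1,4)])
  have formula: "ae_eq (L_op \<iota> A UNIV (P_op N J \<mu> \<phi> \<psi> u))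
         (\<lambda>t. \<Sum>k=1..N. \<Sum>j=1..J k. \<Sum>m<\<mu> k j.
            (Dt UNIV (coef (\<psi> k j m) u) t - lam k * coef (\<psi> k j m) u t
              - (if m = 0 then 0 else coef (\<psi> k j (m - 1)) u t))
            *\<^sub>C wc_rep (\<phi> k j (\<mu> k j - 1 - m)) t)" if u: "u \<in> X_loc \<iota>" for u
  proof -
    have "AE t in lebesgue. \<forall>(k, j, m)\<in>I. Dt UNIV (coef (\<psi> k j m) u) t = adjoint_chain.coef_deriv \<iota> A (lam k) (\<psi> k j) m u t"
      using Dt_ae_eq[OF deriv[OF u]] finI
      by (intro AE_ball_countable[THEN iffD2]) (auto simp: ae_eq_def I_def countable_finite)
    then show ?thesis
      using main(2)[OF u] unfolding ae_eq_def
    proof eventually_elim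
      case (elim t)
      have "coef (\<psi> k j m) (L_op \<iota> A UNIV u) t = Dt UNIV (coef (\<psi> k j m) u) t - lam k * coef (\<psi> k j m) u t
              - (if m = 0 then 0 else coef (\<psi> k j (m - 1)) u t)"
        if "k \<in> {1..N}" "j \<in> {1..J k}" "m < \<mu> k j" for k j m
        using elim(1)[rule_format, of "(k, j, m)"] that adjoint_chain.coef_deriv_def[OF chain[OF that(1,2)], of m u t]
        by (simp add: I_def)
      then show ?case unfolding elim(2) P_op_def by (intro sum.cong refl) simp
    qed
  qed
  show ?thesis
    using proj main formula deriv unfolding weakly_differentiable_on_def by blast
qed

end
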